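(* Let $0<\alpha<n$, let $\vec q=(q_1,\ldots,q_n)$ and $\vec s=(s_1,\ldots,s_n)$ with $1<q_j<\infty$ and $1<s_j<\infty$ for every $j$, and let $0<p,r<\infty$. Assume that $\frac np\le\sum_{j=1}^n\frac1{q_j}$ and $\frac nr\le\sum_{j=1}^n\frac1{s_j}$. Assume also that $$\frac1r=\frac1p-\frac\alpha n,\qquad\frac{q_j}{p}=\frac{s_j}{r}\quad(j=1,\ldots,n).$$ Then there is a constant $C>0$ such that for all $f\in\mathcal M^p_{\vec q}(\mathbb R^n)$, $$\|I_\alpha f\|_{\mathcal M^r_{\vec s}(\mathbb R^n)}\le C\,\|f\|_{\mathcal M^p_{\vec q}(\mathbb R^n)}.$$
   Context: For $\vec q\in(0,\infty)^n$ the mixed Lebesgue norm is $$\|f\|_{\vec q}=\left(\int_{\mathbb R}\cdots\left(\int_{\mathbb R}\left(\int_{\mathbb R}|f(x_1,\ldots,x_n)|^{q_1}\,dx_1\right)^{q_2/q_1}dx_2\right)^{q_3/q_2}\cdots dx_n\right)^{1/q_n}.$$ For $p\in(0,\infty)$ with $\sum_j1/q_j\ge n/p$, the mixed Morrey norm is $$\|f\|_{\mathcal M^p_{\vec q}(\mathbb R^n)}=\sup_Q|Q|^{\frac1p-\frac1n\sum_{j=1}^n\frac1{q_j}}\|f\chi_Q\|_{\vec q},$$ the supremum being over all cubes $Q\subset\mathbb R^n$ with sides parallel to the coordinate axes, and $\mathcal M^p_{\vec q}(\mathbb R^n)$ is the set of measurable $f$ on $\mathbb R^n$ with $\|f\|_{\mathcal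 M^p_{\vec q}(\mathbb R^n)}<\infty$. The fractional integral operator of order $\alpha$ is $I_\alpha f(x)=\int_{\mathbb R^n}\frac{f(y)}{|x-y|^{n-\alpha}}\,dy$ for $f\in L^1_{\rm loc}(\mathbb R^n)$, as long as the right-hand side makes sense. *)

theory Defs
  imports "HOL-Analysis.Analysis"
begin

(* Real powers on [0,\<infinity>]; only used for exponents a > 0, hence \<infinity>^a = \<infinity> and 0^a = 0. *)
definition enn_powr :: "ennreal \<Rightarrow> real \<Rightarrow> ennreal" where
  "enn_powr x a = (if x = \<infinity> then \<infinity> else ennreal (enn2real x powr a))"

definition upd :: "real ^ 'n \<Rightarrow> 'n \<Rightarrow> real \<Rightarrow> real ^ 'n" where
  "upd x i t = (\<chi> j. if j = i then t else x $ j)"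

(* Integrates out the coordinates in the list one after the other, the head of the list being
   the innermost integral.  The argument b is the exponent of the previously integrated
   coordinate, so that consecutive exponents are q_1, q_2/q_1, ..., q_n/q_(n-1), and 1/q_n at
   the end.  All intermediate functions live on the full space and simply do not
   depend on the coordinates already integrated out. *)
primrec iterated_int ::
    "real ^ 'n \<Rightarrow> real \<Rightarrow> 'n list \<Rightarrow> (real ^ 'n \<Rightarrow> ennreal) \<Rightarrow> real ^ 'n \<Rightarrow> ennreal" where
  "iterated_int q b [] F = (\<lambda>x. enn_powr (F x) (1 / b))"
| "iterated_int q b (i # is) F =
     iterated_int q (q $ i) is (\<lambda>x. \<integral>\<^sup>+ t. enn_powr (F (upd x i t)) (q $ i / b) \<partial>lebesgue)"

(* The coordinates are integrated in increasing order of the index type.  Starting with b = 1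
   makes the innermost integrand |f|^(q_1).  The result is a constant function, evaluated at 0. *)
definition mixed_norm ::
    "real ^ 'n::{finite,linorder} \<Rightarrow> (real ^ 'n::{finite,linorder} \<Rightarrow> complex) \<Rightarrow> ennreal" where
  "mixed_norm q f =
     iterated_int q 1 (sorted_list_of_set UNIV) (\<lambda>x. ennreal (norm (f x))) 0"

definition cubes :: "(real ^ 'n) set set" where
  "cubes = {cbox a (a + vec l) | a l. 0 < l}"

definition morrey_norm ::
    "real \<Rightarrow> real ^ 'n::{finite,linorder} \<Rightarrow> (real ^ 'n::{finite,linorder} \<Rightarrow> complex) \<Rightarrow> ennreal" where
  "morrey_norm p q f =
     (SUP Q\<in>cubes.
        ennreal (measure lebesgue Q powr (1 / p - 1 / real CARD('n) * (\<Sum>j\<in>UNIV. 1 / q $ j)))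
        * mixed_norm q (\<lambda>x. indicator Q x *\<^sub>R f x))"

definition morrey_space ::
    "real \<Rightarrow> real ^ 'n::{finite,linorder} \<Rightarrow> (real ^ 'n::{finite,linorder} \<Rightarrow> complex) set" where
  "morrey_space p q = {f. f \<in> borel_measurable lebesgue \<and> morrey_norm p q f < \<infinity>}"

definition frac_integrand ::
    "real \<Rightarrow> (real ^ 'n \<Rightarrow> complex) \<Rightarrow> real ^ 'n \<Rightarrow> real ^ 'n \<Rightarrow> complex" where
  "frac_integrand \<alpha> f x y = f y / of_real (norm (x - y) powr (real CARD('n) - \<alpha>))"

(* The Bochner integral is 0 where the integrand is not integrable, so statements about
   frac_int must assert separately that the integral exists. *)
definition frac_int ::
    "real \<Rightarrow> (real ^ 'n \<Rightarrow> complex) \<Rightarrow> real ^ 'n \<Rightarrow> complex" where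
  "frac_int \<alpha> f x = (LINT y|lebesgue. frac_integrand \<alpha> f x y)"

end

theory Submission
  imports Defs
begin

text \<open>By Hedberg's argument it suffices to bound a maximal operator on mixed Lebesgue spaces: on a cube
  of side \<open>l\<close>, the part of the potential coming from scales at least \<open>l\<close> is controlled by the Morrey
  norm alone, and the part from scales below \<open>l\<close> by a geometric mean of the Morrey norm and of the maximal
  function of the restriction of \<open>f\<close> to the tripled cube; the relation between the exponents turns the
  \<open>s\<close>-norm of the power \<open>p / r\<close> of the maximal function into a power of its \<open>q\<close>-norm.

  Averages over cubes are dominated by compositions of one-variable maximal operators. Such an operator
  acts on functions with values in a mixed norm space of the inner variables, so a vector-valued
  maximal theorem is needed. It follows by induction on the number of inner variables: when the
  exponent in the active variable equals that of the outermost inner variable, Fubini's theorem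
  removes this inner variable, and for the dyadic maximal function the exponent in the active variable
  can then be changed to any other one in \<open>(1, \<infinity>)\<close>, downwards by a Calderon--Zygmund argument and
  upwards by a good-lambda inequality. The one-third trick passes from dyadic to centered averages.\<close>

section \<open>Powers of extended reals, and the inequalities of Jensen and Minkowski\<close>

text \<open>The mixed norm integrates the variables in a fixed order, so an operator in one variable
  sits between inner variables with other exponents and outer ones. The outer ones cost only
  monotonicity and homogeneity; the inner ones are the obstacle, since no scalar estimate can be
  used for each of their values separately before their norm is taken. The maximal theorem is
  therefore proved for an abstract norm \<rho> on functions of the inner variables. It concerns
  sequences indexed by the integers, on a window of \<open>2 ^ L\<close> integers and with the
  \<open>L + 1\<close> dyadic levels inside it: all sums are finite, all suprema are measurable, and
  absorbing a term into the left side is legitimate once infinite data are set aside. The constants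
  must depend neither on \<open>L\<close>, nor on the mesh of the grid, nor on the point at which
  the iterated norm is evaluated; the mesh can then tend to 0 by monotone convergence. The potential
  is estimated as a nonnegative integral of a Borel function; the Bochner integral enters only at
  the end, and finiteness almost everywhere is deduced from the norm estimate itself.\<close>

lemma enn_powr_ennreal: "0 \<le> x \<Longrightarrow> enn_powr (ennreal x) a = ennreal (x powr a)"
  by (simp add: enn_powr_def)

lemma enn_powr_top [simp]: "enn_powr top a = top"
  by (simp add: enn_powr_def)

lemma enn_powr_zero [simp]: "enn_powr 0 a = 0"
  by (simp add: enn_powr_def)

lemma enn_powr_1 [simp]: "enn_powr x 1 = x"
  by (cases x) (auto simp: enn_powr_ennreal)

lemma enn_powr_mono: "x \<le> y \<Longrightarrow> 0 \<le> a \<Longrightarrow> enn_powr x a \<le> enn_powr y a"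
  by (cases x; cases y) (auto simp: enn_powr_ennreal top_unique intro!: ennreal_leI powr_mono2)

lemma enn_powr_mult: "0 < a \<Longrightarrow> enn_powr (x * y) a = enn_powr x a * enn_powr y a"
  by (cases x; cases y)
    (auto simp: enn_powr_ennreal ennreal_mult_top ennreal_top_mult powr_mult
          simp flip: ennreal_mult)

lemma enn_powr_powr: "enn_powr (enn_powr x a) b = enn_powr x (a * b)"
  by (cases x) (auto simp: enn_powr_ennreal powr_powr)

lemma enn_powr_eq_0_iff [simp]: "enn_powr x a = 0 \<longleftrightarrow> x = 0"
  by (cases x) (auto simp: enn_powr_ennreal)

lemma enn_powr_eq_top_iff [simp]: "enn_powr x a = top \<longleftrightarrow> x = top"
  by (cases x) (auto simp: enn_powr_ennreal)

lemma enn_powr_inverse_cancel: "0 < a \<Longrightarrow> enn_powr (enn_powr x (1 / a)) a = x"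
  by (simp add: enn_powr_powr)

lemma enn_powr_inverse_cancel': "0 < a \<Longrightarrow> enn_powr (enn_powr x a) (1 / a) = x"
  by (simp add: enn_powr_powr)

lemma enn_powr_le_iff: "0 < a \<Longrightarrow> enn_powr x a \<le> enn_powr y a \<longleftrightarrow> x \<le> y"
  by (metis enn_powr_inverse_cancel' enn_powr_mono less_imp_le divide_nonneg_pos zero_le_one)

lemma enn_powr_le_swap: "0 < a \<Longrightarrow> enn_powr x a \<le> y \<longleftrightarrow> x \<le> enn_powr y (1 / a)"
  by (metis enn_powr_inverse_cancel enn_powr_le_iff)

lemma borel_measurable_enn_powr [measurable (raw)]:
  assumes [measurable]: "f \<in> borel_measurable M"
  shows "(\<lambda>x. enn_powr (f x) a) \<in> borel_measurable M"
proof -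
  have 1: "(\<lambda>x. ennreal (enn2real (f x) powr a)) \<in> borel_measurable M"
    by (intro measurable_compose [OF _ measurable_ennreal] powr_real_measurable) simp_all
  have 2: "{x \<in> space M. f x = \<infinity>} \<in> sets M"
    by simp
  show ?thesis
    unfolding enn_powr_def using 1 2 by (intro measurable_If) simp_all
qed

lemma enn_powr_SUP:
  assumes "0 < a" "I \<noteq> {}"
  shows "enn_powr (SUP i\<in>I. f i) a = (SUP i\<in>I. enn_powr (f i) a)"
proof (rule antisym)
  have "f i \<le> enn_powr (SUP i\<in>I. enn_powr (f i) a) (1 / a)" if "i \<in> I" for i
    using that assms by (subst enn_powr_le_swap [symmetric]) (auto intro: SUP_upper)
  then have "(SUP i\<in>I. f i) \<le> enn_powr (SUP i\<in>I. enn_powr (f i) a) (1 / a)"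
    by (rule SUP_least)
  then show "enn_powr (SUP i\<in>I. f i) a \<le> (SUP i\<in>I. enn_powr (f i) a)"
    using assms by (simp add: enn_powr_le_swap)
  show "(SUP i\<in>I. enn_powr (f i) a) \<le> enn_powr (SUP i\<in>I. f i) a"
    using assms by (intro SUP_least enn_powr_mono SUP_upper) auto
qed

text \<open>Weighted Young inequality, with equality at \<open>k = c * v\<close>. The right side is
  linear in \<open>k powr q * v powr (1 - q)\<close> and in \<open>v\<close>, so it can be
  integrated for fixed \<open>c\<close>, and \<open>c\<close> can be chosen afterwards.\<close>

lemma powr_tangent_le:
  fixes k c v q :: real
  assumes "0 \<le> k" "0 < c" "0 < v" "1 < q"
  shows "k \<le> (1 / q) * (c powr (1 - q) * (k powr q * v powr (1 - q))) + (1 - 1 / q) * (c * v)"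
proof -
  \<comment> \<open>This \<open>b\<close> makes its conjugate power, the second Young term, equal to
    \<open>c * v\<close>.\<close>
  define b where "b = (c * v) powr (1 - 1 / q)"
  have b: "0 < b" using assms by (simp add: b_def)
  have "(k / b) * b \<le> (k / b) powr q / q + b powr (q / (q - 1)) / (q / (q - 1))"
    by (rule Youngs_inequality) (use assms b in \<open>auto simp: field_simps\<close>)
  moreover have "b powr (q / (q - 1)) = c * v"
  proof -
    have "(1 - 1 / q) * (q / (q - 1)) = 1" using assms by (simp add: field_simps)
    then show ?thesis using assms unfolding b_def powr_powr by simp
  qed
  moreover have "(k / b) powr q = c powr (1 - q) * (k powr q * v powr (1 - q))"
  proof -
    have "(1 - 1 / q) * q = q - 1" using assms by (simp add: field_simps)
    then have "b powr q = (c * v) powr (q - 1)"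
      unfolding b_def powr_powr by simp
    moreover have "(k / b) powr q = k powr q / b powr q"
      using assms b by (simp add: powr_divide)
    moreover have "(c * v) powr (q - 1) = 1 / (c powr (1 - q) * v powr (1 - q))"
      using assms by (simp add: powr_mult powr_diff)
    ultimately show ?thesis by simp
  qed
  ultimately show ?thesis
    using assms b by (simp add: field_simps)
qed

text \<open>Hoelder's inequality for
  \<open>k = (k * v powr (1 / q - 1)) * v powr (1 - 1 / q)\<close>, obtained by integrating
  \<open>powr_tangent_le\<close>. With \<open>v = 1\<close> on a probability space it is Jensen's
  inequality; the general weight is what gives access to Minkowski's inequality.\<close>

lemma nn_integral_Jensen:
  fixes k :: "'a \<Rightarrow> ennreal" and v :: "'a \<Rightarrow> real"
  assumes [measurable]: "k \<in> borel_measurable M" "v \<in> borel_measurable M"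
    and v: "\<And>x. 0 < v x" and V: "(\<integral>\<^sup>+x. ennreal (v x) \<partial>M) < \<infinity>" and q: "1 \<le> q"
  shows "enn_powr (\<integral>\<^sup>+x. k x \<partial>M) q
    \<le> (\<integral>\<^sup>+x. enn_powr (k x) q * ennreal (v x powr (1 - q)) \<partial>M)
       * enn_powr (\<integral>\<^sup>+x. ennreal (v x) \<partial>M) (q - 1)"
proof -
  have K_zero: "(\<integral>\<^sup>+x. k x \<partial>M) = 0" if "(\<integral>\<^sup>+x. ennreal (v x) \<partial>M) = 0"
  proof -
    have "AE x in M. ennreal (v x) = 0"
      using that by (subst (asm) nn_integral_0_iff_AE) auto
    then have "AE x in M. k x = 0"
      by eventually_elim (use v in \<open>simp add: ennreal_eq_0_iff not_le [symmetric]\<close>)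
    then show ?thesis by (subst nn_integral_0_iff_AE) auto
  qed
  show ?thesis
  proof (cases "q = 1")
    case True
    have v0: "v x \<noteq> 0" for x using v [of x] by simp
    \<comment> \<open>For \<open>q = 1\<close> the last factor has exponent 0, and
      \<open>enn_powr\<close> gives 0 rather than 1 at the base 0; a weight of total mass 0 is
      therefore covered by \<open>K_zero\<close>.\<close>
    have "enn_powr y 0 = 1" if "y \<noteq> 0" "y \<noteq> \<infinity>" for y :: ennreal
      using that by (cases y) (auto simp: enn_powr_ennreal)
    moreover have "(\<integral>\<^sup>+x. enn_powr (k x) q * ennreal (v x powr (1 - q)) \<partial>M) = (\<integral>\<^sup>+x. k x \<partial>M)"
      using True v0 by simp
    ultimately show ?thesis
      using True V K_zero by (cases "(\<integral>\<^sup>+x. ennreal (v x) \<partial>M) = 0") simp_all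
  next
    case False
    then have q: "1 < q" using q by simp
    define A where "A = (\<integral>\<^sup>+x. enn_powr (k x) q * ennreal (v x powr (1 - q)) \<partial>M)"
    define V' where "V' = (\<integral>\<^sup>+x. ennreal (v x) \<partial>M)"
    define K where "K = (\<integral>\<^sup>+x. k x \<partial>M)"
    have pt: "k x \<le> ennreal (1 / q * c powr (1 - q)) * (enn_powr (k x) q * ennreal (v x powr (1 - q)))
          + ennreal ((1 - 1 / q) * c) * ennreal (v x)" if c: "0 < c" for x c
    proof (cases "k x")
      case (real r)
      then show ?thesis
        using powr_tangent_le [of r c "v x" q] q v [of x] c
        by (simp add: enn_powr_ennreal mult.assoc flip: ennreal_mult ennreal_plus)
    next
      case top
      then show ?thesis using v [of x] q c by (simp add: ennreal_mult_top ennreal_top_mult)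
    qed
    have int: "K \<le> ennreal (1 / q * c powr (1 - q)) * A + ennreal ((1 - 1 / q) * c) * V'"
      if c: "0 < c" for c
    proof -
      let ?f = "\<lambda>x. enn_powr (k x) q * ennreal (v x powr (1 - q))"
      have [measurable]: "?f \<in> borel_measurable M"
        by (intro borel_measurable_times_ennreal borel_measurable_enn_powr
            measurable_compose [OF _ measurable_ennreal] powr_real_measurable) simp_all
      have "K \<le> (\<integral>\<^sup>+x. ennreal (1 / q * c powr (1 - q)) * ?f x + ennreal ((1 - 1 / q) * c) * ennreal (v x) \<partial>M)"
        unfolding K_def by (rule nn_integral_mono) (rule pt [OF c])
      also have "\<dots> = ennreal (1 / q * c powr (1 - q)) * A + ennreal ((1 - 1 / q) * c) * V'"
        unfolding A_def V'_def by (subst nn_integral_add) (simp_all add: nn_integral_cmult)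
      finally show ?thesis .
    qed
    have "enn_powr K q \<le> A * enn_powr V' (q - 1)"
    proof (cases "V' = 0 \<or> K = 0")
      case True
      then show ?thesis using K_zero by (auto simp: K_def V'_def)
    next
      case False
      obtain V where Vr: "V' = ennreal V" "0 < V"
        using False V unfolding V'_def [symmetric] by (cases V') (auto simp: less_le)
      show ?thesis
      proof (cases K)
        case top
        have "A = \<infinity>"
        proof (rule ccontr)
          assume "A \<noteq> \<infinity>"
          then have "ennreal (1 / q * 1 powr (1 - q)) * A + ennreal ((1 - 1 / q) * 1) * V' < \<infinity>"
            using Vr by (simp add: ennreal_mult_less_top less_top)
          then have "K < \<infinity>" by (intro le_less_trans [OF int [of 1]]) simp_all
          then show False using top by simp
        qed
        then show ?thesis using Vr by (simp add: enn_powr_ennreal ennreal_top_mult)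
      next
        case (real r)
        then have r: "0 < r" using False by (auto simp: less_le)
        show ?thesis
        proof (cases A)
          case top
          then show ?thesis using Vr by (simp add: enn_powr_ennreal ennreal_top_mult)
        next
          case A: (real a)
          \<comment> \<open>The ratio of the total masses, which is the slope in the equality case
            \<open>k = c * v\<close>. It makes \<open>c * V\<close> equal to \<open>r\<close>, so
            the second term can be moved to the left side.\<close>
          define c where "c = r / V"
          have c: "0 < c" using r Vr by (simp add: c_def)
          have "ennreal r \<le> ennreal (1 / q * c powr (1 - q) * a + (1 - 1 / q) * c * V)"
            using int [OF c] q A Vr real c
            by (simp flip: ennreal_mult ennreal_plus)
          then have "r \<le> 1 / q * c powr (1 - q) * a + (1 - 1 / q) * c * V"
            using q A Vr c by (subst (asm) ennreal_le_iff) auto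
          moreover have "c * V = r" using Vr by (simp add: c_def)
          ultimately have "r \<le> 1 / q * c powr (1 - q) * a + (1 - 1 / q) * r"
            by (simp add: mult.assoc)
          then have "r / q \<le> c powr (1 - q) * a / q" by (simp add: algebra_simps)
          then have "r \<le> c powr (1 - q) * a" using q by (simp add: divide_le_cancel)
          then have "r * r powr (q - 1) \<le> c powr (1 - q) * a * r powr (q - 1)"
            by (intro mult_right_mono) auto
          moreover have "r * r powr (q - 1) = r powr q" using r by (simp add: powr_diff)
          moreover have "c powr (1 - q) * r powr (q - 1) = V powr (q - 1)"
            using r Vr by (simp add: c_def powr_divide powr_diff field_simps)
          ultimately have "r powr q \<le> a * V powr (q - 1)" by (simp add: mult_ac)
          then show ?thesis
            using A Vr real r by (simp add: enn_powr_ennreal flip: ennreal_mult)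
        qed
      qed
    qed
    then show ?thesis unfolding K_def A_def V'_def .
  qed
qed

text \<open>No duality: Jensen in \<open>s\<close> is applied with the norm \<open>w s\<close> of
  the slice as weight \<open>v\<close>, the integrals are exchanged, and
  \<open>w powr q * v powr (1 - q)\<close> is again at most \<open>v\<close>. The result is
  \<open>V * V powr (q - 1)\<close>.\<close>

lemma nn_integral_Minkowski:
  fixes k :: "'a \<Rightarrow> 'b \<Rightarrow> ennreal"
  assumes M: "finite_measure M" and N: "sigma_finite_measure N"
    and k: "(\<lambda>(s, t). k s t) \<in> borel_measurable (M \<Otimes>\<^sub>M N)" and q: "1 \<le> q"
  shows "enn_powr (\<integral>\<^sup>+t. enn_powr (\<integral>\<^sup>+s. k s t \<partial>M) q \<partial>N) (1 / q)
    \<le> (\<integral>\<^sup>+s. enn_powr (\<integral>\<^sup>+t. enn_powr (k s t) q \<partial>N) (1 / q) \<partial>M)"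
proof -
  let ?I = "\<integral>\<^sup>+t. enn_powr (\<integral>\<^sup>+s. k s t \<partial>M) q \<partial>N"
  interpret M: finite_measure M by fact
  interpret N: sigma_finite_measure N by fact
  interpret MN: pair_sigma_finite M N ..
  define w where "w s = enn_powr (\<integral>\<^sup>+t. enn_powr (k s t) q \<partial>N) (1 / q)" for s
  define W where "W = (\<integral>\<^sup>+s. w s \<partial>M)"
  have wq: "enn_powr (w s) q = (\<integral>\<^sup>+t. enn_powr (k s t) q \<partial>N)" for s
    using q by (simp add: w_def enn_powr_powr)
  have kq: "(\<lambda>(s, t). enn_powr (k s t) q) \<in> borel_measurable (M \<Otimes>\<^sub>M N)"
    using borel_measurable_enn_powr [OF k, of q] by (simp add: case_prod_unfold)
  have w [measurable]: "w \<in> borel_measurable M"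
    unfolding w_def using N.borel_measurable_nn_integral [OF kq]
    by (intro borel_measurable_enn_powr) simp
  have ks: "(\<lambda>s. k s t) \<in> borel_measurable M" if "t \<in> space N" for t
    using measurable_compose [OF measurable_Pair2' [OF that] k] by simp
  show ?thesis
  proof (cases "W = \<infinity>")
    case True
    then show ?thesis by (simp add: W_def w_def)
  next
    case False
    have fin: "AE s in M. w s < \<infinity>"
      using nn_integral_PInf_AE [OF w] False unfolding W_def by (auto simp: less_top)
    have main: "?I \<le> enn_powr (W + ennreal e * emeasure M (space M)) q"
      if e: "0 < e" for e :: real
    proof -
      \<comment> \<open>The weight must be strictly positive with finite integral, hence the shift
        by \<open>e\<close>; finiteness of \<open>M\<close> keeps the contribution of the shift
        small.\<close>
      define v where "v s = enn2real (w s) + e" for s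
      have v [measurable]: "v \<in> borel_measurable M" unfolding v_def by measurable
      have v0: "0 < v s" for s using e by (simp add: v_def add_nonneg_pos)
      have vw: "AE s in M. ennreal (v s) = w s + ennreal e"
        using fin
      proof eventually_elim
        case (elim s)
        then show ?case using e by (cases "w s") (auto simp: v_def)
      qed
      define V where "V = (\<integral>\<^sup>+s. ennreal (v s) \<partial>M)"
      have V: "V = W + ennreal e * emeasure M (space M)"
        unfolding V_def using vw e by (subst nn_integral_cong_AE [OF vw]) (simp add: W_def nn_integral_add)
      have Vfin: "V < \<infinity>"
        unfolding V using False M.emeasure_finite [of "space M"]
        by (simp add: less_top [symmetric] ennreal_mult_eq_top_iff)
      have meas: "(\<lambda>(s, t). enn_powr (k s t) q * ennreal (v s powr (1 - q))) \<in> borel_measurable (M \<Otimes>\<^sub>M N)"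
      proof -
        have "(\<lambda>x. ennreal (v (fst x) powr (1 - q))) \<in> borel_measurable (M \<Otimes>\<^sub>M N)"
          by (intro measurable_compose [OF _ measurable_ennreal] powr_real_measurable
                measurable_compose [OF measurable_fst v]) simp_all
        then show ?thesis using kq
          by (simp add: case_prod_unfold borel_measurable_times_ennreal)
      qed
      have "?I
        \<le> (\<integral>\<^sup>+t. (\<integral>\<^sup>+s. enn_powr (k s t) q * ennreal (v s powr (1 - q)) \<partial>M) * enn_powr V (q - 1) \<partial>N)"
        unfolding V_def using ks v v0 Vfin q
        by (intro nn_integral_mono nn_integral_Jensen) (auto simp: V_def)
      also have "\<dots> = (\<integral>\<^sup>+t. (\<integral>\<^sup>+s. enn_powr (k s t) q * ennreal (v s powr (1 - q)) \<partial>M) \<partial>N) * enn_powr V (q - 1)"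
        using M.borel_measurable_nn_integral [of "\<lambda>t s. enn_powr (k s t) q * ennreal (v s powr (1 - q))" N]
          measurable_pair_swap [OF meas] by (intro nn_integral_multc) simp_all
      also have "(\<integral>\<^sup>+t. (\<integral>\<^sup>+s. enn_powr (k s t) q * ennreal (v s powr (1 - q)) \<partial>M) \<partial>N)
        = (\<integral>\<^sup>+s. (\<integral>\<^sup>+t. enn_powr (k s t) q * ennreal (v s powr (1 - q)) \<partial>N) \<partial>M)"
        using MN.Fubini' [OF meas] by simp
      also have "\<dots> = (\<integral>\<^sup>+s. enn_powr (w s) q * ennreal (v s powr (1 - q)) \<partial>M)"
      proof (rule nn_integral_cong)
        fix s assume s: "s \<in> space M"
        have "(\<lambda>t. enn_powr (k s t) q) \<in> borel_measurable N"
          using measurable_compose [OF measurable_Pair1' [OF s] kq] by simp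
        then show "(\<integral>\<^sup>+t. enn_powr (k s t) q * ennreal (v s powr (1 - q)) \<partial>N)
          = enn_powr (w s) q * ennreal (v s powr (1 - q))"
          unfolding wq by (rule nn_integral_multc)
      qed
      also have "\<dots> \<le> (\<integral>\<^sup>+s. ennreal (v s) \<partial>M)"
      proof (rule nn_integral_mono_AE)
        show "AE s in M. enn_powr (w s) q * ennreal (v s powr (1 - q)) \<le> ennreal (v s)"
          using fin
        proof eventually_elim
          case (elim s)
          then obtain r where r: "w s = ennreal r" "0 \<le> r" by (cases "w s") auto
          then have "r \<le> v s" using e by (simp add: v_def)
          then have "r powr q * v s powr (1 - q) \<le> v s powr q * v s powr (1 - q)"
            using r q by (intro mult_right_mono powr_mono2) auto
          also have "\<dots> = v s" using v0 [of s] by (simp flip: powr_add)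
          finally show ?case using r by (simp add: enn_powr_ennreal ennreal_leI flip: ennreal_mult)
        qed
      qed
      finally have "?I \<le> V * enn_powr V (q - 1)"
        unfolding V_def [symmetric] by (simp add: mult_right_mono)
      also have "\<dots> \<le> enn_powr V q"
        by (cases V) (auto simp: enn_powr_ennreal powr_diff intro!: ennreal_leI simp flip: ennreal_mult)
      finally show ?thesis unfolding V .
    qed
    have "enn_powr ?I (1 / q) \<le> W"
    proof (rule ennreal_le_epsilon)
      fix e :: real assume e: "0 < e"
      define m where "m = measure M (space M)"
      have m: "emeasure M (space M) = ennreal m" "0 \<le> m"
        by (simp_all add: m_def M.emeasure_eq_measure)
      have "enn_powr ?I (1 / q)
        \<le> W + ennreal (e / (m + 1)) * emeasure M (space M)"
        using main [of "e / (m + 1)"] e m q by (subst enn_powr_le_swap) simp_all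
      also have "\<dots> \<le> W + ennreal e"
        using e m by (intro add_left_mono) (auto simp: field_simps intro!: ennreal_leI simp flip: ennreal_mult)
      finally show "enn_powr ?I (1 / q) \<le> W + ennreal e" .
    qed
    then show ?thesis by (simp add: W_def w_def)
  qed
qed

section \<open>Dyadic blocks of integers\<close>

text \<open>The dyadic block of length \<open>2 ^ l\<close> around \<open>m\<close>. Since
  \<open>div\<close> rounds towards minus infinity, the blocks tile all integers without a break at
  0.\<close>

definition blk :: "nat \<Rightarrow> int \<Rightarrow> int set" where
  "blk l m = {i. i div 2 ^ l = m div 2 ^ l}"

definition av :: "nat \<Rightarrow> (int \<Rightarrow> ennreal) \<Rightarrow> int \<Rightarrow> ennreal" where
  "av l a m = ennreal (1 / 2 ^ l) * (\<Sum>i\<in>blk l m. a i)"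

text \<open>Levels start at 0, where the average is the value itself, and stop at \<open>L\<close>,
  so on a block of level \<open>L\<close> the function depends only on the values in that
  block.\<close>

definition mx :: "nat \<Rightarrow> (int \<Rightarrow> ennreal) \<Rightarrow> int \<Rightarrow> ennreal" where
  "mx L a m = (SUP l\<in>{..L}. av l a m)"

lemma blk_eq: "blk l m = {m div 2 ^ l * 2 ^ l ..< m div 2 ^ l * 2 ^ l + 2 ^ l}"
proof -
  have "i div 2 ^ l = b \<longleftrightarrow> b * 2 ^ l \<le> i \<and> i < b * 2 ^ l + 2 ^ l" for i b :: int
  proof
    assume "i div 2 ^ l = b"
    then have "b * 2 ^ l + i mod 2 ^ l = i"
      using div_mult_mod_eq [of i "2 ^ l"] by simp
    moreover have "0 \<le> i mod 2 ^ l" "i mod 2 ^ l < 2 ^ l" by simp_all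
    ultimately show "b * 2 ^ l \<le> i \<and> i < b * 2 ^ l + 2 ^ l" by linarith
  next
    assume "b * 2 ^ l \<le> i \<and> i < b * 2 ^ l + 2 ^ l"
    then show "i div 2 ^ l = b"
      by (intro int_div_pos_eq [of _ _ _ "i - b * 2 ^ l"]) (auto simp: algebra_simps)
  qed
  then show ?thesis by (auto simp: blk_def)
qed

lemma finite_blk [simp]: "finite (blk l m)"
  by (simp add: blk_eq)

lemma card_blk: "card (blk l m) = 2 ^ l"
  by (simp add: blk_eq nat_power_eq)

lemma self_in_blk [simp]: "m \<in> blk l m"
  by (simp add: blk_def)

lemma blk_eqI: "i \<in> blk l m \<Longrightarrow> blk l i = blk l m"
  by (auto simp: blk_def)

lemma blk_sym: "i \<in> blk l m \<longleftrightarrow> m \<in> blk l i"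
  by (auto simp: blk_def)

lemma blk_0 [simp]: "blk 0 m = {m}"
  by (auto simp: blk_def)

lemma blk_mono: "l \<le> l' \<Longrightarrow> blk l m \<subseteq> blk l' m"
proof
  fix i assume l: "l \<le> l'" and i: "i \<in> blk l m"
  have "j div 2 ^ l' = j div 2 ^ l div 2 ^ (l' - l)" for j :: int
    using l by (simp add: zdiv_zmult2_eq [symmetric] power_add [symmetric])
  then show "i \<in> blk l' m" using i by (simp add: blk_def)
qed

lemma av_cong_blk: "i \<in> blk l m \<Longrightarrow> av l a i = av l a m"
  by (simp add: av_def blk_eqI)

lemma av_0 [simp]: "av 0 a m = a m"
  by (simp add: av_def)

lemma av_mono: "(\<And>i. i \<in> blk l m \<Longrightarrow> a i \<le> b i) \<Longrightarrow> av l a m \<le> av l b m"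
  unfolding av_def by (intro mult_left_mono sum_mono) auto

lemma two_power_cancel: "ennreal (1 / 2 ^ l) * (2 ^ l * x) = x"
proof -
  have "ennreal (1 / 2 ^ l) * 2 ^ l = ennreal (1 / 2 ^ l * 2 ^ l)"
    by (subst ennreal_mult) (simp_all add: ennreal_power [symmetric])
  then show ?thesis by (simp flip: mult.assoc)
qed

lemma av_const: "av l (\<lambda>i. c) m = c"
  by (simp add: av_def card_blk two_power_cancel)

lemma av_le_double: "av l a m \<le> 2 * av (Suc l) a m"
proof -
  have "ennreal (1 / 2 ^ l) = 2 * ennreal (1 / 2 ^ Suc l)"
    by (simp add: ennreal_mult [symmetric] flip: ennreal_numeral)
  moreover have "sum a (blk l m) \<le> sum a (blk (Suc l) m)"
    by (intro sum_mono2 blk_mono) auto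
  ultimately show ?thesis
    by (simp add: av_def mult.assoc mult_left_mono)
qed

lemma av_le_mx: "l \<le> L \<Longrightarrow> av l a m \<le> mx L a m"
  unfolding mx_def by (rule SUP_upper) simp

lemma mx_gr_iff: "x < mx L a m \<longleftrightarrow> (\<exists>l\<le>L. x < av l a m)"
  unfolding mx_def by (auto simp: less_SUP_iff)

lemma mx_finite: "(\<And>i. i \<in> blk L m \<Longrightarrow> a i < \<infinity>) \<Longrightarrow> mx L a m < \<infinity>"
proof -
  assume a: "\<And>i. i \<in> blk L m \<Longrightarrow> a i < \<infinity>"
  have av: "av l a m < \<infinity>" if "l \<le> L" for l
    using a blk_mono [OF that, of m] by (auto simp: av_def ennreal_mult_less_top)
  have "mx L a m \<le> (\<Sum>l\<le>L. av l a m)"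
    unfolding mx_def by (intro SUP_least member_le_sum) auto
  also have "\<dots> < \<infinity>" using av by auto
  finally show ?thesis .
qed

text \<open>A level for every point such that the blocks \<open>blk (\<tau> m) m\<close> partition
  the integers: two of them that meet have the same level and coincide.\<close>

definition stopping :: "nat \<Rightarrow> (int \<Rightarrow> nat) \<Rightarrow> bool" where
  "stopping L \<tau> \<longleftrightarrow> (\<forall>m. \<tau> m \<le> L) \<and> (\<forall>m. \<forall>i\<in>blk (\<tau> m) m. \<tau> i = \<tau> m)"

text \<open>Averaging over the members of a partition preserves sums over their unions, and a block
  of level \<open>L\<close> is such a union because \<tau> is at most \<open>L\<close>. The
  computation exchanges a double sum, as lying in the same member is a symmetric relation.\<close>

lemma sum_av_stopping:
  assumes "stopping L \<tau>"
  shows "(\<Sum>j\<in>blk L m. av (\<tau> j) h j) = (\<Sum>j\<in>blk L m. h j)"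
proof -
  have sub: "blk (\<tau> j) j \<subseteq> blk L m" if "j \<in> blk L m" for j
  proof -
    have "\<tau> j \<le> L" using assms by (simp add: stopping_def)
    then show ?thesis using blk_mono [of "\<tau> j" L j] blk_eqI [OF that] by simp
  qed
  have "(\<Sum>j\<in>blk L m. av (\<tau> j) h j)
    = (\<Sum>j\<in>blk L m. \<Sum>i\<in>blk L m. if i \<in> blk (\<tau> j) j then ennreal (1 / 2 ^ \<tau> j) * h i else 0)"
  proof (rule sum.cong [OF refl])
    fix j assume j: "j \<in> blk L m"
    have "(\<Sum>i\<in>blk L m. if i \<in> blk (\<tau> j) j then ennreal (1 / 2 ^ \<tau> j) * h i else 0)
      = (\<Sum>i\<in>blk L m \<inter> blk (\<tau> j) j. ennreal (1 / 2 ^ \<tau> j) * h i)"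
      by (simp add: sum.inter_restrict)
    also have "blk L m \<inter> blk (\<tau> j) j = blk (\<tau> j) j" using sub [OF j] by blast
    finally show "av (\<tau> j) h j = (\<Sum>i\<in>blk L m. if i \<in> blk (\<tau> j) j then ennreal (1 / 2 ^ \<tau> j) * h i else 0)"
      by (simp add: av_def sum_distrib_left)
  qed
  also have "\<dots> = (\<Sum>i\<in>blk L m. \<Sum>j\<in>blk L m. if i \<in> blk (\<tau> j) j then ennreal (1 / 2 ^ \<tau> j) * h i else 0)"
    by (rule sum.swap)
  also have "\<dots> = (\<Sum>i\<in>blk L m. \<Sum>j\<in>blk L m. if j \<in> blk (\<tau> i) i then ennreal (1 / 2 ^ \<tau> i) * h i else 0)"
  proof (intro sum.cong refl)
    fix i j
    have "\<tau> i = \<tau> j" if "i \<in> blk (\<tau> j) j \<or> j \<in> blk (\<tau> i) i"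
      using assms that by (auto simp: stopping_def)
    then have "i \<in> blk (\<tau> j) j \<longleftrightarrow> j \<in> blk (\<tau> i) i" "i \<in> blk (\<tau> j) j \<Longrightarrow> \<tau> i = \<tau> j"
      using blk_sym [of i "\<tau> j" j] by auto
    then show "(if i \<in> blk (\<tau> j) j then ennreal (1 / 2 ^ \<tau> j) * h i else 0)
      = (if j \<in> blk (\<tau> i) i then ennreal (1 / 2 ^ \<tau> i) * h i else 0)" by auto
  qed
  also have "\<dots> = (\<Sum>i\<in>blk L m. h i)"
  proof (rule sum.cong [OF refl])
    fix i assume i: "i \<in> blk L m"
    have "(\<Sum>j\<in>blk L m. if j \<in> blk (\<tau> i) i then ennreal (1 / 2 ^ \<tau> i) * h i else 0)
      = (\<Sum>j\<in>blk L m \<inter> blk (\<tau> i) i. ennreal (1 / 2 ^ \<tau> i) * h i)"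
      by (rule sum.inter_restrict [symmetric]) simp
    also have "blk L m \<inter> blk (\<tau> i) i = blk (\<tau> i) i" using sub [OF i] by blast
    also have "(\<Sum>j\<in>blk (\<tau> i) i. ennreal (1 / 2 ^ \<tau> i) * h i) = h i"
      using two_power_cancel [of "\<tau> i" "h i"] by (simp add: card_blk mult_ac)
    finally show "(\<Sum>j\<in>blk L m. if j \<in> blk (\<tau> i) i then ennreal (1 / 2 ^ \<tau> i) * h i else 0) = h i" .
  qed
  finally show ?thesis .
qed

text \<open>Level 0, where averaging does nothing, stands for never stopping.\<close>

definition stop_level :: "nat \<Rightarrow> (nat \<Rightarrow> int \<Rightarrow> bool) \<Rightarrow> int \<Rightarrow> nat" where
  "stop_level L P m = (if \<exists>l\<le>L. P l m then GREATEST l. l \<le> L \<and> P l m else 0)"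

lemma stop_level_holds:
  assumes "l \<le> L" "P l m"
  shows "P (stop_level L P m) m" "l \<le> stop_level L P m"
proof -
  have *: "l \<le> L \<and> P l m" using assms by simp
  have e: "\<exists>l\<le>L. P l m" using assms by blast
  show "P (stop_level L P m) m"
    using GreatestI_nat [of "\<lambda>l. l \<le> L \<and> P l m", OF *] e by (auto simp: stop_level_def)
  show "l \<le> stop_level L P m"
    using Greatest_le_nat [of "\<lambda>l. l \<le> L \<and> P l m", OF *] e by (auto simp: stop_level_def)
qed

lemma stop_level_le: "stop_level L P m \<le> L"
proof (cases "\<exists>l\<le>L. P l m")
  case True
  then obtain l where *: "l \<le> L \<and> P l m" by blast
  show ?thesis
    using GreatestI_nat [of "\<lambda>l. l \<le> L \<and> P l m", OF *] True by (auto simp: stop_level_def)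
next
  case False
  then show ?thesis unfolding stop_level_def by (simp only: if_False)
qed

lemma stop_level_above: "stop_level L P m < l \<Longrightarrow> l \<le> L \<Longrightarrow> \<not> P l m"
  using stop_level_holds(2) [of l L P m] by auto

text \<open>If \<open>i\<close> lies in the block selected at \<open>m\<close>, then
  \<open>P\<close> holds for this block at \<open>i\<close>, so the level at \<open>i\<close> is at
  least as large; its block then contains \<open>m\<close>, and maximality at \<open>m\<close> gives
  equality. Where nothing is selected the block is a single point.\<close>

lemma stopping_stop_level:
  assumes P: "\<And>l m i. i \<in> blk l m \<Longrightarrow> P l i = P l m"
  shows "stopping L (stop_level L P)"
  unfolding stopping_def
proof safe
  fix m i assume i: "i \<in> blk (stop_level L P m) m"
  show "stop_level L P i = stop_level L P m"
  proof (cases "\<exists>l\<le>L. P l m")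
    case True
    then have "P (stop_level L P m) m" using stop_level_holds(1) by blast
    then have Pi: "P (stop_level L P m) i" using P [OF i] by simp
    have 1: "stop_level L P m \<le> stop_level L P i"
      using stop_level_holds(2) [of "stop_level L P m" L P i, OF stop_level_le Pi] .
    have "P (stop_level L P i) i"
      using stop_level_holds(1) [of "stop_level L P m" L P i, OF stop_level_le Pi] .
    moreover have "i \<in> blk (stop_level L P i) m"
      using blk_mono [OF 1] i by blast
    ultimately have "P (stop_level L P i) m" using P by simp
    then show ?thesis using stop_level_holds(2) [of "stop_level L P i" L P m, OF stop_level_le] 1 by simp
  next
    case False
    then have "stop_level L P m = 0" unfolding stop_level_def by (simp only: if_False)
    then show ?thesis using i by simp
  qed
qed (rule stop_level_le)

text \<open>The set where the maximal function exceeds \<open>l\<close> is a union of maximal blocks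
  with average above \<open>l\<close>. The sum on the right runs over this set only; this
  localisation is what allows a power of the maximal function to be absorbed in
  \<open>good_inequality\<close>.\<close>

lemma mx_weak_type:
  "l * card {j \<in> blk L m. l < mx L F j} \<le> (\<Sum>j\<in>{j \<in> blk L m. l < mx L F j}. F j)"
  for l :: ennreal
proof -
  define P where "P k j \<longleftrightarrow> l < av k F j" for k j
  define \<tau> where "\<tau> = stop_level L P"
  have stop: "stopping L \<tau>"
    unfolding \<tau>_def by (rule stopping_stop_level) (simp add: P_def av_cong_blk)
  let ?U = "\<lambda>j. l < mx L F j"
  have U: "?U j \<longleftrightarrow> P (\<tau> j) j" for j
    unfolding mx_gr_iff \<tau>_def
    by (metis P_def stop_level_holds(1) stop_level_le)
  have Ublk: "?U i \<longleftrightarrow> ?U j" if "i \<in> blk (\<tau> j) j" for i j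
  proof -
    have "\<tau> i = \<tau> j" using stop that by (auto simp: stopping_def)
    then show ?thesis using that by (simp add: U P_def av_cong_blk)
  qed
  have "l * card {j \<in> blk L m. ?U j} = (\<Sum>j\<in>{j \<in> blk L m. ?U j}. l)"
    by (simp add: mult.commute)
  also have "\<dots> \<le> (\<Sum>j\<in>{j \<in> blk L m. ?U j}. av (\<tau> j) F j)"
    by (intro sum_mono) (auto simp: U P_def)
  also have "\<dots> = (\<Sum>j\<in>blk L m. if ?U j then av (\<tau> j) F j else 0)"
    by (simp add: sum.inter_filter)
  also have "\<dots> = (\<Sum>j\<in>blk L m. av (\<tau> j) (\<lambda>i. if ?U i then F i else 0) j)"
    by (intro sum.cong refl) (auto simp: av_def Ublk cong: sum.cong)
  also have "\<dots> = (\<Sum>j\<in>blk L m. if ?U j then F j else 0)"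
    by (rule sum_av_stopping [OF stop])
  also have "\<dots> = (\<Sum>j\<in>{j \<in> blk L m. ?U j}. F j)"
    by (simp add: sum.inter_filter)
  finally show ?thesis .
qed

section \<open>Good-lambda inequalities\<close>

lemma nn_integral_powr_below:
  fixes a r :: real
  assumes "0 < a" "0 \<le> r"
  shows "(\<integral>\<^sup>+l. ennreal (a * l powr (a - 1)) * indicator {0<..<r} l \<partial>lborel) = ennreal (r powr a)"
proof -
  have "((\<lambda>l. a * l powr (a - 1)) has_integral (a * (r powr (a - 1 + 1) / (a - 1 + 1)))) {0..r}"
    using assms by (intro has_integral_mult_right has_integral_powr_from_0) auto
  then have "((\<lambda>l. a * l powr (a - 1)) has_integral r powr a) {0..r}"
    using assms by simp
  then have "((\<lambda>l. a * l powr (a - 1)) has_integral r powr a) {0<..<r}"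
    by (simp add: has_integral_Icc_iff_Ioo)
  then show ?thesis
    using assms by (intro nn_integral_has_integral_lebesgue') auto
qed

lemma nn_integral_powr_above:
  fixes a r :: real
  assumes "0 < a" "0 < r"
  shows "(\<integral>\<^sup>+l. ennreal (l powr (- a - 1)) * indicator {r..} l \<partial>lborel) = ennreal (r powr (- a) / a)"
proof -
  have "((\<lambda>l. l powr (- a - 1)) has_integral - (r powr (- a - 1 + 1)) / (- a - 1 + 1)) {r..}"
    using assms by (intro has_integral_powr_to_inf) auto
  then have "((\<lambda>l. l powr (- a - 1)) has_integral r powr (- a) / a) {r..}" by simp
  then show ?thesis
    by (intro nn_integral_has_integral_lebesgue') auto
qed

lemma sum_indicator_less:
  "finite J \<Longrightarrow> (\<Sum>j\<in>J. c * indicator {0<..<g j} l)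
    = c * of_nat (card {j \<in> J. 0 < l \<and> l < g j})" for c :: ennreal and g :: "'i \<Rightarrow> real"
  by (simp add: indicator_def sum_distrib_left [symmetric] sum.If_cases Int_def)

text \<open>Two cases: if \<open>Y\<close> is at most \<open>e * g\<close>, the first term suffices;
  otherwise \<open>g\<close> is less than \<open>Y / e\<close> and the second one does. A small
  \<open>e\<close> lets the first term be absorbed later.\<close>

lemma absorb_pointwise:
  fixes g e q :: real
  assumes "0 \<le> g" "0 < e" "1 < q"
  shows "Y * ennreal (g powr (q - 1))
    \<le> ennreal e * ennreal (g powr q) + ennreal (e powr (1 - q)) * enn_powr Y q"
proof (cases Y)
  case (real y)
  have "y * g powr (q - 1) \<le> e * g powr q + e powr (1 - q) * y powr q"
  proof (cases "y \<le> e * g")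
    case True
    then have "y * g powr (q - 1) \<le> e * g * g powr (q - 1)" by (intro mult_right_mono) auto
    also have "\<dots> = e * g powr q" using assms by (cases "g = 0") (auto simp: powr_diff)
    finally show ?thesis by (simp add: add_increasing2)
  next
    case False
    then have y: "0 < y" using assms real by (smt (verit) mult_nonneg_nonneg)
    have "g \<le> y / e" using False assms by (simp add: field_simps)
    then have "y * g powr (q - 1) \<le> y * (y / e) powr (q - 1)"
      using assms real by (intro mult_left_mono powr_mono2) auto
    also have "\<dots> = e powr (1 - q) * y powr q"
      using y assms by (simp add: powr_divide powr_diff)
    finally show ?thesis using assms by (simp add: add_increasing)
  qed
  then show ?thesis
    using real assms by (simp add: enn_powr_ennreal ennreal_leI flip: ennreal_mult ennreal_plus)
next
  case top
  then show ?thesis using assms by (simp add: ennreal_mult_top)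
qed

text \<open>\<open>K\<close> is the factor in front of the sum of \<open>Y * g powr (q - 1)\<close>:
  \<open>2 powr q\<close> comes from the level \<open>2 * l\<close>, and \<open>q / (q - 1)\<close>
  from the layer-cake formula. Absorption with \<open>e = 1 / (2 * K)\<close> leaves half of the
  left side, whence the outer factor 2.\<close>

definition good_const :: "real \<Rightarrow> real" where
  "good_const q = (let K = 2 powr q * (q / (q - 1)) in 2 * K * (1 / (2 * K)) powr (1 - q))"

lemma good_const_nonneg: "1 < q \<Longrightarrow> 0 \<le> good_const q"
  by (simp add: good_const_def Let_def)

text \<open>The hypothesis is multiplied by \<open>q * l powr (q - 2)\<close> and integrated in
  \<open>l\<close>: the left side becomes the sum of \<open>(g / 2) powr q\<close>, the right side
  that of \<open>Y * g powr (q - 1)\<close> up to a constant. The power of \<open>g\<close> is then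
  absorbed, which is legitimate since \<open>g\<close> is real-valued and the index set
  finite.\<close>

lemma good_inequality:
  fixes g :: "'i \<Rightarrow> real" and Y :: "'i \<Rightarrow> ennreal"
  assumes J: "finite J" and g: "\<And>j. j \<in> J \<Longrightarrow> 0 \<le> g j" and q: "1 < q"
    and le: "\<And>l. 0 < l \<Longrightarrow> ennreal l * of_nat (card {j \<in> J. 2 * l < g j}) \<le> (\<Sum>j\<in>{j \<in> J. l < g j}. Y j)"
  shows "(\<Sum>j\<in>J. ennreal (g j powr q)) \<le> ennreal (good_const q) * (\<Sum>j\<in>J. enn_powr (Y j) q)"
proof -
  define K where "K = 2 powr q * (q / (q - 1))"
  have K: "0 < K" using q by (simp add: K_def)
  have pt: "(\<Sum>j\<in>J. ennreal (q * l powr (q - 1)) * indicator {0<..<g j / 2} l)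
    \<le> (\<Sum>j\<in>J. ennreal (q / (q - 1)) * Y j * (ennreal ((q - 1) * l powr (q - 1 - 1)) * indicator {0<..<g j} l))"
    for l
  proof (cases "0 < l")
    case True
    have "(\<Sum>j\<in>J. ennreal (q * l powr (q - 1)) * indicator {0<..<g j / 2} l)
      = ennreal (q * l powr (q - 1)) * of_nat (card {j \<in> J. 2 * l < g j})"
      unfolding sum_indicator_less [OF J] using True by (simp add: mult.commute)
    also have "\<dots> = ennreal (q * l powr (q - 2)) * (ennreal l * of_nat (card {j \<in> J. 2 * l < g j}))"
    proof -
      have "q * l powr (q - 1) = q * l powr (q - 2) * l"
        using True by (simp add: powr_diff power2_eq_square)
      then show ?thesis using True q by (simp add: ennreal_mult mult.assoc)
    qed
    also have "\<dots> \<le> ennreal (q * l powr (q - 2)) * (\<Sum>j\<in>{j \<in> J. l < g j}. Y j)"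
      by (intro mult_left_mono le True) auto
    also have "\<dots> = (\<Sum>j\<in>J. ennreal (q * l powr (q - 2)) * Y j * indicator {0<..<g j} l)"
      using True by (auto simp: sum_distrib_left sum.inter_filter [OF J] indicator_def intro!: sum.cong)
    also have "\<dots> = (\<Sum>j\<in>J. ennreal (q / (q - 1)) * Y j * (ennreal ((q - 1) * l powr (q - 1 - 1)) * indicator {0<..<g j} l))"
    proof (rule sum.cong [OF refl])
      fix j
      have "q * l powr (q - 2) = q / (q - 1) * ((q - 1) * l powr (q - 2))" using q by simp
      then have "ennreal (q * l powr (q - 2)) = ennreal (q / (q - 1)) * ennreal ((q - 1) * l powr (q - 2))"
        using q by (subst ennreal_mult [symmetric]) auto
      then show "ennreal (q * l powr (q - 2)) * Y j * indicator {0<..<g j} l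
        = ennreal (q / (q - 1)) * Y j * (ennreal ((q - 1) * l powr (q - 1 - 1)) * indicator {0<..<g j} l)"
        by (simp add: mult_ac)
    qed
    finally show ?thesis .
  next
    case False
    then show ?thesis by simp
  qed
  have "(\<Sum>j\<in>J. ennreal ((g j / 2) powr q))
    = (\<integral>\<^sup>+l. (\<Sum>j\<in>J. ennreal (q * l powr (q - 1)) * indicator {0<..<g j / 2} l) \<partial>lborel)"
    using q g by (subst nn_integral_sum) (auto intro!: sum.cong simp: nn_integral_powr_below)
  also have "\<dots> \<le> (\<integral>\<^sup>+l. (\<Sum>j\<in>J. ennreal (q / (q - 1)) * Y j * (ennreal ((q - 1) * l powr (q - 1 - 1)) * indicator {0<..<g j} l)) \<partial>lborel)"
    by (intro nn_integral_mono pt)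
  also have "\<dots> = (\<Sum>j\<in>J. ennreal (q / (q - 1)) * Y j * ennreal (g j powr (q - 1)))"
    using q g nn_integral_powr_below [of "q - 1"]
    by (subst nn_integral_sum) (auto intro!: sum.cong simp: nn_integral_cmult)
  finally have 1: "(\<Sum>j\<in>J. ennreal ((g j / 2) powr q))
    \<le> ennreal (q / (q - 1)) * (\<Sum>j\<in>J. Y j * ennreal (g j powr (q - 1)))"
    by (simp add: sum_distrib_left mult.assoc)
  have 2: "(\<Sum>j\<in>J. ennreal (g j powr q)) = ennreal (2 powr q) * (\<Sum>j\<in>J. ennreal ((g j / 2) powr q))"
    unfolding sum_distrib_left
    by (intro sum.cong refl) (simp add: g powr_divide flip: ennreal_mult)
  define S where "S = (\<Sum>j\<in>J. ennreal (g j powr q))"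
  define T where "T = (\<Sum>j\<in>J. enn_powr (Y j) q)"
  have "S \<le> ennreal (2 powr q) * (ennreal (q / (q - 1)) * (\<Sum>j\<in>J. Y j * ennreal (g j powr (q - 1))))"
    unfolding S_def 2 by (intro mult_left_mono 1) auto
  also have "\<dots> = ennreal K * (\<Sum>j\<in>J. Y j * ennreal (g j powr (q - 1)))"
  proof -
    have "ennreal K = ennreal (2 powr q) * ennreal (q / (q - 1))"
      unfolding K_def using q by (intro ennreal_mult) auto
    then show ?thesis by (simp only: mult.assoc)
  qed
  also have "\<dots> \<le> ennreal K * (\<Sum>j\<in>J. ennreal (1 / (2 * K)) * ennreal (g j powr q)
      + ennreal ((1 / (2 * K)) powr (1 - q)) * enn_powr (Y j) q)"
    using K q g by (intro mult_left_mono sum_mono absorb_pointwise) auto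
  also have "\<dots> = ennreal K * (ennreal (1 / (2 * K)) * S + ennreal ((1 / (2 * K)) powr (1 - q)) * T)"
    by (simp only: S_def T_def sum.distrib sum_distrib_left)
  also have "\<dots> = ennreal (1 / 2) * S + ennreal (K * (1 / (2 * K)) powr (1 - q)) * T"
  proof -
    have "ennreal K * ennreal (1 / (2 * K)) = ennreal (1 / 2)"
      using K by (simp flip: ennreal_mult)
    then show ?thesis
      using K by (simp add: distrib_left ennreal_mult flip: mult.assoc)
  qed
  finally have 3: "S \<le> ennreal (1 / 2) * S + ennreal (K * (1 / (2 * K)) powr (1 - q)) * T" .
  have gc: "good_const q = 2 * (K * (1 / (2 * K)) powr (1 - q))"
    by (simp add: good_const_def K_def Let_def)
  have "S \<le> ennreal (good_const q) * T"
  proof (cases "ennreal (good_const q) * T = \<infinity>")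
    case True
    then show ?thesis by simp
  next
    case False
    define R where "R = ennreal (K * (1 / (2 * K)) powr (1 - q)) * T"
    have R: "ennreal (good_const q) * T = 2 * R"
      using K by (simp add: gc R_def ennreal_mult mult.assoc)
    have "S < \<infinity>" unfolding S_def by simp
    then obtain s where s: "S = ennreal s" "0 \<le> s" by (cases S) auto
    obtain r where r: "R = ennreal r" "0 \<le> r" using False unfolding R by (cases R) (auto simp: ennreal_mult_top)
    have "ennreal (1 / 2) * S + R = ennreal (1 / 2 * s + r)"
      unfolding s r using s r by (subst ennreal_mult [symmetric]) (simp_all flip: ennreal_plus)
    then have "s \<le> 1 / 2 * s + r"
      using 3 s r unfolding R_def [symmetric] by (subst ennreal_le_iff [symmetric]) simp_all
    then have "s \<le> 2 * r" by simp
    then show ?thesis unfolding R s r using r by (simp add: ennreal_leI flip: ennreal_mult ennreal_numeral)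
  qed
  then show ?thesis by (simp add: S_def T_def)
qed

text \<open>Integration against \<open>q * l powr (q - 1)\<close>. In the last sum, levels below
  \<open>u j\<close> contribute \<open>K * u j powr q\<close>; levels above it give a tail integral
  of \<open>l powr (q - q0 - 1)\<close>, convergent since \<open>q < q0\<close>, and with it the
  factor \<open>q / (q0 - q)\<close>.\<close>

lemma good_inequality_below:
  fixes g u :: "'i \<Rightarrow> real"
  assumes J: "finite J" and g: "\<And>j. j \<in> J \<Longrightarrow> 0 \<le> g j" and u: "\<And>j. j \<in> J \<Longrightarrow> 0 \<le> u j"
    and q: "0 < q" "q < q0" and K: "0 \<le> K"
    and le: "\<And>l. 0 < l \<Longrightarrow> of_nat (card {j \<in> J. l < g j}) \<le> of_nat (card {j \<in> J. l < u j})
         + ennreal (K * l powr (- q0)) * (\<Sum>j\<in>J. ennreal (min l (u j) powr q0))"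
  shows "(\<Sum>j\<in>J. ennreal (g j powr q)) \<le> ennreal (1 + K * (1 + q / (q0 - q))) * (\<Sum>j\<in>J. ennreal (u j powr q))"
proof -
  let ?A = "\<lambda>j l. ennreal (q * l powr (q - 1)) * indicator {0<..<u j} l"
  let ?B = "\<lambda>j l. ennreal (q * u j powr q0) * (ennreal (l powr (- (q0 - q) - 1)) * indicator {u j..} l)"
  have pt: "(\<Sum>j\<in>J. ennreal (q * l powr (q - 1)) * indicator {0<..<g j} l)
    \<le> (\<Sum>j\<in>J. ?A j l + ennreal K * (?A j l + (if 0 < u j then ?B j l else 0)))" for l
  proof (cases "0 < l")
    case True
    have *: "ennreal (q * l powr (q - 1)) * (ennreal (K * l powr (- q0)) * ennreal (min l (u j) powr q0))
       \<le> ennreal K * (?A j l + (if 0 < u j then ?B j l else 0))" if j: "j \<in> J" for j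
    proof -
      consider "u j = 0" | "0 < u j" "l < u j" | "0 < u j" "u j \<le> l" using u [OF j] by linarith
      then show ?thesis
      proof cases
        case 1
        then show ?thesis using True q by simp
      next
        case 2
        have "q * l powr (q - 1) * (K * l powr (- q0) * l powr q0) = K * (q * l powr (q - 1))"
        proof -
          have "l powr (- q0) * l powr q0 = 1" using True by (simp flip: powr_add)
          then show ?thesis by (simp add: mult.assoc)
        qed
        moreover have "l powr (- q0) * l powr q0 = 1" using True by (simp flip: powr_add)
        ultimately show ?thesis using 2 True q K
          by (simp add: mult.assoc flip: ennreal_mult)
      next
        case 3
        have "l powr (q - 1) * l powr (- q0) = l powr (- (q0 - q) - 1)"
          by (simp add: algebra_simps flip: powr_add)
        moreover have "q * l powr (q - 1) * (K * l powr (- q0) * u j powr q0)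
            = K * (q * u j powr q0 * (l powr (q - 1) * l powr (- q0)))"
          by (simp only: mult_ac)
        ultimately have "q * l powr (q - 1) * (K * l powr (- q0) * u j powr q0)
            = K * (q * u j powr q0 * l powr (- (q0 - q) - 1))" by simp
        moreover have "ennreal (q * l powr (q - 1)) * (ennreal (K * l powr (- q0)) * ennreal (u j powr q0))
            = ennreal (q * l powr (q - 1) * (K * l powr (- q0) * u j powr q0))"
          using q K by (simp flip: ennreal_mult)
        moreover have "ennreal K * (ennreal (q * u j powr q0) * ennreal (l powr (- (q0 - q) - 1)))
            = ennreal (K * (q * u j powr q0 * l powr (- (q0 - q) - 1)))"
          using q K by (simp flip: ennreal_mult)
        moreover have "min l (u j) = u j" "indicator {0<..<u j} l = (0 :: ennreal)"
          "indicator {u j..} l = (1 :: ennreal)"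
          using 3 by auto
        ultimately show ?thesis
          using 3(1) by (simp only: if_True mult_zero_right mult_1_right add_0_left order_refl)
      qed
    qed
    have "(\<Sum>j\<in>J. ennreal (q * l powr (q - 1)) * indicator {0<..<g j} l)
      = ennreal (q * l powr (q - 1)) * of_nat (card {j \<in> J. l < g j})"
      unfolding sum_indicator_less [OF J] using True by simp
    also have "\<dots> \<le> ennreal (q * l powr (q - 1)) * (of_nat (card {j \<in> J. l < u j})
         + ennreal (K * l powr (- q0)) * (\<Sum>j\<in>J. ennreal (min l (u j) powr q0)))"
      by (intro mult_left_mono le True) auto
    also have "\<dots> = (\<Sum>j\<in>J. ?A j l) + (\<Sum>j\<in>J. ennreal (q * l powr (q - 1)) * (ennreal (K * l powr (- q0)) * ennreal (min l (u j) powr q0)))"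
      unfolding sum_indicator_less [OF J] distrib_left using True by (simp add: sum_distrib_left del: sum_ennreal)
    also have "\<dots> \<le> (\<Sum>j\<in>J. ?A j l) + (\<Sum>j\<in>J. ennreal K * (?A j l + (if 0 < u j then ?B j l else 0)))"
      by (intro add_left_mono sum_mono *)
    finally show ?thesis by (simp add: sum.distrib)
  next
    case False
    then show ?thesis by simp
  qed
  have B: "(\<integral>\<^sup>+l. (if 0 < u j then ?B j l else 0) \<partial>lborel) \<le> ennreal (q / (q0 - q) * u j powr q)" if "j \<in> J" for j
  proof (cases "0 < u j")
    case True
    have "(\<integral>\<^sup>+l. ?B j l \<partial>lborel) = ennreal (q * u j powr q0) * ennreal (u j powr (- (q0 - q)) / (q0 - q))"
      using True q by (subst nn_integral_cmult) (simp_all only: nn_integral_powr_above diff_gt_0_iff_gt, measurable)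
    also have "\<dots> = ennreal (q / (q0 - q) * (u j powr q0 * u j powr (- (q0 - q))))"
      using q by (subst ennreal_mult [symmetric]) (auto simp: field_simps)
    also have "u j powr q0 * u j powr (- (q0 - q)) = u j powr q" using True by (simp flip: powr_add)
    finally show ?thesis using True by simp
  qed simp
  have "(\<Sum>j\<in>J. ennreal (g j powr q))
    = (\<integral>\<^sup>+l. (\<Sum>j\<in>J. ennreal (q * l powr (q - 1)) * indicator {0<..<g j} l) \<partial>lborel)"
    using q g by (subst nn_integral_sum) (auto intro!: sum.cong simp: nn_integral_powr_below)
  also have "\<dots> \<le> (\<integral>\<^sup>+l. (\<Sum>j\<in>J. ?A j l + ennreal K * (?A j l + (if 0 < u j then ?B j l else 0))) \<partial>lborel)"
    by (intro nn_integral_mono pt)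
  also have "\<dots> = (\<Sum>j\<in>J. (\<integral>\<^sup>+l. ?A j l \<partial>lborel) + ennreal K * ((\<integral>\<^sup>+l. ?A j l \<partial>lborel) + (\<integral>\<^sup>+l. (if 0 < u j then ?B j l else 0) \<partial>lborel)))"
    by (subst nn_integral_sum) (auto intro!: sum.cong simp: nn_integral_add nn_integral_cmult)
  also have "\<dots> \<le> (\<Sum>j\<in>J. ennreal (u j powr q) + ennreal K * (ennreal (u j powr q) + ennreal (q / (q0 - q) * u j powr q)))"
    using q u by (intro sum_mono add_mono mult_left_mono B) (auto simp: nn_integral_powr_below)
  also have "\<dots> = ennreal (1 + K * (1 + q / (q0 - q))) * (\<Sum>j\<in>J. ennreal (u j powr q))"
    unfolding sum_distrib_left
  proof (rule sum.cong [OF refl])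
    fix j
    show "ennreal (u j powr q) + ennreal K * (ennreal (u j powr q) + ennreal (q / (q0 - q) * u j powr q))
      = ennreal (1 + K * (1 + q / (q0 - q))) * ennreal (u j powr q)"
      using q K by (simp add: algebra_simps flip: ennreal_mult ennreal_plus)
  qed
  finally show ?thesis .
qed

section \<open>Vector-valued dyadic maximal functions\<close>

lemma ennreal_sum_eq_top:
  fixes f :: "'a \<Rightarrow> ennreal"
  assumes "finite I"
  shows "sum f I = top \<longleftrightarrow> (\<exists>i\<in>I. f i = top)"
  using assms by (induction I rule: finite_induct) auto

lemma enn_powr_av_le:
  assumes "1 \<le> q"
  shows "enn_powr (av l H m) q \<le> av l (\<lambda>i. enn_powr (H i) q) m"
proof -
  define M where "M = point_measure (blk l m) (\<lambda>_. ennreal (1 / 2 ^ l))"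
  have int: "(\<integral>\<^sup>+i. h i \<partial>M) = av l h m" for h
    unfolding M_def by (subst nn_integral_point_measure_finite) (simp_all add: av_def mult.commute flip: sum_distrib_right)
  have one: "(\<integral>\<^sup>+i. ennreal 1 \<partial>M) = 1"
    unfolding int by (simp add: av_const)
  have "enn_powr (\<integral>\<^sup>+i. H i \<partial>M) q
    \<le> (\<integral>\<^sup>+i. enn_powr (H i) q * ennreal (1 powr (1 - q)) \<partial>M) * enn_powr (\<integral>\<^sup>+i. ennreal 1 \<partial>M) (q - 1)"
    using assms by (intro nn_integral_Jensen) (auto simp: M_def one [unfolded M_def, simplified])
  moreover have "enn_powr 1 (q - 1) = 1"
    using enn_powr_ennreal [of 1 "q - 1"] by simp
  ultimately show ?thesis unfolding one int by simp
qed

text \<open>The localised weak type bound, weakened to the level \<open>2 * l\<close> on the left,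
  is the hypothesis of \<open>good_inequality\<close> with \<open>Y = F\<close>. Infinite values of
  \<open>F\<close> are treated apart, because the maximal function must be real-valued
  there.\<close>

lemma mx_scalar_bound:
  assumes q: "1 < q"
  shows "(\<Sum>j\<in>blk L m. enn_powr (mx L F j) q) \<le> ennreal (good_const q) * (\<Sum>j\<in>blk L m. enn_powr (F j) q)"
    (is "?lhs \<le> _ * ?rhs")
proof (cases "\<exists>i\<in>blk L m. F i = \<infinity>")
  case True
  then have top: "?rhs = \<infinity>" by (auto simp: ennreal_sum_eq_top)
  have "good_const q > 0" using q by (auto simp: good_const_def Let_def)
  then show ?thesis unfolding top by (simp add: ennreal_mult_top)
next
  case False
  then have fin: "mx L F j < \<infinity>" if "j \<in> blk L m" for j
    using blk_eqI [OF that] by (intro mx_finite) (auto simp: less_top)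
  define g where "g j = enn2real (mx L F j)" for j
  have g: "mx L F j = ennreal (g j)" if "j \<in> blk L m" for j
    using fin [OF that] by (simp add: g_def)
  have g0: "0 \<le> g j" for j by (simp add: g_def)
  have less: "ennreal l < mx L F j \<longleftrightarrow> l < g j" if "j \<in> blk L m" "0 \<le> l" for j l
    using that by (simp add: g ennreal_less_iff)
  have "(\<Sum>j\<in>blk L m. ennreal (g j powr q)) \<le> ennreal (good_const q) * ?rhs"
  proof (rule good_inequality)
    fix l :: real assume l: "0 < l"
    have "ennreal l * of_nat (card {j \<in> blk L m. 2 * l < g j})
      \<le> ennreal l * of_nat (card {j \<in> blk L m. ennreal l < mx L F j})"
      using l by (intro mult_left_mono of_nat_mono card_mono) (auto simp: less)
    also have "\<dots> \<le> (\<Sum>j\<in>{j \<in> blk L m. ennreal l < mx L F j}. F j)"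
      by (rule mx_weak_type)
    also have "{j \<in> blk L m. ennreal l < mx L F j} = {j \<in> blk L m. l < g j}"
      using l by (auto simp: less)
    finally show "ennreal l * of_nat (card {j \<in> blk L m. 2 * l < g j})
      \<le> (\<Sum>j\<in>{j \<in> blk L m. l < g j}. F j)" .
  qed (use q g0 in auto)
  moreover have "?lhs = (\<Sum>j\<in>blk L m. ennreal (g j powr q))"
    by (intro sum.cong) (auto simp: g enn_powr_ennreal g0)
  ultimately show ?thesis by simp
qed

text \<open>An explicit function, because the change of exponent is applied to a family of norms
  indexed by a point, and the new constant must be common to the family. The summand 1 in the first
  two branches keeps the constant positive, so the bound is trivial when the right-hand sum is
  infinite.\<close>

definition exponent_const :: "real \<Rightarrow> real \<Rightarrow> real \<Rightarrow> real" where
  "exponent_const q0 q C =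
     (if q < q0 then (1 + C * 2 powr q0 * (1 + q / (q0 - q))) * good_const q + 1
      else if q0 < q then good_const q * (C powr (q / q0) * good_const (q / q0)) + 1
      else C)"

text \<open>\<rho> stands for the norm in the inner variables and \<open>D\<close> for the
  measurable functions, outside which the triangle inequality can fail. Closure under
  \<open>sup\<close> keeps truncated maximal functions in \<open>D\<close>.\<close>

locale function_norm =
  fixes \<rho> :: "('b \<Rightarrow> ennreal) \<Rightarrow> ennreal" and D :: "('b \<Rightarrow> ennreal) set"
  assumes zero: "(\<lambda>_. 0) \<in> D"
    and add: "f \<in> D \<Longrightarrow> g \<in> D \<Longrightarrow> (\<lambda>x. f x + g x) \<in> D"
    and scale: "f \<in> D \<Longrightarrow> (\<lambda>x. ennreal c * f x) \<in> D"
    and sup: "f \<in> D \<Longrightarrow> g \<in> D \<Longrightarrow> (\<lambda>x. sup (f x) (g x)) \<in> D"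
    and mono: "f \<in> D \<Longrightarrow> g \<in> D \<Longrightarrow> (\<And>x. f x \<le> g x) \<Longrightarrow> \<rho> f \<le> \<rho> g"
    and triangle: "f \<in> D \<Longrightarrow> g \<in> D \<Longrightarrow> \<rho> (\<lambda>x. f x + g x) \<le> \<rho> f + \<rho> g"
    and homogeneous: "f \<in> D \<Longrightarrow> \<rho> (\<lambda>x. ennreal c * f x) \<le> ennreal c * \<rho> f"
begin

lemma norm_zero: "\<rho> (\<lambda>_. 0) = 0"
  using homogeneous [OF zero, of 0] by simp

lemma sum_closed: "finite I \<Longrightarrow> (\<And>i. i \<in> I \<Longrightarrow> a i \<in> D) \<Longrightarrow> (\<lambda>x. \<Sum>i\<in>I. a i x) \<in> D"
  by (induction I rule: finite_induct) (auto intro: zero add)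

lemma SUP_closed: "finite I \<Longrightarrow> (\<And>i. i \<in> I \<Longrightarrow> a i \<in> D) \<Longrightarrow> (\<lambda>x. SUP i\<in>I. a i x) \<in> D"
proof (induction I rule: finite_induct)
  case empty
  then show ?case using zero by (simp add: bot_ennreal)
next
  case (insert i I)
  then show ?case using sup [of "a i" "\<lambda>x. SUP i\<in>I. a i x"] by simp
qed

lemma norm_sum: "finite I \<Longrightarrow> (\<And>i. i \<in> I \<Longrightarrow> a i \<in> D) \<Longrightarrow> \<rho> (\<lambda>x. \<Sum>i\<in>I. a i x) \<le> (\<Sum>i\<in>I. \<rho> (a i))"
proof (induction I rule: finite_induct)
  case empty
  then show ?case by (simp add: norm_zero)
next
  case (insert i I)
  have "\<rho> (\<lambda>x. a i x + (\<Sum>i\<in>I. a i x)) \<le> \<rho> (a i) + \<rho> (\<lambda>x. \<Sum>i\<in>I. a i x)"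
    using insert by (intro triangle sum_closed) auto
  also have "\<dots> \<le> \<rho> (a i) + (\<Sum>i\<in>I. \<rho> (a i))"
    using insert by (intro add_left_mono) auto
  finally show ?case using insert by simp
qed

lemma av_closed: "(\<And>i. a i \<in> D) \<Longrightarrow> (\<lambda>x. av l (\<lambda>i. a i x) m) \<in> D"
  unfolding av_def by (intro scale sum_closed) auto

lemma norm_av: "(\<And>i. a i \<in> D) \<Longrightarrow> \<rho> (\<lambda>x. av l (\<lambda>i. a i x) m) \<le> av l (\<lambda>i. \<rho> (a i)) m"
  unfolding av_def
  by (intro order.trans [OF homogeneous] mult_left_mono norm_sum sum_closed) auto

lemma SUP_av_closed: "finite I \<Longrightarrow> (\<And>i. a i \<in> D) \<Longrightarrow> (\<lambda>x. SUP l\<in>I. av l (\<lambda>i. a i x) m) \<in> D"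
  by (intro SUP_closed av_closed)

lemma mx_closed: "(\<And>i. a i \<in> D) \<Longrightarrow> (\<lambda>x. mx L (\<lambda>i. a i x) m) \<in> D"
  unfolding mx_def by (intro SUP_av_closed) auto

lemma norm_mx_finite:
  assumes a: "\<And>i. a i \<in> D" and fin: "\<And>i. i \<in> blk L m \<Longrightarrow> \<rho> (a i) < \<infinity>"
  shows "\<rho> (\<lambda>x. mx L (\<lambda>i. a i x) m) < \<infinity>"
proof -
  have "\<rho> (\<lambda>x. mx L (\<lambda>i. a i x) m) \<le> \<rho> (\<lambda>x. \<Sum>l\<le>L. av l (\<lambda>i. a i x) m)"
    unfolding mx_def
    by (intro mono SUP_av_closed sum_closed av_closed a SUP_least member_le_sum) auto
  also have "\<dots> \<le> (\<Sum>l\<le>L. \<rho> (\<lambda>x. av l (\<lambda>i. a i x) m))"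
    by (intro norm_sum av_closed a) auto
  also have "\<dots> \<le> (\<Sum>l\<le>L. av l (\<lambda>i. \<rho> (a i)) m)"
    by (intro sum_mono norm_av a)
  also have "\<dots> < \<infinity>"
  proof -
    have "av l (\<lambda>i. \<rho> (a i)) m < \<infinity>" if "l \<le> L" for l
      using fin blk_mono [OF that, of m] by (auto simp: av_def ennreal_mult_less_top)
    then show ?thesis by auto
  qed
  finally show ?thesis .
qed

text \<open>Boundedness of \<open>mx\<close> on q-summable sequences with values in the space normed
  by \<rho>. Window and truncation have the same level \<open>L\<close>, so a window is
  self-contained and any stopping block can serve as one; \<open>C\<close> is uniform in
  \<open>L\<close>.\<close>

definition maximal_bound :: "real \<Rightarrow> real \<Rightarrow> bool" where
  "maximal_bound q C \<longleftrightarrow> 0 \<le> C \<and> (\<forall>L m a. (\<forall>i. a i \<in> D) \<longrightarrow>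
     (\<Sum>j\<in>blk L m. enn_powr (\<rho> (\<lambda>x. mx L (\<lambda>i. a i x) j)) q) \<le> ennreal C * (\<Sum>j\<in>blk L m. enn_powr (\<rho> (a j)) q))"

text \<open>Lowering the exponent: replacing \<open>a\<close> by its averages over the maximal blocks on which the
  average of the norms exceeds \<open>l\<close> does not change the maximal function off these blocks. For the
  dyadic maximal function the Calderon--Zygmund decomposition has no bad part.\<close>

lemma maximal_bound_below:
  assumes C: "maximal_bound q0 C" and q: "1 < q" "q < q0"
  shows "maximal_bound q ((1 + C * 2 powr q0 * (1 + q / (q0 - q))) * good_const q + 1)"
proof -
  have C0: "0 \<le> C" using C by (simp add: maximal_bound_def)
  let ?K = "1 + C * 2 powr q0 * (1 + q / (q0 - q))"
  have K0: "0 \<le> ?K" using C0 q by simp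
  have pos: "0 < ?K * good_const q + 1"
    using K0 good_const_nonneg [OF q(1)] by (smt (verit) mult_nonneg_nonneg)
  have "(\<Sum>j\<in>blk L m. enn_powr (\<rho> (\<lambda>x. mx L (\<lambda>i. a i x) j)) q)
      \<le> ennreal (?K * good_const q + 1) * (\<Sum>j\<in>blk L m. enn_powr (\<rho> (a j)) q)"
    if a: "\<And>i. a i \<in> D" for L m and a :: "int \<Rightarrow> 'b \<Rightarrow> ennreal"
  proof (cases "\<exists>i\<in>blk L m. \<rho> (a i) = \<infinity>")
    case True
    then have top: "(\<Sum>j\<in>blk L m. enn_powr (\<rho> (a j)) q) = \<infinity>" by (auto simp: ennreal_sum_eq_top)
    show ?thesis unfolding top using pos by (simp add: ennreal_mult_top)
  next
    case False
    define F where "F i = \<rho> (a i)" for i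
    have Ffin: "F i < \<infinity>" if "i \<in> blk L m" for i using False that by (auto simp: F_def less_top)
    define g where "g j = enn2real (\<rho> (\<lambda>x. mx L (\<lambda>i. a i x) j))" for j
    define u where "u j = enn2real (mx L F j)" for j
    have g: "\<rho> (\<lambda>x. mx L (\<lambda>i. a i x) j) = ennreal (g j)" if "j \<in> blk L m" for j
      using norm_mx_finite [of a L j] a Ffin blk_eqI [OF that] by (simp add: g_def F_def)
    have u: "mx L F j = ennreal (u j)" if "j \<in> blk L m" for j
      using mx_finite [of L j F] Ffin blk_eqI [OF that] by (simp add: u_def)
    have g0: "0 \<le> g j" and u0: "0 \<le> u j" for j by (simp_all add: g_def u_def)
    have key: "of_nat (card {j \<in> blk L m. l < g j}) \<le> of_nat (card {j \<in> blk L m. l < u j})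
         + ennreal (C * 2 powr q0 * l powr (- q0)) * (\<Sum>j\<in>blk L m. ennreal (min l (u j) powr q0))"
      if l: "0 < l" for l :: real
    \<comment> \<open>If the average over the whole window exceeds \<open>l\<close>, then
      \<open>u\<close> exceeds \<open>l\<close> everywhere in it and the bound is trivial. Otherwise
      every selected block has a parent inside the window, and the average over the parent is at
      most \<open>l\<close>.\<close>
    proof (cases "av L F m \<le> ennreal l")
      case False
      have "blk L m \<subseteq> {j \<in> blk L m. l < u j}"
      proof
        fix j assume j: "j \<in> blk L m"
        have "ennreal l < mx L F j"
          using False av_le_mx [of L L F j] av_cong_blk [OF j] by auto
        then show "j \<in> {j \<in> blk L m. l < u j}" using j u u0 l by (simp add: ennreal_less_iff)
      qed
      then have "card {j \<in> blk L m. l < g j} \<le> card {j \<in> blk L m. l < u j}"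
        by (intro card_mono) auto
      then show ?thesis by (simp add: add_increasing2)
    next
      case True
      let ?W = "\<Sum>j\<in>blk L m. ennreal (min l (u j) powr q0)"
      define P where "P k j \<longleftrightarrow> ennreal l < av k F j" for k j
      define \<tau> where "\<tau> = stop_level L P"
      have stop: "stopping L \<tau>"
        unfolding \<tau>_def by (rule stopping_stop_level) (simp add: P_def av_cong_blk)
      define b where "b j x = av (\<tau> j) (\<lambda>i. a i x) j" for j x
      have bD: "b j \<in> D" for j unfolding b_def by (intro av_closed a)
      have less: "ennreal l < mx L F j \<longleftrightarrow> l < u j" if "j \<in> blk L m" for j
        using that l by (simp add: u ennreal_less_iff)
      have \<tau>0: "\<tau> j = 0" if "j \<in> blk L m" "\<not> l < u j" for j
      proof -
        have "\<not> (\<exists>k\<le>L. P k j)" using that less [OF that(1)] mx_gr_iff [of "ennreal l" L F j] by (simp add: P_def)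
        then show ?thesis unfolding \<tau>_def stop_level_def by (simp only: if_False)
      qed
      \<comment> \<open>The level above \<tau> was not selected, so the average there is at most
        \<open>l\<close>, and passing to the smaller block at most doubles it.\<close>
      have bnorm: "\<rho> (b j) \<le> ennreal (2 * min l (u j))" if j: "j \<in> blk L m" for j
      proof -
        have "\<rho> (b j) \<le> av (\<tau> j) F j"
          unfolding b_def F_def by (intro norm_av a)
        moreover have "av (\<tau> j) F j \<le> ennreal (2 * u j)"
        proof -
          have "av (\<tau> j) F j \<le> ennreal (u j)"
            using av_le_mx [of "\<tau> j" L F j] stop u [OF j] by (simp add: stopping_def)
          also have "\<dots> \<le> ennreal (2 * u j)" using u0 by (intro ennreal_leI) auto
          finally show ?thesis .
        qed
        moreover have "av (\<tau> j) F j \<le> ennreal (2 * l)"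
        proof (cases "\<tau> j = L")
          case True
          have "av (\<tau> j) F j \<le> ennreal l"
            using \<open>av L F m \<le> ennreal l\<close> av_cong_blk [OF j] True by simp
          also have "\<dots> \<le> ennreal (2 * l)" using l by (intro ennreal_leI) auto
          finally show ?thesis .
        next
          case False
          then have "Suc (\<tau> j) \<le> L" using stop by (simp add: stopping_def le_neq_implies_less Suc_le_eq)
          then have "av (Suc (\<tau> j)) F j \<le> ennreal l"
            using stop_level_above [of L P j "Suc (\<tau> j)"] by (simp add: \<tau>_def P_def not_less)
          then have "2 * av (Suc (\<tau> j)) F j \<le> 2 * ennreal l" by (rule mult_left_mono) simp
          then show ?thesis using av_le_double [of "\<tau> j" F j] l by (simp add: ennreal_mult)
        qed
        ultimately show ?thesis
          by (auto simp: min_def intro: order.trans)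
      qed
      \<comment> \<open>A block around a point where nothing is selected either contains a given
        stopping block or misses it, so averaging inside the stopping blocks leaves its sum
        unchanged.\<close>
      have same: "mx L (\<lambda>i. a i x) j = mx L (\<lambda>i. b i x) j" if j: "j \<in> blk L m" "\<not> l < u j" for j x
      proof -
        have "av k (\<lambda>i. a i x) j = av k (\<lambda>i. b i x) j" if k: "k \<le> L" for k
        proof -
          have sub: "blk k j \<subseteq> blk L m" using blk_mono [OF k, of j] blk_eqI [OF j(1)] by simp
          have in_iff: "i' \<in> blk k j \<longleftrightarrow> i \<in> blk k j" if i: "i' \<in> blk (\<tau> i) i" for i i'
          proof (cases "\<tau> i \<le> k")
            case True
            then have "i' \<in> blk k i" using blk_mono i by blast
            then show ?thesis by (auto simp: blk_def)
          next
            case False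
            have ne: "j \<notin> blk (\<tau> i) i"
              using stop \<tau>0 [OF j] False by (auto simp: stopping_def)
            have ti: "\<tau> i' = \<tau> i" using i stop by (auto simp: stopping_def)
            have "i'' \<notin> blk k j" if "i'' \<in> blk (\<tau> i) i" for i''
            proof
              assume "i'' \<in> blk k j"
              then have "i'' \<in> blk (\<tau> i) j" using blk_mono [of k "\<tau> i" j] False by auto
              then show False using ne that by (auto simp: blk_def)
            qed
            then show ?thesis using i by auto
          qed
          have "(\<Sum>i\<in>blk L m. av (\<tau> i) (\<lambda>i. if i \<in> blk k j then a i x else 0) i)
            = (\<Sum>i\<in>blk L m. if i \<in> blk k j then a i x else 0)"
            by (rule sum_av_stopping [OF stop])
          moreover have "av (\<tau> i) (\<lambda>i. if i \<in> blk k j then a i x else 0) i = (if i \<in> blk k j then b i x else 0)" for i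
            using in_iff by (auto simp: av_def b_def cong: sum.cong)
          ultimately have "(\<Sum>i\<in>blk L m. if i \<in> blk k j then b i x else 0)
             = (\<Sum>i\<in>blk L m. if i \<in> blk k j then a i x else 0)" by simp
          then have "(\<Sum>i\<in>blk L m \<inter> blk k j. b i x) = (\<Sum>i\<in>blk L m \<inter> blk k j. a i x)"
            by (simp add: sum.inter_restrict)
          moreover have "blk L m \<inter> blk k j = blk k j" using sub by blast
          ultimately show ?thesis by (simp add: av_def)
        qed
        then show ?thesis unfolding mx_def by (intro SUP_cong) auto
      qed
      \<comment> \<open>On this set the maximal functions of \<open>a\<close> and \<open>b\<close>
        agree, so Chebyshev's inequality and the bound at \<open>q0\<close> for \<open>b\<close>
        count its points.\<close>
      let ?V = "{j \<in> blk L m. l < g j \<and> \<not> l < u j}"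
      have "ennreal (l powr q0) * of_nat (card ?V) = (\<Sum>j\<in>?V. ennreal (l powr q0))"
        by (simp add: mult.commute)
      also have "\<dots> \<le> (\<Sum>j\<in>?V. enn_powr (\<rho> (\<lambda>x. mx L (\<lambda>i. b i x) j)) q0)"
      proof (rule sum_mono)
        fix j assume j: "j \<in> ?V"
        then have "(\<lambda>x. mx L (\<lambda>i. b i x) j) = (\<lambda>x. mx L (\<lambda>i. a i x) j)"
          using j by (intro ext same [symmetric]) auto
        then have "\<rho> (\<lambda>x. mx L (\<lambda>i. b i x) j) = ennreal (g j)" using j g by simp
        then show "ennreal (l powr q0) \<le> enn_powr (\<rho> (\<lambda>x. mx L (\<lambda>i. b i x) j)) q0"
          using j l g0 q by (auto simp: enn_powr_ennreal intro!: ennreal_leI powr_mono2)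
      qed
      also have "\<dots> \<le> (\<Sum>j\<in>blk L m. enn_powr (\<rho> (\<lambda>x. mx L (\<lambda>i. b i x) j)) q0)"
        by (intro sum_mono2) auto
      also have "\<dots> \<le> ennreal C * (\<Sum>j\<in>blk L m. enn_powr (\<rho> (b j)) q0)"
        using C bD by (simp add: maximal_bound_def)
      also have "\<dots> \<le> ennreal C * (\<Sum>j\<in>blk L m. ennreal ((2 * min l (u j)) powr q0))"
      proof (intro mult_left_mono sum_mono)
        fix j assume j: "j \<in> blk L m"
        have "enn_powr (\<rho> (b j)) q0 \<le> enn_powr (ennreal (2 * min l (u j))) q0"
          using q by (intro enn_powr_mono bnorm j) auto
        then show "enn_powr (\<rho> (b j)) q0 \<le> ennreal ((2 * min l (u j)) powr q0)"
          using l u0 by (simp add: enn_powr_ennreal)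
      qed simp
      also have "\<dots> = ennreal (C * 2 powr q0) * ?W"
      proof -
        have "ennreal ((2 * min l (u j)) powr q0) = ennreal (2 powr q0) * ennreal (min l (u j) powr q0)" for j
          using l u0 by (subst ennreal_mult [symmetric]) (simp_all add: powr_mult)
        moreover have "ennreal (C * 2 powr q0) = ennreal C * ennreal (2 powr q0)"
          using C0 by (intro ennreal_mult) auto
        ultimately show ?thesis by (simp only: sum_distrib_left mult.assoc)
      qed
      finally have "ennreal (l powr (- q0)) * (ennreal (l powr q0) * of_nat (card ?V))
        \<le> ennreal (l powr (- q0)) * (ennreal (C * 2 powr q0) * ?W)"
        by (rule mult_left_mono) simp
      moreover have "ennreal (l powr (- q0)) * ennreal (l powr q0) = 1"
        using l by (simp flip: ennreal_mult powr_add)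
      then have "ennreal (l powr (- q0)) * (ennreal (l powr q0) * of_nat (card ?V)) = of_nat (card ?V)"
        by (simp flip: mult.assoc)
      moreover have "ennreal (l powr (- q0)) * ennreal (C * 2 powr q0) = ennreal (C * 2 powr q0 * l powr (- q0))"
        using C0 by (subst ennreal_mult [symmetric]) (simp_all add: mult.commute)
      then have "ennreal (l powr (- q0)) * (ennreal (C * 2 powr q0) * ?W)
        = ennreal (C * 2 powr q0 * l powr (- q0)) * ?W"
        by (simp only: mult.assoc [symmetric])
      ultimately have V: "of_nat (card ?V) \<le> ennreal (C * 2 powr q0 * l powr (- q0)) * ?W"
        by (simp only:)
      have "{j \<in> blk L m. l < g j} \<subseteq> {j \<in> blk L m. l < u j} \<union> ?V" by auto
      then have "card {j \<in> blk L m. l < g j} \<le> card ({j \<in> blk L m. l < u j} \<union> ?V)"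
        by (intro card_mono) auto
      also have "\<dots> \<le> card {j \<in> blk L m. l < u j} + card ?V" by (rule card_Un_le)
      finally have "of_nat (card {j \<in> blk L m. l < g j}) \<le> (of_nat (card {j \<in> blk L m. l < u j} + card ?V) :: ennreal)"
        by (rule of_nat_mono)
      also have "\<dots> = of_nat (card {j \<in> blk L m. l < u j}) + of_nat (card ?V)" by simp
      finally show ?thesis using V by (blast intro: order.trans add_left_mono)
    qed
    let ?F = "\<Sum>j\<in>blk L m. enn_powr (F j) q"
    have "(\<Sum>j\<in>blk L m. ennreal (g j powr q)) \<le> ennreal ?K * (\<Sum>j\<in>blk L m. ennreal (u j powr q))"
      by (rule good_inequality_below) (use q C0 key g0 u0 in auto)
    also have "(\<Sum>j\<in>blk L m. ennreal (u j powr q)) = (\<Sum>j\<in>blk L m. enn_powr (mx L F j) q)"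
      by (intro sum.cong) (auto simp: u enn_powr_ennreal u0)
    also have "\<dots> \<le> ennreal (good_const q) * ?F"
      by (rule mx_scalar_bound [OF q(1)])
    finally have "(\<Sum>j\<in>blk L m. ennreal (g j powr q))
      \<le> ennreal ?K * (ennreal (good_const q) * ?F)"
      by (simp add: mult_left_mono)
    also have "\<dots> = ennreal (?K * good_const q) * ?F"
      using K0 good_const_nonneg [OF q(1)] by (simp only: ennreal_mult mult.assoc)
    also have "\<dots> \<le> ennreal (?K * good_const q + 1) * ?F"
      by (intro mult_right_mono ennreal_leI) auto
    also have "(\<Sum>j\<in>blk L m. ennreal (g j powr q)) = (\<Sum>j\<in>blk L m. enn_powr (\<rho> (\<lambda>x. mx L (\<lambda>i. a i x) j)) q)"
      by (intro sum.cong) (auto simp: g enn_powr_ennreal g0)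
    finally show ?thesis by (simp add: F_def)
  qed
  then show ?thesis using pos by (auto simp: maximal_bound_def)
qed

text \<open>Raising the exponent: here the stopping blocks come from the increasing process
  \<open>\<rho> (SUP k\<ge>l. av k a)\<close>, and the assumption at \<open>q0\<close> on each block bounds its
  increments by the maximal function of the \<open>q0\<close>-th powers of the norms.\<close>

lemma maximal_bound_above:
  assumes C: "maximal_bound q0 C" and q: "1 < q0" "q0 < q"
  shows "maximal_bound q (good_const q * (C powr (q / q0) * good_const (q / q0)) + 1)"
proof -
  have C0: "0 \<le> C" using C by (simp add: maximal_bound_def)
  have q1: "1 < q" "1 < q / q0" using q by auto
  let ?K = "good_const q * (C powr (q / q0) * good_const (q / q0))"
  have K0: "0 \<le> ?K" using good_const_nonneg q1 by simp
  have "(\<Sum>j\<in>blk L m. enn_powr (\<rho> (\<lambda>x. mx L (\<lambda>i. a i x) j)) q)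
      \<le> ennreal (?K + 1) * (\<Sum>j\<in>blk L m. enn_powr (\<rho> (a j)) q)"
    if a: "\<And>i. a i \<in> D" for L m and a :: "int \<Rightarrow> 'b \<Rightarrow> ennreal"
  proof (cases "\<exists>i\<in>blk L m. \<rho> (a i) = \<infinity>")
    case True
    then have top: "(\<Sum>j\<in>blk L m. enn_powr (\<rho> (a j)) q) = \<infinity>" by (auto simp: ennreal_sum_eq_top)
    show ?thesis unfolding top using K0 by (simp add: ennreal_mult_top)
  next
    case False
    define F where "F i = \<rho> (a i)" for i
    have Ffin: "F i < \<infinity>" if "i \<in> blk L m" for i using False that by (auto simp: F_def less_top)
    define g where "g j = enn2real (\<rho> (\<lambda>x. mx L (\<lambda>i. a i x) j))" for j
    have g: "\<rho> (\<lambda>x. mx L (\<lambda>i. a i x) j) = ennreal (g j)" if "j \<in> blk L m" for j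
      using norm_mx_finite [of a L j] a Ffin blk_eqI [OF that] by (simp add: g_def F_def)
    have g0: "0 \<le> g j" for j by (simp add: g_def)
    \<comment> \<open>The maximal function of the q0-th powers, with the q0-th root taken;
      \<open>C\<close> is the price of using the hypothesis on each stopping block.\<close>
    define Y where "Y j = enn_powr (ennreal C * mx L (\<lambda>i. enn_powr (F i) q0) j) (1 / q0)" for j
    have key: "ennreal l * of_nat (card {j \<in> blk L m. 2 * l < g j}) \<le> (\<Sum>j\<in>{j \<in> blk L m. l < g j}. Y j)"
      if l: "0 < l" for l :: real
    proof -
      \<comment> \<open>The maximal function over the levels from \<open>k\<close> on. It is
        constant on blocks of level \<open>k\<close> and decreases in \<open>k\<close>, so a
        threshold for its norm defines a stopping level.\<close>
      define tail where "tail k j x = (SUP k\<in>{k..L}. av k (\<lambda>i. a i x) j)" for k j x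
      have tailD: "tail k j \<in> D" for k j unfolding tail_def by (intro SUP_av_closed a) auto
      define P where "P k j \<longleftrightarrow> ennreal l < \<rho> (tail k j)" for k j
      have Pcong: "P k i = P k j" if "i \<in> blk k j" for k i j
      proof -
        have "av k' (\<lambda>i. a i x) i = av k' (\<lambda>i. a i x) j" if "k' \<in> {k..L}" for k' x
          using blk_mono [of k k' j] that \<open>i \<in> blk k j\<close> by (intro av_cong_blk) auto
        then have "tail k i = tail k j" unfolding tail_def by (intro ext SUP_cong) auto
        then show ?thesis by (simp add: P_def)
      qed
      define \<tau> where "\<tau> = stop_level L P"
      have stop: "stopping L \<tau>"
        unfolding \<tau>_def by (rule stopping_stop_level) (rule Pcong)
      have tail0: "tail 0 j = (\<lambda>x. mx L (\<lambda>i. a i x) j)" for j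
        by (simp add: tail_def mx_def atMost_atLeast0 fun_eq_iff)
      have mono_tail: "\<rho> (tail k j) \<le> \<rho> (tail 0 j)" for k j
        by (intro mono tailD) (auto simp: tail_def intro: SUP_subset_mono)
      have U: "l < g j \<longleftrightarrow> P (\<tau> j) j" if j: "j \<in> blk L m" for j
      proof -
        have "l < g j \<longleftrightarrow> P 0 j"
          using g [OF j] l by (simp add: P_def tail0 ennreal_less_iff)
        moreover have "P 0 j \<longleftrightarrow> P (\<tau> j) j"
          using stop_level_holds(1) [of 0 L P j] mono_tail [of "\<tau> j" j]
          by (auto simp: \<tau>_def P_def)
        ultimately show ?thesis by simp
      qed
      define H where "H j = \<rho> (\<lambda>x. mx (\<tau> j) (\<lambda>i. a i x) j)" for j
      \<comment> \<open>Just above the stopping level the norm of the tail is at most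
        \<open>l\<close>. If the whole norm exceeds \<open>2 * l\<close>, the levels up to \<tau>
        must contribute at least \<open>l\<close>.\<close>
      have big: "ennreal l \<le> H j" if j: "j \<in> blk L m" "2 * l < g j" for j
      proof -
        have "tail 0 j x \<le> mx (\<tau> j) (\<lambda>i. a i x) j + tail (Suc (\<tau> j)) j x" for x
          unfolding tail_def
        proof (rule SUP_least)
          fix k assume "k \<in> {0..L}"
          then consider "k \<le> \<tau> j" | "k \<in> {Suc (\<tau> j)..L}" by fastforce
          then show "av k (\<lambda>i. a i x) j \<le> mx (\<tau> j) (\<lambda>i. a i x) j + (SUP k\<in>{Suc (\<tau> j)..L}. av k (\<lambda>i. a i x) j)"
          proof cases
            case 1
            then show ?thesis by (intro add_increasing2 av_le_mx) auto
          next
            case 2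
            then show ?thesis by (intro add_increasing SUP_upper) auto
          qed
        qed
        then have "\<rho> (tail 0 j) \<le> \<rho> (\<lambda>x. mx (\<tau> j) (\<lambda>i. a i x) j + tail (Suc (\<tau> j)) j x)"
          by (intro mono add mx_closed tailD a)
        also have "\<dots> \<le> H j + \<rho> (tail (Suc (\<tau> j)) j)"
          unfolding H_def by (intro triangle mx_closed tailD a)
        also have "\<rho> (tail (Suc (\<tau> j)) j) \<le> ennreal l"
        proof (cases "Suc (\<tau> j) \<le> L")
          case True
          then show ?thesis
            using stop_level_above [of L P j "Suc (\<tau> j)"] by (simp add: \<tau>_def P_def not_less)
        next
          case False
          \<comment> \<open>At \<open>\<tau> j = L\<close> no level is left, and the supremum over
            the empty set is 0.\<close>
          then have "tail (Suc (\<tau> j)) j = (\<lambda>_. 0)" by (simp add: tail_def bot_ennreal fun_eq_iff)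
          then show ?thesis using norm_zero by simp
        qed
        finally have "ennreal (g j) \<le> H j + ennreal l"
          using g [OF j(1)] by (simp add: tail0 add_left_mono)
        moreover have "ennreal (2 * l) \<le> ennreal (g j)" using j by (intro ennreal_leI) auto
        ultimately have "ennreal l + ennreal l \<le> H j + ennreal l"
          using l by (simp flip: ennreal_plus)
        then show ?thesis using ennreal_add_left_cancel_le [of "ennreal l" "ennreal l" "H j"]
          by (simp add: add.commute)
      qed
      \<comment> \<open>The stopping block is a window for the truncation level
        \<open>\<tau> j\<close>, so the hypothesis at \<open>q0\<close> applies to it; Jensen
        compares the mean of \<open>H\<close> with the mean of its q0-th power.\<close>
      have avH: "av (\<tau> j) H j \<le> Y j" if j: "j \<in> blk L m" for j
      proof -
        have "enn_powr (av (\<tau> j) H j) q0 \<le> av (\<tau> j) (\<lambda>i. enn_powr (H i) q0) j"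
          using q by (intro enn_powr_av_le) auto
        also have "\<dots> = ennreal (1 / 2 ^ \<tau> j) * (\<Sum>i\<in>blk (\<tau> j) j. enn_powr (\<rho> (\<lambda>x. mx (\<tau> j) (\<lambda>i. a i x) i)) q0)"
          using stop by (auto simp: av_def H_def stopping_def intro!: arg_cong2 [where f = "(*)"] sum.cong)
        also have "\<dots> \<le> ennreal (1 / 2 ^ \<tau> j) * (ennreal C * (\<Sum>i\<in>blk (\<tau> j) j. enn_powr (\<rho> (a i)) q0))"
          using C a by (intro mult_left_mono) (auto simp: maximal_bound_def)
        also have "\<dots> = ennreal C * av (\<tau> j) (\<lambda>i. enn_powr (F i) q0) j"
          by (simp add: av_def F_def mult_ac)
        also have "\<dots> \<le> ennreal C * mx L (\<lambda>i. enn_powr (F i) q0) j"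
          using stop by (intro mult_left_mono av_le_mx) (auto simp: stopping_def)
        finally show ?thesis unfolding Y_def using q by (simp add: enn_powr_le_swap)
      qed
      have Ublk: "l < g i \<longleftrightarrow> l < g j" if "i \<in> blk (\<tau> j) j" "j \<in> blk L m" for i j
      proof -
        have "\<tau> j \<le> L" using stop by (simp add: stopping_def)
        then have i: "i \<in> blk L m"
          using blk_mono [of "\<tau> j" L j] that blk_eqI [OF that(2)] by auto
        have "\<tau> i = \<tau> j" using stop that by (auto simp: stopping_def)
        then show ?thesis using U [OF i] U [OF that(2)] Pcong [OF that(1)] by simp
      qed
      have "ennreal l * of_nat (card {j \<in> blk L m. 2 * l < g j}) = (\<Sum>j\<in>{j \<in> blk L m. 2 * l < g j}. ennreal l)"
        by (simp add: mult.commute)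
      also have "\<dots> \<le> (\<Sum>j\<in>{j \<in> blk L m. 2 * l < g j}. H j)"
        using big by (intro sum_mono) auto
      also have "\<dots> \<le> (\<Sum>j\<in>{j \<in> blk L m. l < g j}. H j)"
        using l by (intro sum_mono2) auto
      also have "\<dots> = (\<Sum>j\<in>blk L m. if l < g j then H j else 0)"
        by (simp add: sum.inter_filter)
      also have "\<dots> = (\<Sum>j\<in>blk L m. av (\<tau> j) (\<lambda>i. if l < g i then H i else 0) j)"
        by (rule sum_av_stopping [OF stop, symmetric])
      also have "\<dots> = (\<Sum>j\<in>blk L m. if l < g j then av (\<tau> j) H j else 0)"
        by (intro sum.cong refl) (auto simp: av_def Ublk cong: sum.cong)
      also have "\<dots> \<le> (\<Sum>j\<in>blk L m. if l < g j then Y j else 0)"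
        using avH by (intro sum_mono) auto
      also have "\<dots> = (\<Sum>j\<in>{j \<in> blk L m. l < g j}. Y j)"
        by (simp add: sum.inter_filter)
      finally show ?thesis .
    qed
    let ?F = "\<Sum>j\<in>blk L m. enn_powr (F j) q"
    have "(\<Sum>j\<in>blk L m. ennreal (g j powr q)) \<le> ennreal (good_const q) * (\<Sum>j\<in>blk L m. enn_powr (Y j) q)"
      by (rule good_inequality) (use q1 g0 key in auto)
    also have "(\<Sum>j\<in>blk L m. enn_powr (Y j) q)
      = ennreal (C powr (q / q0)) * (\<Sum>j\<in>blk L m. enn_powr (mx L (\<lambda>i. enn_powr (F i) q0) j) (q / q0))"
      using q C0 by (simp add: Y_def enn_powr_powr enn_powr_mult enn_powr_ennreal powr_powr sum_distrib_left)
    also have "\<dots> \<le> ennreal (C powr (q / q0)) * (ennreal (good_const (q / q0)) *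
        (\<Sum>j\<in>blk L m. enn_powr (enn_powr (F j) q0) (q / q0)))"
      by (intro mult_left_mono mx_scalar_bound q1) auto
    also have "(\<Sum>j\<in>blk L m. enn_powr (enn_powr (F j) q0) (q / q0)) = ?F"
      using q by (simp add: enn_powr_powr)
    finally have "(\<Sum>j\<in>blk L m. ennreal (g j powr q))
      \<le> ennreal (good_const q) * (ennreal (C powr (q / q0)) * (ennreal (good_const (q / q0)) * ?F))"
      by (simp add: mult_left_mono)
    also have "\<dots> = ennreal ?K * ?F"
      using good_const_nonneg [OF q1(1)] good_const_nonneg [OF q1(2)]
      by (simp only: ennreal_mult powr_ge_zero mult_nonneg_nonneg mult.assoc)
    also have "\<dots> \<le> ennreal (?K + 1) * ?F"
      by (intro mult_right_mono ennreal_leI) auto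
    also have "(\<Sum>j\<in>blk L m. ennreal (g j powr q)) = (\<Sum>j\<in>blk L m. enn_powr (\<rho> (\<lambda>x. mx L (\<lambda>i. a i x) j)) q)"
      by (intro sum.cong) (auto simp: g enn_powr_ennreal g0)
    finally show ?thesis by (simp add: F_def)
  qed
  then show ?thesis using K0 by (auto simp: maximal_bound_def)
qed

lemma maximal_bound_exponent:
  assumes "maximal_bound q0 C" "1 < q0" "1 < q"
  shows "maximal_bound q (exponent_const q0 q C)"
proof (cases q q0 rule: linorder_cases)
  case less
  show ?thesis
    using maximal_bound_below [OF assms(1,3) less] less unfolding exponent_const_def by (simp only: if_True)
next
  case equal
  then show ?thesis using assms(1) by (simp add: exponent_const_def)
next
  case greater
  then have "\<not> q < q0" by simp
  then show ?thesis
    using maximal_bound_above [OF assms(1,2) greater] greater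
    unfolding exponent_const_def by (simp only: if_True if_False)
qed

end

section \<open>Iterated norms\<close>

lemma upd_nth [simp]: "upd x i t $ j = (if j = i then t else x $ j)"
  by (simp add: upd_def)

lemma upd_same [simp]: "upd (upd x i s) i t = upd x i t"
  by (simp add: vec_eq_iff)

lemma upd_commute: "i \<noteq> j \<Longrightarrow> upd (upd x i s) j t = upd (upd x j t) i s"
  by (simp add: vec_eq_iff)

lemma upd_eq: "upd x i t = x + (t - x $ i) *\<^sub>R axis i 1"
  by (auto simp: vec_eq_iff axis_def)

lemma borel_measurable_upd [measurable (raw)]:
  fixes f :: "'a \<Rightarrow> real ^ 'n"
  assumes [measurable]: "f \<in> borel_measurable M" "g \<in> borel_measurable M"
  shows "(\<lambda>w. upd (f w) i (g w)) \<in> borel_measurable M"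
proof -
  have "(\<lambda>z :: real ^ 'n. z $ i) \<in> borel_measurable borel"
    by (intro borel_measurable_continuous_onI continuous_on_component continuous_on_id)
  from measurable_compose [OF assms(1) this]
  show ?thesis unfolding upd_eq by (intro borel_measurable_add borel_measurable_scaleR borel_measurable_diff) simp_all
qed

definition slice_norm :: "real \<Rightarrow> 'n \<Rightarrow> (real ^ 'n \<Rightarrow> ennreal) \<Rightarrow> real ^ 'n \<Rightarrow> ennreal" where
  "slice_norm q i f x = enn_powr (\<integral>\<^sup>+t. enn_powr (f (upd x i t)) q \<partial>lborel) (1 / q)"

text \<open>The root is taken after every integration, unlike in \<open>iterated_int\<close>, so
  that each stage is a norm in one variable, and homogeneity, Minkowski's inequality and monotone
  limits follow by induction.\<close>

primrec nested_norm :: "real ^ 'n \<Rightarrow> 'n list \<Rightarrow> (real ^ 'n \<Rightarrow> ennreal) \<Rightarrow> real ^ 'n \<Rightarrow> ennreal" where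
  "nested_norm q [] f = f"
| "nested_norm q (i # is) f = nested_norm q is (slice_norm (q $ i) i f)"

lemma nested_norm_append: "nested_norm q (is @ js) f = nested_norm q js (nested_norm q is f)"
  by (induction "is" arbitrary: f) auto

lemma borel_measurable_slice_norm_param:
  fixes k :: "'s \<Rightarrow> real ^ 'n \<Rightarrow> ennreal"
  assumes k [measurable]: "(\<lambda>(s, x). k s x) \<in> borel_measurable (M \<Otimes>\<^sub>M borel)"
  shows "(\<lambda>(s, x). slice_norm q i (k s) x) \<in> borel_measurable (M \<Otimes>\<^sub>M borel)"
proof -
  have "(\<lambda>z. (fst (fst z), upd (snd (fst z)) i (snd z)))
      \<in> (M \<Otimes>\<^sub>M borel) \<Otimes>\<^sub>M lborel \<rightarrow>\<^sub>M M \<Otimes>\<^sub>M borel"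
    by measurable
  from measurable_compose [OF this k]
  have "(\<lambda>(p, t). enn_powr (k (fst p) (upd (snd p) i t)) q) \<in> borel_measurable ((M \<Otimes>\<^sub>M borel) \<Otimes>\<^sub>M lborel)"
    by (simp add: case_prod_unfold borel_measurable_enn_powr)
  from lborel.borel_measurable_nn_integral [OF this]
  show ?thesis
    unfolding slice_norm_def case_prod_unfold by (intro borel_measurable_enn_powr)
qed

lemma borel_measurable_slice_norm:
  fixes f :: "real ^ 'n \<Rightarrow> ennreal"
  assumes [measurable]: "f \<in> borel_measurable borel"
  shows "slice_norm q i f \<in> borel_measurable borel"
proof -
  have "(\<lambda>(x, t). enn_powr (f (upd x i t)) q) \<in> borel_measurable (borel \<Otimes>\<^sub>M lborel)"
    by measurable
  from lborel.borel_measurable_nn_integral [OF this]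
  show ?thesis
    unfolding slice_norm_def [abs_def] by (intro borel_measurable_enn_powr)
qed

lemma borel_measurable_nested_norm:
  "f \<in> borel_measurable borel \<Longrightarrow> nested_norm q is f \<in> borel_measurable borel"
  by (induction "is" arbitrary: f) (auto intro: borel_measurable_slice_norm)

lemma borel_measurable_norm_compose [measurable (raw)]:
  assumes "f \<in> borel_measurable borel" "g \<in> borel_measurable M"
  shows "(\<lambda>w. slice_norm e i f (g w)) \<in> borel_measurable M"
    and "(\<lambda>w. nested_norm q is f (g w)) \<in> borel_measurable M"
  using assms by (auto intro: measurable_compose borel_measurable_slice_norm borel_measurable_nested_norm)

lemma slice_norm_mono: "(\<And>x. f x \<le> g x) \<Longrightarrow> 0 < q \<Longrightarrow> slice_norm q i f x \<le> slice_norm q i g x"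
  unfolding slice_norm_def by (intro enn_powr_mono nn_integral_mono) auto

lemma nested_norm_mono:
  "(\<And>x. f x \<le> g x) \<Longrightarrow> (\<And>i. i \<in> set is \<Longrightarrow> 0 < q $ i) \<Longrightarrow> nested_norm q is f x \<le> nested_norm q is g x"
proof (induction "is" arbitrary: f g)
  case (Cons i "is")
  have "0 < q $ i" using Cons.prems(2) by simp
  then have "slice_norm (q $ i) i f y \<le> slice_norm (q $ i) i g y" for y
    using Cons.prems(1) by (intro slice_norm_mono)
  then show ?case using Cons.IH Cons.prems(2) by simp
qed simp

lemma slice_norm_cmult:
  assumes [measurable]: "f \<in> borel_measurable borel" and "0 < q"
  shows "slice_norm q i (\<lambda>x. c * f x) x = c * slice_norm q i f x"
proof -
  have "(\<integral>\<^sup>+t. enn_powr (c * f (upd x i t)) q \<partial>lborel)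
    = enn_powr c q * (\<integral>\<^sup>+t. enn_powr (f (upd x i t)) q \<partial>lborel)"
    using assms by (subst nn_integral_cmult [symmetric]) (auto simp: enn_powr_mult)
  then show ?thesis
    using assms by (simp add: slice_norm_def enn_powr_mult enn_powr_powr)
qed

lemma nested_norm_cmult:
  assumes "f \<in> borel_measurable borel" "\<And>i. i \<in> set is \<Longrightarrow> 0 < q $ i"
  shows "nested_norm q is (\<lambda>x. c * f x) x = c * nested_norm q is f x"
  using assms
proof (induction "is" arbitrary: f)
  case (Cons i "is")
  have "slice_norm (q $ i) i (\<lambda>x. c * f x) = (\<lambda>x. c * slice_norm (q $ i) i f x)"
    using Cons.prems by (intro ext slice_norm_cmult) auto
  then show ?case using Cons by (simp add: borel_measurable_slice_norm)
qed simp

text \<open>One application of Minkowski's inequality per variable, after which the remaining stages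
  use only monotonicity. Joint measurability in \<open>s\<close> and \<open>x\<close> is the
  invariant of the induction.\<close>

lemma nested_norm_Minkowski:
  fixes k :: "'s \<Rightarrow> real ^ 'n \<Rightarrow> ennreal"
  assumes M: "finite_measure M"
  shows "(\<lambda>(s, x). k s x) \<in> borel_measurable (M \<Otimes>\<^sub>M borel) \<Longrightarrow> (\<And>i. i \<in> set is \<Longrightarrow> 1 \<le> q $ i) \<Longrightarrow>
     nested_norm q is (\<lambda>x. \<integral>\<^sup>+s. k s x \<partial>M) x \<le> (\<integral>\<^sup>+s. nested_norm q is (k s) x \<partial>M)"
proof (induction "is" arbitrary: k)
  case (Cons i "is")
  note [measurable] = Cons.prems(1)
  have q0: "0 < q $ j" if "j \<in> set (i # is)" for j
    using Cons.prems(2) [OF that] by simp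
  have "slice_norm (q $ i) i (\<lambda>x. \<integral>\<^sup>+s. k s x \<partial>M) y \<le> (\<integral>\<^sup>+s. slice_norm (q $ i) i (k s) y \<partial>M)" for y
  proof -
    have "(\<lambda>z. (fst z, upd y i (snd z))) \<in> M \<Otimes>\<^sub>M lborel \<rightarrow>\<^sub>M M \<Otimes>\<^sub>M borel" by measurable
    from measurable_compose [OF this Cons.prems(1)]
    have "(\<lambda>(s, t). k s (upd y i t)) \<in> borel_measurable (M \<Otimes>\<^sub>M lborel)"
      by (simp add: case_prod_unfold)
    then show ?thesis
      unfolding slice_norm_def using Cons.prems
      by (intro nn_integral_Minkowski [OF M sigma_finite_lborel]) auto
  qed
  then have "nested_norm q is (slice_norm (q $ i) i (\<lambda>x. \<integral>\<^sup>+s. k s x \<partial>M)) x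
    \<le> nested_norm q is (\<lambda>y. \<integral>\<^sup>+s. slice_norm (q $ i) i (k s) y \<partial>M) x"
    using q0 by (intro nested_norm_mono) auto
  also have "\<dots> \<le> (\<integral>\<^sup>+s. nested_norm q is (slice_norm (q $ i) i (k s)) x \<partial>M)"
    using Cons.prems by (intro Cons.IH borel_measurable_slice_norm_param) auto
  finally show ?case by simp
qed simp

text \<open>The integral inequality for counting measure on two points.\<close>

lemma nested_norm_triangle:
  fixes f g :: "real ^ 'n \<Rightarrow> ennreal"
  assumes [measurable]: "f \<in> borel_measurable borel" "g \<in> borel_measurable borel"
    and q: "\<And>i. i \<in> set is \<Longrightarrow> 1 \<le> q $ i"
  shows "nested_norm q is (\<lambda>x. f x + g x) x \<le> nested_norm q is f x + nested_norm q is g x"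
proof -
  let ?M = "count_space (UNIV :: bool set)"
  let ?k = "\<lambda>b x. if b then f x else g x"
  have k: "(\<lambda>(b, x). ?k b x) \<in> borel_measurable (?M \<Otimes>\<^sub>M borel)"
    by (rule measurable_pair_measure_countable1) auto
  have "finite_measure ?M" by (rule finite_measure_count_space) simp
  from nested_norm_Minkowski [OF this k q]
  show ?thesis by (simp add: nn_integral_count_space_finite UNIV_bool add.commute)
qed

lemma nested_norm_upd:
  "i \<notin> set is \<Longrightarrow> nested_norm q is f (upd x i t) = nested_norm q is (\<lambda>y. f (upd y i t)) x"
proof (induction "is" arbitrary: f)
  case (Cons j "is")
  have "slice_norm (q $ j) j f (upd y i t) = slice_norm (q $ j) j (\<lambda>y. f (upd y i t)) y" for y
    using Cons.prems by (auto simp: slice_norm_def upd_commute)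
  then show ?case using Cons by simp
qed simp

lemma function_norm_nested_norm:
  assumes "\<And>i. i \<in> set is \<Longrightarrow> 1 \<le> q $ i"
  shows "function_norm (\<lambda>f. nested_norm q is f x) (borel_measurable borel)"
proof -
  have q0: "0 < q $ i" if "i \<in> set is" for i using assms [OF that] by simp
  show ?thesis
    by standard (auto intro: nested_norm_mono nested_norm_triangle assms q0 simp: nested_norm_cmult q0)
qed

text \<open>\<open>rev_induct\<close> peels off the outermost variable \<open>k\<close>. With the
  exponent \<open>q $ k\<close> in the active variable too, the \<open>q $ k\<close>-th power of the
  norm is an integral over \<open>k\<close> of powers of the remaining norm, and the bound passes
  through with the same constant. The claim is general in \<open>e\<close> because the induction
  hypothesis is used at \<open>q $ k\<close>, and uniform in \<open>x\<close> because that integral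
  runs over many points.\<close>

lemma nested_norm_maximal_bound:
  fixes q :: "real ^ 'n"
  assumes "\<And>i. i \<in> set is \<Longrightarrow> 1 < q $ i" "1 < e"
  shows "\<exists>C. \<forall>x. function_norm.maximal_bound (\<lambda>f. nested_norm q is f x) (borel_measurable borel) e C"
  using assms
proof (induction "is" arbitrary: e rule: rev_induct)
  case Nil
  have fn: "function_norm (\<lambda>f. f x) (borel_measurable borel)" for x :: "real ^ 'n"
    using function_norm_nested_norm [of "[]" q x] by simp
  have "function_norm.maximal_bound (\<lambda>f. f x) (borel_measurable borel) e (good_const e)" for x :: "real ^ 'n"
    unfolding function_norm.maximal_bound_def [OF fn]
    using good_const_nonneg [of e] mx_scalar_bound [of e] Nil by blast
  then show ?case by auto
next
  case (snoc k "is")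
  obtain C where C: "function_norm.maximal_bound (\<lambda>f. nested_norm q is f x) (borel_measurable borel) (q $ k) C" for x
    using snoc.IH [of "q $ k"] snoc.prems by auto
  have q0: "0 < q $ k" "1 < q $ k" using snoc.prems(1) [of k] by auto
  have fn: "function_norm (\<lambda>f. nested_norm q is f x) (borel_measurable borel)" for x
    using snoc.prems by (intro function_norm_nested_norm) (auto intro: less_imp_le)
  have fn': "function_norm (\<lambda>f. nested_norm q (is @ [k]) f x) (borel_measurable borel)" for x
    using snoc.prems by (intro function_norm_nested_norm) (auto intro: less_imp_le)
  note C' = C [unfolded function_norm.maximal_bound_def [OF fn]]
  have eq: "enn_powr (nested_norm q (is @ [k]) f x) (q $ k)
      = (\<integral>\<^sup>+t. enn_powr (nested_norm q is f (upd x k t)) (q $ k) \<partial>lborel)" for f x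
    using q0 by (simp add: nested_norm_append slice_norm_def enn_powr_powr)
  have "function_norm.maximal_bound (\<lambda>f. nested_norm q (is @ [k]) f x) (borel_measurable borel) (q $ k) C" for x
    unfolding function_norm.maximal_bound_def [OF fn']
  proof (intro conjI allI impI)
    show "0 \<le> C" using C' by blast
    fix L m and a :: "int \<Rightarrow> real ^ 'n \<Rightarrow> ennreal"
    assume a: "\<forall>i. a i \<in> borel_measurable borel"
    then have [measurable]: "a i \<in> borel_measurable borel" for i by simp
    have [measurable]: "(\<lambda>x. mx L (\<lambda>i. a i x) j) \<in> borel_measurable borel" for j
      by (rule function_norm.mx_closed [OF fn]) simp
    have "(\<Sum>j\<in>blk L m. enn_powr (nested_norm q (is @ [k]) (\<lambda>x. mx L (\<lambda>i. a i x) j) x) (q $ k))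
      = (\<integral>\<^sup>+t. (\<Sum>j\<in>blk L m. enn_powr (nested_norm q is (\<lambda>x. mx L (\<lambda>i. a i x) j) (upd x k t)) (q $ k)) \<partial>lborel)"
      unfolding eq by (subst nn_integral_sum) auto
    also have "\<dots> \<le> (\<integral>\<^sup>+t. ennreal C * (\<Sum>j\<in>blk L m. enn_powr (nested_norm q is (a j) (upd x k t)) (q $ k)) \<partial>lborel)"
      using C' a by (intro nn_integral_mono) blast
    also have "\<dots> = ennreal C * (\<Sum>j\<in>blk L m. enn_powr (nested_norm q (is @ [k]) (a j) x) (q $ k))"
      unfolding eq by (subst nn_integral_cmult, measurable, subst nn_integral_sum) auto
    finally show "(\<Sum>j\<in>blk L m. enn_powr (nested_norm q (is @ [k]) (\<lambda>x. mx L (\<lambda>i. a i x) j) x) (q $ k))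
      \<le> ennreal C * (\<Sum>j\<in>blk L m. enn_powr (nested_norm q (is @ [k]) (a j) x) (q $ k))" .
  qed
  then have "function_norm.maximal_bound (\<lambda>f. nested_norm q (is @ [k]) f x) (borel_measurable borel) e (exponent_const (q $ k) e C)" for x
    using function_norm.maximal_bound_exponent [OF fn'] q0 snoc.prems(2) by blast
  then show ?case by blast
qed

section \<open>The dyadic maximal function in one variable\<close>

definition cell :: "real \<Rightarrow> real \<Rightarrow> real \<Rightarrow> int" where
  "cell b d t = \<lfloor>(t - b) / d\<rfloor>"

definition cell_mean :: "real \<Rightarrow> real \<Rightarrow> 'n \<Rightarrow> (real ^ 'n \<Rightarrow> ennreal) \<Rightarrow> int \<Rightarrow> real ^ 'n \<Rightarrow> ennreal" where
  "cell_mean b d i f m x = ennreal (1 / d) * (\<integral>\<^sup>+t. f (upd x i t) * indicator {t. cell b d t = m} t \<partial>lborel)"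

text \<open>The cells of mesh \<open>d\<close> take the place of the integers, so the averages are
  over grid intervals of lengths from \<open>d\<close> to \<open>d * 2 ^ L\<close>. The origin
  \<open>b\<close> allows translated grids.\<close>

definition dyadic_max :: "real \<Rightarrow> real \<Rightarrow> nat \<Rightarrow> 'n \<Rightarrow> (real ^ 'n \<Rightarrow> ennreal) \<Rightarrow> real ^ 'n \<Rightarrow> ennreal" where
  "dyadic_max b d L i f x = mx L (\<lambda>m. cell_mean b d i f m x) (cell b d (x $ i))"

lemma measurable_cell [measurable]: "cell b d \<in> borel \<rightarrow>\<^sub>M count_space UNIV"
  unfolding cell_def [abs_def] by measurable

lemma cell_set: "0 < d \<Longrightarrow> {t. cell b d t = m} = {b + m * d ..< b + (m + 1) * d}"
  by (auto simp: cell_def floor_eq_iff field_simps)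

lemma nn_integral_cell: "0 < d \<Longrightarrow> (\<integral>\<^sup>+t. c * indicator {t. cell b d t = m} t \<partial>lborel) = ennreal d * c"
  by (subst nn_integral_cmult_indicator) (auto simp: cell_set algebra_simps mult.commute)

lemma borel_measurable_cell_mean [measurable]:
  fixes f :: "real ^ 'n \<Rightarrow> ennreal"
  assumes [measurable]: "f \<in> borel_measurable borel"
  shows "cell_mean b d i f m \<in> borel_measurable borel"
proof -
  have "(\<lambda>(x, t). f (upd x i t) * indicator {t. cell b d t = m} t) \<in> borel_measurable (borel \<Otimes>\<^sub>M lborel)"
    by measurable
  from lborel.borel_measurable_nn_integral [OF this]
  show ?thesis unfolding cell_mean_def [abs_def] by measurable
qed

lemma cell_mean_upd [simp]: "cell_mean b d i f m (upd x i t) = cell_mean b d i f m x"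
  by (simp add: cell_mean_def)

text \<open>The line is cut into windows of \<open>2 ^ L\<close> cells, on which the discrete bound
  is available; \<open>w * 2 ^ L\<close> is the first cell of window \<open>w\<close>.\<close>

lemma nn_integral_windows:
  assumes [measurable]: "\<phi> \<in> borel_measurable borel"
  shows "(\<integral>\<^sup>+t. \<phi> t \<partial>lborel) = (\<integral>\<^sup>+w. (\<Sum>m\<in>blk L (w * 2 ^ L).
      \<integral>\<^sup>+t. \<phi> t * indicator {t. cell b d t = m} t \<partial>lborel) \<partial>count_space UNIV)"
proof -
  have "(\<integral>\<^sup>+t. \<phi> t \<partial>lborel)
    = (\<integral>\<^sup>+t. (\<integral>\<^sup>+w. \<phi> t * indicator {cell b d t div 2 ^ L} w \<partial>count_space UNIV) \<partial>lborel)"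
    by (simp add: nn_integral_cmult)
  also have "\<dots> = (\<integral>\<^sup>+t. (\<integral>\<^sup>+w. \<phi> t * indicator {t. cell b d t \<in> blk L (w * 2 ^ L)} t \<partial>count_space UNIV) \<partial>lborel)"
    by (intro nn_integral_cong) (auto simp: indicator_def blk_def)
  also have "\<dots> = (\<integral>\<^sup>+w. (\<integral>\<^sup>+t. \<phi> t * indicator {t. cell b d t \<in> blk L (w * 2 ^ L)} t \<partial>lborel) \<partial>count_space UNIV)"
    by (rule nn_integral_count_space_nn_integral) auto
  also have "\<dots> = (\<integral>\<^sup>+w. (\<Sum>m\<in>blk L (w * 2 ^ L).
      \<integral>\<^sup>+t. \<phi> t * indicator {t. cell b d t = m} t \<partial>lborel) \<partial>count_space UNIV)"
  proof (rule nn_integral_cong)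
    fix w :: int
    have "\<phi> t * indicator {t. cell b d t \<in> blk L (w * 2 ^ L)} t
      = (\<Sum>m\<in>blk L (w * 2 ^ L). \<phi> t * indicator {t. cell b d t = m} t)" for t
      by (simp add: sum_distrib_left [symmetric] indicator_def sum.delta')
    then show "(\<integral>\<^sup>+t. \<phi> t * indicator {t. cell b d t \<in> blk L (w * 2 ^ L)} t \<partial>lborel)
      = (\<Sum>m\<in>blk L (w * 2 ^ L). \<integral>\<^sup>+t. \<phi> t * indicator {t. cell b d t = m} t \<partial>lborel)"
      by (simp only:) (rule nn_integral_sum, measurable)
  qed
  finally show ?thesis .
qed

text \<open>Minkowski moves the inner norm under the mean over the cell and Jensen moves the power
  \<open>q\<close>, both for the uniform probability measure \<open>M\<close> on the cell.\<close>

lemma nested_norm_cell_mean: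
  fixes f :: "real ^ 'n \<Rightarrow> ennreal"
  assumes [measurable]: "f \<in> borel_measurable borel" and d: "0 < d" and q: "1 \<le> q"
    and e: "\<And>j. j \<in> set is \<Longrightarrow> 1 \<le> e $ j" and i: "i \<notin> set is"
  shows "ennreal d * enn_powr (nested_norm e is (cell_mean b d i f m) x) q
    \<le> (\<integral>\<^sup>+t. enn_powr (nested_norm e is f (upd x i t)) q * indicator {t. cell b d t = m} t \<partial>lborel)"
proof -
  let ?R = "\<integral>\<^sup>+t. enn_powr (nested_norm e is f (upd x i t)) q * indicator {t. cell b d t = m} t \<partial>lborel"
  define M where "M = density lborel (\<lambda>t. ennreal (1 / d) * indicator {t. cell b d t = m} t)"
  have int: "(\<integral>\<^sup>+t. h t \<partial>M) = ennreal (1 / d) * (\<integral>\<^sup>+t. h t * indicator {t. cell b d t = m} t \<partial>lborel)"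
    if [measurable]: "h \<in> borel_measurable borel" for h
    unfolding M_def using d
    by (subst nn_integral_density) (auto simp: nn_integral_cmult [symmetric] mult_ac)
  have sets [measurable_cong]: "sets M = sets borel" by (simp add: M_def)
  have one: "(\<integral>\<^sup>+t. 1 \<partial>M) = 1"
  proof -
    have "(\<integral>\<^sup>+t. 1 \<partial>M) = ennreal (1 / d) * ennreal d"
      using nn_integral_cell [OF d, of 1 b m] by (subst int) auto
    then show ?thesis using d by (simp flip: ennreal_mult)
  qed
  have fin: "finite_measure M"
    using one by (intro finite_measureI) simp
  have "nested_norm e is (cell_mean b d i f m) x = nested_norm e is (\<lambda>y. \<integral>\<^sup>+t. f (upd y i t) \<partial>M) x"
    by (simp add: int cell_mean_def [abs_def])
  also have "\<dots> \<le> (\<integral>\<^sup>+t. nested_norm e is (\<lambda>y. f (upd y i t)) x \<partial>M)"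
    using e by (intro nested_norm_Minkowski fin) auto
  also have "\<dots> = (\<integral>\<^sup>+t. nested_norm e is f (upd x i t) \<partial>M)"
    using i by (simp add: nested_norm_upd)
  finally have "enn_powr (nested_norm e is (cell_mean b d i f m) x) q
    \<le> enn_powr (\<integral>\<^sup>+t. nested_norm e is f (upd x i t) \<partial>M) q"
    using q by (intro enn_powr_mono) auto
  also have "\<dots> \<le> (\<integral>\<^sup>+t. enn_powr (nested_norm e is f (upd x i t)) q * ennreal (1 powr (1 - q)) \<partial>M)
      * enn_powr (\<integral>\<^sup>+t. ennreal 1 \<partial>M) (q - 1)"
    using q one by (intro nn_integral_Jensen) auto
  also have "\<dots> = (\<integral>\<^sup>+t. enn_powr (nested_norm e is f (upd x i t)) q \<partial>M)"
    using one enn_powr_ennreal [of 1 "q - 1"] by simp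
  also have "\<dots> = ennreal (1 / d) * ?R"
    by (rule int) measurable
  finally have "ennreal d * enn_powr (nested_norm e is (cell_mean b d i f m) x) q
    \<le> ennreal d * (ennreal (1 / d) * ?R)"
    by (rule mult_left_mono) simp
  also have "ennreal d * (ennreal (1 / d) * z) = z" for z
    using d by (simp flip: mult.assoc ennreal_mult)
  finally show ?thesis .
qed

lemma dyadic_max_upd: "dyadic_max b d L i f (upd x i t) = mx L (\<lambda>m. cell_mean b d i f m x) (cell b d t)"
  by (simp add: dyadic_max_def)

lemma borel_measurable_mx [measurable (raw)]:
  assumes "\<And>m. a m \<in> borel_measurable M"
  shows "(\<lambda>x. mx L (\<lambda>m. a m x) j) \<in> borel_measurable M"
  unfolding mx_def av_def using assms by measurable

lemma borel_measurable_dyadic_max [measurable]: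
  fixes f :: "real ^ 'n \<Rightarrow> ennreal"
  assumes [measurable]: "f \<in> borel_measurable borel"
  shows "dyadic_max b d L i f \<in> borel_measurable borel"
proof -
  have "(\<lambda>x. (cell b d (x $ i))) \<in> (borel :: (real ^ 'n) measure) \<rightarrow>\<^sub>M count_space UNIV"
    by (intro measurable_compose [OF _ measurable_cell] borel_measurable_continuous_onI
        continuous_on_component continuous_on_id)
  then show ?thesis
    unfolding dyadic_max_def [abs_def]
    by (rule measurable_compose_countable' [rotated]) (auto intro!: borel_measurable_mx)
qed

text \<open>Along coordinate \<open>i\<close> the dyadic maximal function is constant on each cell,
  so the integral is a sum of \<open>d\<close> times discrete values. The discrete bound is applied
  window by window, and \<open>nested_norm_cell_mean\<close> leads from the means back to
  \<open>f\<close>.\<close>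

lemma dyadic_max_slice_bound:
  fixes f :: "real ^ 'n \<Rightarrow> ennreal"
  assumes f [measurable]: "f \<in> borel_measurable borel" and d: "0 < d" and q: "1 \<le> q"
    and e: "\<And>j. j \<in> set is \<Longrightarrow> 1 \<le> e $ j" and i: "i \<notin> set is"
    and C: "function_norm.maximal_bound (\<lambda>f. nested_norm e is f x) (borel_measurable borel) q C"
  shows "(\<integral>\<^sup>+t. enn_powr (nested_norm e is (dyadic_max b d L i f) (upd x i t)) q \<partial>lborel)
    \<le> ennreal C * (\<integral>\<^sup>+t. enn_powr (nested_norm e is f (upd x i t)) q \<partial>lborel)"
proof -
  have fn: "function_norm (\<lambda>f. nested_norm e is f x) (borel_measurable borel)"
    by (rule function_norm_nested_norm [OF e])
  note C' = C [unfolded function_norm.maximal_bound_def [OF fn]]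
  let ?a = "cell_mean b d i f"
  let ?k = "\<lambda>m. enn_powr (nested_norm e is (\<lambda>y. mx L (\<lambda>m. ?a m y) m) x) q"
  let ?J = "\<lambda>w. blk L (w * 2 ^ L)"
  have "(\<integral>\<^sup>+t. enn_powr (nested_norm e is (dyadic_max b d L i f) (upd x i t)) q \<partial>lborel)
    = (\<integral>\<^sup>+t. ?k (cell b d t) \<partial>lborel)"
    using i by (simp add: nested_norm_upd dyadic_max_upd)
  also have "\<dots> = (\<integral>\<^sup>+w. (\<Sum>m\<in>?J w. \<integral>\<^sup>+t. ?k (cell b d t) * indicator {t. cell b d t = m} t \<partial>lborel) \<partial>count_space UNIV)"
    by (rule nn_integral_windows) (rule measurable_compose [OF measurable_cell], simp)
  also have "\<dots> = (\<integral>\<^sup>+w. (\<Sum>m\<in>?J w. ennreal d * ?k m) \<partial>count_space UNIV)"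
  proof (intro nn_integral_cong sum.cong refl)
    fix m
    have "(\<integral>\<^sup>+t. ?k (cell b d t) * indicator {t. cell b d t = m} t \<partial>lborel)
      = (\<integral>\<^sup>+t. ?k m * indicator {t. cell b d t = m} t \<partial>lborel)"
      by (intro nn_integral_cong) (auto simp: indicator_def)
    then show "(\<integral>\<^sup>+t. ?k (cell b d t) * indicator {t. cell b d t = m} t \<partial>lborel) = ennreal d * ?k m"
      by (simp add: nn_integral_cell [OF d])
  qed
  also have "\<dots> \<le> (\<integral>\<^sup>+w. ennreal C * (\<Sum>m\<in>?J w. ennreal d * enn_powr (nested_norm e is (?a m) x) q) \<partial>count_space UNIV)"
  proof (rule nn_integral_mono)
    fix w :: int
    have "(\<Sum>m\<in>?J w. ?k m) \<le> ennreal C * (\<Sum>m\<in>?J w. enn_powr (nested_norm e is (?a m) x) q)"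
      using C' f by (auto intro: borel_measurable_cell_mean)
    then have "ennreal d * (\<Sum>m\<in>?J w. ?k m) \<le> ennreal d * (ennreal C * (\<Sum>m\<in>?J w. enn_powr (nested_norm e is (?a m) x) q))"
      by (rule mult_left_mono) simp
    then show "(\<Sum>m\<in>?J w. ennreal d * ?k m) \<le> ennreal C * (\<Sum>m\<in>?J w. ennreal d * enn_powr (nested_norm e is (?a m) x) q)"
      by (simp add: sum_distrib_left mult.left_commute)
  qed
  also have "\<dots> \<le> (\<integral>\<^sup>+w. ennreal C * (\<Sum>m\<in>?J w. \<integral>\<^sup>+t. enn_powr (nested_norm e is f (upd x i t)) q * indicator {t. cell b d t = m} t \<partial>lborel) \<partial>count_space UNIV)"
    using f d q e i by (intro nn_integral_mono mult_left_mono sum_mono nested_norm_cell_mean) auto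
  also have "\<dots> = ennreal C * (\<integral>\<^sup>+t. enn_powr (nested_norm e is f (upd x i t)) q \<partial>lborel)"
  proof -
    have m: "(\<lambda>t. enn_powr (nested_norm e is f (upd x i t)) q) \<in> borel_measurable borel" by measurable
    show ?thesis
      unfolding nn_integral_windows [OF m, where L = L and b = b and d = d] by (rule nn_integral_cmult) simp
  qed
  finally show ?thesis .
qed

text \<open>The list is split at \<open>i\<close>: the inner part \<open>xs\<close> is covered by
  the vector-valued bound, and the outer part \<open>ys\<close> by monotonicity and
  homogeneity.\<close>

lemma dyadic_max_bound:
  fixes q :: "real ^ 'n"
  assumes q: "\<And>j. 1 < q $ j" and "is": "i \<notin> set xs"
  shows "\<exists>C\<ge>0. \<forall>b d L f x. 0 < d \<longrightarrow> f \<in> borel_measurable borel \<longrightarrow>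
     nested_norm q (xs @ i # ys) (dyadic_max b d L i f) x \<le> ennreal C * nested_norm q (xs @ i # ys) f x"
proof -
  obtain C where C: "function_norm.maximal_bound (\<lambda>f. nested_norm q xs f x) (borel_measurable borel) (q $ i) C" for x
    using nested_norm_maximal_bound [of xs q "q $ i"] q by auto
  have q0: "0 < q $ j" "1 \<le> q $ j" for j using q [of j] by auto
  have fn: "function_norm (\<lambda>f. nested_norm q xs f x) (borel_measurable borel)" for x
    by (rule function_norm_nested_norm) (rule q0)
  have C0: "0 \<le> C" using C unfolding function_norm.maximal_bound_def [OF fn] by blast
  let ?C = "C powr (1 / q $ i)"
  have "nested_norm q (xs @ i # ys) (dyadic_max b d L i f) x \<le> ennreal ?C * nested_norm q (xs @ i # ys) f x"
    if d: "0 < d" and f: "f \<in> borel_measurable borel" for b d L f x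
  proof -
    have "slice_norm (q $ i) i (nested_norm q xs (dyadic_max b d L i f)) y
       \<le> ennreal ?C * slice_norm (q $ i) i (nested_norm q xs f) y" for y
    proof -
      have "(\<integral>\<^sup>+t. enn_powr (nested_norm q xs (dyadic_max b d L i f) (upd y i t)) (q $ i) \<partial>lborel)
        \<le> ennreal C * (\<integral>\<^sup>+t. enn_powr (nested_norm q xs f (upd y i t)) (q $ i) \<partial>lborel)"
        by (rule dyadic_max_slice_bound [OF f d _ _ "is" C]) (rule q0)+
      then have "slice_norm (q $ i) i (nested_norm q xs (dyadic_max b d L i f)) y
        \<le> enn_powr (ennreal C * (\<integral>\<^sup>+t. enn_powr (nested_norm q xs f (upd y i t)) (q $ i) \<partial>lborel)) (1 / q $ i)"
        unfolding slice_norm_def using q0 [of i] by (intro enn_powr_mono) auto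
      also have "\<dots> = ennreal ?C * slice_norm (q $ i) i (nested_norm q xs f) y"
        using q0 [of i] C0 by (simp add: slice_norm_def enn_powr_mult enn_powr_ennreal)
      finally show ?thesis .
    qed
    then have "nested_norm q ys (slice_norm (q $ i) i (nested_norm q xs (dyadic_max b d L i f))) x
       \<le> nested_norm q ys (\<lambda>y. ennreal ?C * slice_norm (q $ i) i (nested_norm q xs f) y) x"
      by (intro nested_norm_mono q0)
    also have "\<dots> = ennreal ?C * nested_norm q ys (slice_norm (q $ i) i (nested_norm q xs f)) x"
      using f by (intro nested_norm_cmult q0 borel_measurable_slice_norm borel_measurable_nested_norm)
    finally show ?thesis by (simp add: nested_norm_append)
  qed
  then show ?thesis by (intro exI [of _ ?C]) auto
qed

section \<open>Centered maximal functions\<close>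

lemma borel_measurable_component [measurable (raw)]:
  fixes f :: "'a \<Rightarrow> real ^ 'n"
  assumes "f \<in> borel_measurable M"
  shows "(\<lambda>w. f w $ i) \<in> borel_measurable M"
  by (rule measurable_compose [OF assms])
    (intro borel_measurable_continuous_onI continuous_on_component continuous_on_id)

text \<open>Division by \<open>R\<close> instead of the length \<open>2 * R\<close> gives twice the
  average and keeps powers of 2 out of \<open>nested_norm_box\<close>.\<close>

definition centered_mean :: "real \<Rightarrow> 'n \<Rightarrow> (real ^ 'n \<Rightarrow> ennreal) \<Rightarrow> real ^ 'n \<Rightarrow> ennreal" where
  "centered_mean R i f x = ennreal (1 / R) * (\<integral>\<^sup>+t. f (upd x i t) * indicator {t. \<bar>t - x $ i\<bar> \<le> R} t \<partial>lborel)"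

text \<open>The radii are those in the dyadic decomposition of the kernel below the side
  \<open>l\<close> of a cube; countably many keep the supremum measurable.\<close>

definition scale_max :: "real \<Rightarrow> 'n \<Rightarrow> (real ^ 'n \<Rightarrow> ennreal) \<Rightarrow> real ^ 'n \<Rightarrow> ennreal" where
  "scale_max l i f x = (SUP k. centered_mean (l / 2 ^ k) i f x)"

lemma borel_measurable_centered_mean:
  fixes f :: "real ^ 'n \<Rightarrow> ennreal"
  assumes [measurable]: "f \<in> borel_measurable borel"
  shows "centered_mean R i f \<in> borel_measurable borel"
proof -
  have "(\<lambda>(x, t). f (upd x i t) * (if \<bar>t - x $ i\<bar> \<le> R then 1 else 0)) \<in> borel_measurable (borel \<Otimes>\<^sub>M lborel)"
    by measurable
  from lborel.borel_measurable_nn_integral [OF this]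
  show ?thesis unfolding centered_mean_def [abs_def] indicator_def mem_Collect_eq of_bool_def
    by measurable
qed

lemma borel_measurable_scale_max:
  fixes f :: "real ^ 'n \<Rightarrow> ennreal"
  assumes "f \<in> borel_measurable borel"
  shows "scale_max l i f \<in> borel_measurable borel"
  unfolding scale_max_def [abs_def]
  by (intro borel_measurable_SUP borel_measurable_centered_mean assms) auto

lemma centered_mean_mono: "(\<And>x. f x \<le> g x) \<Longrightarrow> centered_mean R i f x \<le> centered_mean R i g x"
  unfolding centered_mean_def by (intro mult_left_mono nn_integral_mono mult_right_mono) auto

lemma floor_neq_between:
  fixes u v :: real
  assumes "\<lfloor>u\<rfloor> \<noteq> \<lfloor>v\<rfloor>"
  obtains a :: int where "min u v \<le> a" "a \<le> max u v"
proof
  show "min u v \<le> real_of_int (max \<lfloor>u\<rfloor> \<lfloor>v\<rfloor>)" "real_of_int (max \<lfloor>u\<rfloor> \<lfloor>v\<rfloor>) \<le> max u v"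
    using assms by (auto simp: min_def max_def) linarith+
qed

text \<open>The one-third trick: a short interval cannot meet the grid of mesh \<open>d\<close> and its translate by
  \<open>2 ^ k * d / 3\<close> simultaneously, because \<open>2 ^ k / 3\<close> keeps distance \<open>1 / 3\<close> from the integers.\<close>

lemma one_third_trick:
  fixes d t x :: real
  assumes d: "0 < d" and tx: "\<bar>t - x\<bar> \<le> d / 4"
  shows "\<lfloor>t / d\<rfloor> = \<lfloor>x / d\<rfloor> \<or> \<lfloor>(t - 2 ^ k * d / 3) / d\<rfloor> = \<lfloor>(x - 2 ^ k * d / 3) / d\<rfloor>"
proof (rule ccontr)
  assume *: "\<not> ?thesis"
  define u v w where "u = t / d" and "v = x / d" and "w = 2 ^ k / (3 :: real)"
  have uv: "\<bar>u - v\<bar> \<le> 1 / 4"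
    using d tx by (simp add: u_def v_def diff_divide_distrib [symmetric] abs_divide field_simps)
  have "(t - 2 ^ k * d / 3) / d = u - w" "(x - 2 ^ k * d / 3) / d = v - w"
    using d by (auto simp: u_def v_def w_def field_simps)
  then have n: "\<lfloor>u\<rfloor> \<noteq> \<lfloor>v\<rfloor>" "\<lfloor>u - w\<rfloor> \<noteq> \<lfloor>v - w\<rfloor>" using * by (auto simp: u_def v_def)
  obtain a :: int where a: "min u v \<le> a" "a \<le> max u v" using floor_neq_between [OF n(1)] .
  obtain b :: int where b: "min (u - w) (v - w) \<le> b" "b \<le> max (u - w) (v - w)"
    using floor_neq_between [OF n(2)] .
  \<comment> \<open>Both the integer \<open>a\<close> and the shifted integer \<open>b + w\<close>
    lie between \<open>u\<close> and \<open>v\<close>, so they are at most 1 / 4 apart, and three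
    times their difference is an integer.\<close>
  have "u \<le> a \<and> a \<le> v \<and> u \<le> b + w \<and> b + w \<le> v \<or> v \<le> a \<and> a \<le> u \<and> v \<le> b + w \<and> b + w \<le> u"
    using a b by (cases "u \<le> v") (auto simp: min_def max_def split: if_splits)
  then have "\<bar>real_of_int a - real_of_int b - w\<bar> \<le> 1 / 4"
    using uv by (elim disjE conjE; linarith)
  then have "\<bar>3 * (real_of_int a - b) - 2 ^ k\<bar> \<le> 3 / 4" by (simp add: w_def abs_le_iff field_simps)
  then have "\<bar>real_of_int (3 * (a - b) - 2 ^ k)\<bar> < 1" by simp
  then have "3 * (a - b) = 2 ^ k" by linarith
  then have dvd: "(3 :: int) dvd 2 ^ k" by (metis dvd_triv_left)
  have cop: "coprime (3 :: int) (2 ^ k)" by simp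
  show False using coprime_absorb_left [OF dvd, THEN iffD1, OF cop] by simp
qed

lemma cell_div_power:
  assumes "0 < d"
  shows "cell b d t div 2 ^ n = \<lfloor>(t - b) / (d * 2 ^ n)\<rfloor>"
  using floor_divide_real_eq_div [of "2 ^ n" "(t - b) / d"] by (simp add: cell_def field_simps)

lemma dyadic_window_le:
  fixes f :: "real ^ 'n \<Rightarrow> ennreal"
  assumes [measurable]: "f \<in> borel_measurable borel" and d: "0 < d" and n: "n \<le> N"
  shows "(\<integral>\<^sup>+t. f (upd x i t) * indicator {t. cell b d t \<in> blk n (cell b d (x $ i))} t \<partial>lborel)
    \<le> ennreal (d * 2 ^ n) * dyadic_max b d N i f x"
proof -
  let ?J = "blk n (cell b d (x $ i))"
  have "f (upd x i t) * indicator {t. cell b d t \<in> ?J} t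
      = (\<Sum>m\<in>?J. f (upd x i t) * indicator {t. cell b d t = m} t)" for t
    by (simp add: sum_distrib_left [symmetric] indicator_def sum.delta')
  then have "(\<integral>\<^sup>+t. f (upd x i t) * indicator {t. cell b d t \<in> ?J} t \<partial>lborel)
    = (\<Sum>m\<in>?J. \<integral>\<^sup>+t. f (upd x i t) * indicator {t. cell b d t = m} t \<partial>lborel)"
    by (simp only:) (rule nn_integral_sum, measurable)
  also have "\<dots> = (\<Sum>m\<in>?J. ennreal d * cell_mean b d i f m x)"
  proof (rule sum.cong [OF refl])
    fix m
    have "ennreal d * (ennreal (1 / d) * z) = z" for z
      using d by (simp flip: mult.assoc ennreal_mult)
    then show "(\<integral>\<^sup>+t. f (upd x i t) * indicator {t. cell b d t = m} t \<partial>lborel) = ennreal d * cell_mean b d i f m x"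
      by (simp add: cell_mean_def)
  qed
  also have "\<dots> = ennreal (d * 2 ^ n) * av n (\<lambda>m. cell_mean b d i f m x) (cell b d (x $ i))"
  proof -
    have "ennreal (d * 2 ^ n) * ennreal (1 / 2 ^ n) = ennreal d"
      using d by (simp flip: ennreal_mult)
    then show ?thesis by (simp add: av_def sum_distrib_left flip: mult.assoc)
  qed
  also have "\<dots> \<le> ennreal (d * 2 ^ n) * dyadic_max b d N i f x"
    unfolding dyadic_max_def by (intro mult_left_mono av_le_mx n) auto
  finally show ?thesis .
qed

text \<open>The mesh \<open>4 * l / 2 ^ N\<close> makes the grid intervals of level
  \<open>N - k\<close> exactly \<open>4 * R\<close> long for \<open>R = l / 2 ^ k\<close>. The fixed
  shift \<open>4 * l / 3\<close> is \<open>2 ^ k / 3\<close> times this length, so the same two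
  grids serve all scales at once. The factor 4 is \<open>4 * R / R\<close>.\<close>

lemma centered_mean_le_dyadic_max:
  fixes f :: "real ^ 'n \<Rightarrow> ennreal"
  assumes f [measurable]: "f \<in> borel_measurable borel" and l: "0 < l" and k: "k \<le> N"
  shows "centered_mean (l / 2 ^ k) i f x
    \<le> 4 * (dyadic_max 0 (4 * l / 2 ^ N) N i f x + dyadic_max (4 * l / 3) (4 * l / 2 ^ N) N i f x)"
proof -
  define R d n where "R = l / 2 ^ k" and "d = 4 * l / 2 ^ N" and "n = N - k"
  have R: "0 < R" and d: "0 < d" using l by (auto simp: R_def d_def)
  have "(2 :: real) ^ N = 2 ^ n * 2 ^ k" using k by (simp add: n_def flip: power_add)
  then have dn: "d * 2 ^ n = 4 * R" and lk: "4 * l / 3 = 2 ^ k * (4 * R) / 3" by (simp_all add: R_def d_def)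
  let ?I = "\<lambda>b. {t. cell b d t \<in> blk n (cell b d (x $ i))}"
  have cover: "indicator {t. \<bar>t - x $ i\<bar> \<le> R} t \<le> indicator (?I 0) t + (indicator (?I (4 * l / 3)) t :: ennreal)" for t
  proof (cases "\<bar>t - x $ i\<bar> \<le> R")
    case True
    then have "\<bar>t - x $ i\<bar> \<le> 4 * R / 4" by simp
    from one_third_trick [OF _ this, of k] R
    have "t \<in> ?I 0 \<or> t \<in> ?I (4 * l / 3)"
      by (simp add: blk_def cell_div_power [OF d] dn lk)
    then show ?thesis by (auto simp: indicator_def)
  qed simp
  have "(\<integral>\<^sup>+t. f (upd x i t) * indicator {t. \<bar>t - x $ i\<bar> \<le> R} t \<partial>lborel)
    \<le> (\<integral>\<^sup>+t. f (upd x i t) * indicator (?I 0) t + f (upd x i t) * indicator (?I (4 * l / 3)) t \<partial>lborel)"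
    unfolding distrib_left [symmetric] by (intro nn_integral_mono mult_left_mono cover) auto
  also have "\<dots> = (\<integral>\<^sup>+t. f (upd x i t) * indicator (?I 0) t \<partial>lborel) + (\<integral>\<^sup>+t. f (upd x i t) * indicator (?I (4 * l / 3)) t \<partial>lborel)"
    by (rule nn_integral_add) measurable
  also have "\<dots> \<le> ennreal (d * 2 ^ n) * dyadic_max 0 d N i f x + ennreal (d * 2 ^ n) * dyadic_max (4 * l / 3) d N i f x"
    using f d by (intro add_mono dyadic_window_le) (auto simp: n_def)
  finally have "centered_mean R i f x \<le> ennreal (1 / R) * (ennreal (4 * R) * (dyadic_max 0 d N i f x + dyadic_max (4 * l / 3) d N i f x))"
    unfolding centered_mean_def dn distrib_left [symmetric] by (rule mult_left_mono) simp
  moreover have "ennreal (1 / R) * ennreal (4 * R) = 4"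
    using R by (simp flip: ennreal_mult)
  ultimately show ?thesis unfolding R_def d_def by (simp flip: mult.assoc)
qed

lemma slice_norm_SUP:
  fixes f :: "nat \<Rightarrow> real ^ 'n \<Rightarrow> ennreal"
  assumes [measurable]: "\<And>N. f N \<in> borel_measurable borel" and inc: "\<And>x. incseq (\<lambda>N. f N x)" and q: "0 < q"
  shows "slice_norm q i (\<lambda>x. SUP N. f N x) x = (SUP N. slice_norm q i (f N) x)"
proof -
  have "(\<integral>\<^sup>+t. enn_powr (SUP N. f N (upd x i t)) q \<partial>lborel) = (SUP N. \<integral>\<^sup>+t. enn_powr (f N (upd x i t)) q \<partial>lborel)"
    unfolding enn_powr_SUP [OF q UNIV_not_empty]
    using inc q by (intro nn_integral_monotone_convergence_SUP)
      (auto simp: incseq_def le_fun_def intro!: enn_powr_mono)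
  then show ?thesis using q by (simp add: slice_norm_def enn_powr_SUP)
qed

lemma nested_norm_SUP:
  fixes f :: "nat \<Rightarrow> real ^ 'n \<Rightarrow> ennreal"
  assumes "\<And>N. f N \<in> borel_measurable borel" "\<And>x. incseq (\<lambda>N. f N x)" "\<And>i. i \<in> set is \<Longrightarrow> 0 < q $ i"
  shows "nested_norm q is (\<lambda>x. SUP N. f N x) x = (SUP N. nested_norm q is (f N) x)"
  using assms
proof (induction "is" arbitrary: f)
  case (Cons i "is")
  have q: "0 < q $ i" using Cons.prems(3) by simp
  have "slice_norm (q $ i) i (\<lambda>x. SUP N. f N x) = (\<lambda>x. SUP N. slice_norm (q $ i) i (f N) x)"
    using Cons.prems q by (intro ext slice_norm_SUP)
  moreover have "incseq (\<lambda>N. slice_norm (q $ i) i (f N) x)" for x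
    using Cons.prems(2) q by (auto simp: incseq_def intro!: slice_norm_mono)
  ultimately show ?case
    using Cons.IH [of "\<lambda>N. slice_norm (q $ i) i (f N)"] Cons.prems by (simp add: borel_measurable_slice_norm)
qed simp

text \<open>For the first \<open>N + 1\<close> radii two grids with a mesh depending on
  \<open>N\<close> suffice, with a constant that does not. The supremum over \<open>N\<close> passes
  through the norm by monotone convergence.\<close>

lemma scale_max_bound:
  fixes q :: "real ^ 'n"
  assumes q: "\<And>j. 1 < q $ j" and i: "i \<in> set ds"
  shows "\<exists>C\<ge>0. \<forall>l f x. 0 < l \<longrightarrow> f \<in> borel_measurable borel \<longrightarrow>
     nested_norm q ds (scale_max l i f) x \<le> ennreal C * nested_norm q ds f x"
proof -
  obtain xs ys where ds: "ds = xs @ i # ys" and notin: "i \<notin> set xs"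
    using split_list_first [OF i] by blast
  obtain C where C0: "0 \<le> C" and C: "\<And>b d L f x. 0 < d \<Longrightarrow> f \<in> borel_measurable borel \<Longrightarrow>
     nested_norm q ds (dyadic_max b d L i f) x \<le> ennreal C * nested_norm q ds f x"
    using dyadic_max_bound [of q i xs ys, OF q notin] unfolding ds by blast
  have q0: "0 < q $ j" "1 \<le> q $ j" for j using q [of j] by auto
  have "nested_norm q ds (scale_max l i f) x \<le> ennreal (4 * (C + C)) * nested_norm q ds f x"
    if l: "0 < l" and f [measurable]: "f \<in> borel_measurable borel" for l f x
  proof -
    define g where "g N x = (SUP k\<in>{..N}. centered_mean (l / 2 ^ k) i f x)" for N x
    have [measurable]: "g N \<in> borel_measurable borel" for N
      unfolding g_def [abs_def] by (intro borel_measurable_SUP borel_measurable_centered_mean f) auto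
    have ginc: "incseq (\<lambda>N. g N x)" for x
      unfolding incseq_def g_def by (auto intro!: SUP_subset_mono)
    have "scale_max l i f = (\<lambda>x. SUP N. g N x)"
    proof
      fix x
      have "centered_mean (l / 2 ^ k) i f x \<le> (SUP N. g N x)" for k
        by (rule SUP_upper2 [of k]) (auto simp: g_def intro: SUP_upper)
      moreover have "g N x \<le> scale_max l i f x" for N
        unfolding g_def scale_max_def by (intro SUP_subset_mono) auto
      ultimately show "scale_max l i f x = (SUP N. g N x)"
        unfolding scale_max_def by (intro antisym SUP_least) auto
    qed
    moreover have "nested_norm q ds (\<lambda>x. SUP N. g N x) x = (SUP N. nested_norm q ds (g N) x)"
      by (intro nested_norm_SUP q0 ginc) measurable
    moreover have "nested_norm q ds (g N) x \<le> ennreal (4 * (C + C)) * nested_norm q ds f x" for N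
    proof -
      let ?d = "4 * l / 2 ^ N"
      let ?m = "\<lambda>b. dyadic_max b ?d N i f"
      have d: "0 < ?d" using l by simp
      have "nested_norm q ds (g N) x \<le> nested_norm q ds (\<lambda>x. 4 * (?m 0 x + ?m (4 * l / 3) x)) x"
        using l f q0 by (intro nested_norm_mono) (auto simp: g_def simp del: distrib_left_numeral intro!: SUP_least centered_mean_le_dyadic_max)
      also have "\<dots> = 4 * nested_norm q ds (\<lambda>x. ?m 0 x + ?m (4 * l / 3) x) x"
        using q0 by (intro nested_norm_cmult) auto
      also have "\<dots> \<le> 4 * (nested_norm q ds (?m 0) x + nested_norm q ds (?m (4 * l / 3)) x)"
        using q0 by (intro mult_left_mono nested_norm_triangle) auto
      also have "\<dots> \<le> 4 * (ennreal C * nested_norm q ds f x + ennreal C * nested_norm q ds f x)"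
        by (intro mult_left_mono add_mono C d f) auto
      also have "\<dots> = ennreal (4 * (C + C)) * nested_norm q ds f x"
      proof -
        have "ennreal (4 * (C + C)) = 4 * (ennreal C + ennreal C)"
          using C0 by (subst ennreal_mult) (auto simp flip: ennreal_plus)
        then show ?thesis by (simp only: distrib_right mult.assoc)
      qed
      finally show ?thesis .
    qed
    ultimately show ?thesis by (auto intro: SUP_least)
  qed
  then show ?thesis using C0 by (intro exI [of _ "4 * (C + C)"]) auto
qed

text \<open>The radii in the different coordinates vary independently. This only enlarges the
  maximal function over cubes, and makes it a composition of one-variable operators.\<close>

primrec box_max :: "real \<Rightarrow> 'n list \<Rightarrow> (real ^ 'n \<Rightarrow> ennreal) \<Rightarrow> real ^ 'n \<Rightarrow> ennreal" where
  "box_max l [] f = f"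
| "box_max l (i # is) f = box_max l is (scale_max l i f)"

primrec box_mean :: "real \<Rightarrow> 'n list \<Rightarrow> (real ^ 'n \<Rightarrow> ennreal) \<Rightarrow> real ^ 'n \<Rightarrow> ennreal" where
  "box_mean R [] f = f"
| "box_mean R (i # is) f = box_mean R is (centered_mean R i f)"

lemma box_max_bound:
  fixes q :: "real ^ 'n"
  assumes q: "\<And>j. 1 < q $ j" and "is": "set is \<subseteq> set ds"
  shows "\<exists>C\<ge>0. \<forall>l f x. 0 < l \<longrightarrow> f \<in> borel_measurable borel \<longrightarrow>
     nested_norm q ds (box_max l is f) x \<le> ennreal C * nested_norm q ds f x"
  using "is"
proof (induction "is")
  case Nil
  then show ?case by (intro exI [of _ 1]) simp
next
  case (Cons i "is")
  then have "i \<in> set ds" "set is \<subseteq> set ds" by auto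
  obtain C where C: "0 \<le> C" "\<And>l f x. 0 < l \<Longrightarrow> f \<in> borel_measurable borel \<Longrightarrow>
     nested_norm q ds (scale_max l i f) x \<le> ennreal C * nested_norm q ds f x"
    using scale_max_bound [OF q \<open>i \<in> set ds\<close>] by blast
  obtain C' where C': "0 \<le> C'" "\<And>l f x. 0 < l \<Longrightarrow> f \<in> borel_measurable borel \<Longrightarrow>
     nested_norm q ds (box_max l is f) x \<le> ennreal C' * nested_norm q ds f x"
    using Cons.IH [OF \<open>set is \<subseteq> set ds\<close>] by blast
  have "nested_norm q ds (box_max l (i # is) f) x \<le> ennreal (C' * C) * nested_norm q ds f x"
    if l: "0 < l" and f: "f \<in> borel_measurable borel" for l f x
  proof -
    have "nested_norm q ds (box_max l is (scale_max l i f)) x \<le> ennreal C' * nested_norm q ds (scale_max l i f) x"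
      by (intro C' l borel_measurable_scale_max f)
    also have "\<dots> \<le> ennreal C' * (ennreal C * nested_norm q ds f x)"
      by (intro mult_left_mono C l f) auto
    finally show ?thesis using C C' by (simp add: ennreal_mult mult.assoc)
  qed
  then show ?case using C C' by (intro exI [of _ "C' * C"]) auto
qed

lemma borel_measurable_box_max: "f \<in> borel_measurable borel \<Longrightarrow> box_max l is f \<in> borel_measurable borel"
  by (induction "is" arbitrary: f) (auto intro: borel_measurable_scale_max)

lemma box_mean_mono: "(\<And>x. f x \<le> g x) \<Longrightarrow> box_mean R is f x \<le> box_mean R is g x"
proof (induction "is" arbitrary: f g)
  case (Cons i "is")
  have "centered_mean R i f y \<le> centered_mean R i g y" for y
    using Cons.prems by (rule centered_mean_mono)
  then show ?case using Cons.IH by simp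
qed simp

lemma box_mean_le_box_max: "box_mean (l / 2 ^ k) is f x \<le> box_max l is f x"
proof (induction "is" arbitrary: f)
  case (Cons i "is")
  have "box_mean (l / 2 ^ k) is (centered_mean (l / 2 ^ k) i f) x \<le> box_mean (l / 2 ^ k) is (scale_max l i f) x"
    by (intro box_mean_mono) (auto simp: scale_max_def intro: SUP_upper)
  also have "\<dots> \<le> box_max l is (scale_max l i f) x" by (rule Cons.IH)
  finally show ?case by simp
qed simp

lemma nested_norm_cong:
  "(\<And>y. (\<And>j. j \<notin> set is \<Longrightarrow> y $ j = x $ j) \<Longrightarrow> f y = g y) \<Longrightarrow> nested_norm q is f x = nested_norm q is g x"
proof (induction "is" arbitrary: f g)
  case (Cons i "is")
  have slice: "slice_norm (q $ i) i f y = slice_norm (q $ i) i g y" if y: "\<And>j. j \<notin> set is \<Longrightarrow> y $ j = x $ j" for y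
  proof -
    have "f (upd y i t) = g (upd y i t)" for t
      by (rule Cons.prems) (auto simp: y)
    then show ?thesis by (simp add: slice_norm_def)
  qed
  have "nested_norm q is (slice_norm (q $ i) i f) x = nested_norm q is (slice_norm (q $ i) i g) x"
    by (rule Cons.IH) (rule slice)
  then show ?case by simp
qed simp

text \<open>The centre \<open>z\<close> is fixed, while the iterated integrals evaluate at moving
  points. By \<open>nested_norm_cong\<close> only points that agree with \<open>x\<close> off the
  remaining variables matter; their coordinate \<open>i\<close> is \<open>z $ i\<close>, so the mean
  has the right centre. Each variable contributes a factor \<open>R\<close>.\<close>

lemma nested_norm_box:
  fixes h :: "real ^ 'n \<Rightarrow> ennreal"
  assumes R: "0 < R" and "distinct is" "h \<in> borel_measurable borel" "\<And>j. j \<in> set is \<Longrightarrow> x $ j = z $ j"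
  shows "nested_norm 1 is (\<lambda>y. h y * (\<Prod>j\<in>set is. indicator {t. \<bar>t - z $ j\<bar> \<le> R} (y $ j))) x
    = ennreal (R ^ length is) * box_mean R is h x"
  using assms(2-)
proof (induction "is" arbitrary: h)
  case (Cons i "is")
  note [measurable] = Cons.prems(2)
  have i: "i \<notin> set is" using Cons.prems(1) by simp
  let ?P = "\<lambda>y. \<Prod>j\<in>set is. indicator {t. \<bar>t - z $ j\<bar> \<le> R} (y $ j) :: ennreal"
  have P: "?P (upd y i t) = ?P y" for y t
    by (intro prod.cong) (use i in auto)
  have R1: "ennreal R * (ennreal (1 / R) * c) = c" for c
    using R by (simp flip: mult.assoc ennreal_mult)
  have "nested_norm 1 (i # is) (\<lambda>y. h y * (\<Prod>j\<in>set (i # is). indicator {t. \<bar>t - z $ j\<bar> \<le> R} (y $ j))) x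
    = nested_norm 1 is (\<lambda>y. \<integral>\<^sup>+t. h (upd y i t) * indicator {t. \<bar>t - z $ i\<bar> \<le> R} t * ?P y \<partial>lborel) x"
  proof -
    have "(\<Prod>j\<in>set (i # is). indicator {t. \<bar>t - z $ j\<bar> \<le> R} (upd y i t $ j))
      = indicator {t. \<bar>t - z $ i\<bar> \<le> R} (upd y i t $ i) * ?P (upd y i t)" for y t
      using i by (simp del: upd_nth)
    then have "h (upd y i t) * (\<Prod>j\<in>set (i # is). indicator {t. \<bar>t - z $ j\<bar> \<le> R} (upd y i t $ j))
      = h (upd y i t) * indicator {t. \<bar>t - z $ i\<bar> \<le> R} t * ?P y" for y t
      unfolding P by (simp add: mult.assoc)
    then show ?thesis
      by (simp only: nested_norm.simps slice_norm_def [abs_def] one_index enn_powr_1 div_by_1)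
  qed
  also have "\<dots> = nested_norm 1 is (\<lambda>y. (\<integral>\<^sup>+t. h (upd y i t) * indicator {t. \<bar>t - z $ i\<bar> \<le> R} t \<partial>lborel) * ?P y) x"
    by (subst nn_integral_multc) auto
  also have "\<dots> = nested_norm 1 is (\<lambda>y. ennreal R * (centered_mean R i h y * ?P y)) x"
  proof (rule nested_norm_cong)
    fix y :: "real ^ 'n" assume y: "\<And>j. j \<notin> set is \<Longrightarrow> y $ j = x $ j"
    have "y $ i = z $ i" using y [OF i] Cons.prems(3) [of i] by simp
    then show "(\<integral>\<^sup>+t. h (upd y i t) * indicator {t. \<bar>t - z $ i\<bar> \<le> R} t \<partial>lborel) * ?P y
      = ennreal R * (centered_mean R i h y * ?P y)"
      by (simp add: centered_mean_def mult.assoc R1)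
  qed
  also have "\<dots> = ennreal R * nested_norm 1 is (\<lambda>y. centered_mean R i h y * ?P y) x"
    using borel_measurable_centered_mean [of h R i] by (intro nested_norm_cmult) (auto intro!: borel_measurable_times_ennreal borel_measurable_prod_ennreal)
  also have "\<dots> = ennreal R * (ennreal (R ^ length is) * box_mean R is (centered_mean R i h) x)"
    using Cons.prems by (subst Cons.IH) (auto intro: borel_measurable_centered_mean)
  finally show ?case using R by (simp add: ennreal_mult mult.assoc)
qed simp

section \<open>Iterated integrals and cubes\<close>

lemma axis_cart_Basis: "(Basis :: (real ^ 'n) set) = range (\<lambda>i. axis i 1)"
  by (auto simp: Basis_vec_def)

lemma prod_Basis_cart:
  "(\<Prod>b\<in>(Basis :: (real ^ 'n) set). x \<bullet> b) = (\<Prod>i\<in>UNIV. x $ i)" for x :: "real ^ 'n"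
  unfolding axis_cart_Basis
  by (subst prod.reindex) (auto simp: inj_on_def axis_eq_axis inner_axis)

section \<open>Lebesgue measure as an iterated integral\<close>

lemma product_sigma_finite_lborel: "product_sigma_finite (\<lambda>_. lborel)"
  by (simp add: product_sigma_finite_def sigma_finite_lborel)

lemma measurable_vec_lambda_PiM:
  fixes x :: "real ^ 'n"
  shows "(\<lambda>y. \<chi> j. if j \<in> I then y j else x $ j) \<in> Pi\<^sub>M I (\<lambda>_. lborel) \<rightarrow>\<^sub>M borel"
proof -
  have "(\<chi> j. if j \<in> I then y j else x $ j) = (\<Sum>j\<in>UNIV. (if j \<in> I then y j else x $ j) *\<^sub>R axis j 1)"
    for y :: "'n \<Rightarrow> real"
    by (subst basis_expansion [symmetric]) (simp add: scalar_mult_eq_scaleR)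
  moreover have "(\<lambda>y. if j \<in> I then y j else x $ j) \<in> Pi\<^sub>M I (\<lambda>_. lborel) \<rightarrow>\<^sub>M borel" for j
    by (cases "j \<in> I") auto
  ultimately show ?thesis by simp
qed

lemma lborel_cart_eq_distr_PiM:
  "(lborel :: (real ^ 'n) measure) = distr (Pi\<^sub>M UNIV (\<lambda>_. lborel)) borel (\<lambda>y. \<chi> j. y j)"
proof (rule lborel_eqI)
  interpret product_sigma_finite "\<lambda>_ :: 'n. lborel :: real measure" by (rule product_sigma_finite_lborel)
  fix l u :: "real ^ 'n"
  assume lu: "\<And>b. b \<in> Basis \<Longrightarrow> l \<bullet> b \<le> u \<bullet> b"
  have le: "l $ j \<le> u $ j" for j
    using lu [of "axis j 1"] by (simp add: axis_cart_Basis inner_axis)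
  have m: "(\<lambda>y. \<chi> j. y j) \<in> Pi\<^sub>M UNIV (\<lambda>_. lborel) \<rightarrow>\<^sub>M (borel :: (real ^ 'n) measure)"
    using measurable_vec_lambda_PiM [of UNIV 0] by simp
  have "(\<lambda>y. \<chi> j. y j) -` box l u \<inter> space (Pi\<^sub>M UNIV (\<lambda>_. lborel)) = Pi\<^sub>E UNIV (\<lambda>j. {l $ j <..< u $ j})"
    by (auto simp: space_PiM mem_box_cart PiE_iff)
  then have "emeasure (distr (Pi\<^sub>M UNIV (\<lambda>_. lborel)) borel (\<lambda>y. \<chi> j. y j)) (box l u)
     = (\<Prod>j\<in>UNIV. emeasure lborel {l $ j <..< u $ j})"
    by (subst emeasure_distr [OF m]) (auto simp: emeasure_PiM)
  also have "\<dots> = ennreal (\<Prod>j\<in>UNIV. (u - l) $ j)"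
    using le by (simp add: prod_ennreal)
  finally show "emeasure (distr (Pi\<^sub>M UNIV (\<lambda>_. lborel)) borel (\<lambda>y. \<chi> j. y j)) (box l u)
     = ennreal (\<Prod>b\<in>Basis. (u - l) \<bullet> b)"
    by (simp only: prod_Basis_cart)
qed simp

lemma nn_integral_PiM_nested:
  fixes h :: "real ^ 'n \<Rightarrow> ennreal"
  assumes "distinct is" "h \<in> borel_measurable borel"
  shows "(\<integral>\<^sup>+y. h (\<chi> j. if j \<in> set is then y j else x $ j) \<partial>Pi\<^sub>M (set is) (\<lambda>_. lborel)) = nested_norm 1 is h x"
  using assms
proof (induction "is" arbitrary: h)
  case Nil
  interpret product_sigma_finite "\<lambda>_ :: 'n. lborel :: real measure" by (rule product_sigma_finite_lborel)
  show ?case unfolding list.set by (subst nn_integral_empty) simp_all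
next
  case (Cons i "is")
  interpret product_sigma_finite "\<lambda>_ :: 'n. lborel :: real measure" by (rule product_sigma_finite_lborel)
  have upd: "(\<chi> j. if j \<in> set (i # is) then (y(i := t)) j else x $ j) = upd (\<chi> j. if j \<in> set is then y j else x $ j) i t"
    for y t using Cons.prems by (auto simp: vec_eq_iff)
  have "(\<integral>\<^sup>+y. h (\<chi> j. if j \<in> set (i # is) then y j else x $ j) \<partial>Pi\<^sub>M (set (i # is)) (\<lambda>_. lborel))
    = (\<integral>\<^sup>+y. (\<integral>\<^sup>+t. h (\<chi> j. if j \<in> set (i # is) then (y(i := t)) j else x $ j) \<partial>lborel) \<partial>Pi\<^sub>M (set is) (\<lambda>_. lborel))"
    using Cons.prems measurable_compose [OF measurable_vec_lambda_PiM Cons.prems(2), of "set (i # is)" x]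
    unfolding list.set by (subst product_nn_integral_insert) auto
  also have "\<dots> = nested_norm 1 is (slice_norm 1 i h) x"
    unfolding upd using Cons.prems
    by (subst Cons.IH [symmetric]) (auto simp: slice_norm_def borel_measurable_slice_norm)
  finally show ?case by simp
qed

text \<open>Tonelli in all coordinates: with exponents 1 the roots disappear, and the result is
  constant in the evaluation point \<open>x\<close>.\<close>

lemma nn_integral_lborel_nested:
  fixes h :: "real ^ 'n \<Rightarrow> ennreal"
  assumes "distinct ds" "set ds = UNIV" and h: "h \<in> borel_measurable borel"
  shows "(\<integral>\<^sup>+y. h y \<partial>lborel) = nested_norm 1 ds h x"
proof -
  have m: "(\<lambda>y. \<chi> j. y j) \<in> Pi\<^sub>M UNIV (\<lambda>_. lborel) \<rightarrow>\<^sub>M (borel :: (real ^ 'n) measure)"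
    using measurable_vec_lambda_PiM [of UNIV 0] by simp
  have "(\<integral>\<^sup>+y. h y \<partial>lborel) = (\<integral>\<^sup>+y. h (\<chi> j. y j) \<partial>Pi\<^sub>M UNIV (\<lambda>_. lborel))"
    by (subst lborel_cart_eq_distr_PiM, subst nn_integral_distr [OF m]) (use h in auto)
  then show ?thesis using nn_integral_PiM_nested [OF assms(1) h, of x] assms(2) by simp
qed

lemma indicator_box_eq_prod:
  fixes x y :: "real ^ 'n"
  shows "indicator (cbox (x - vec R) (x + vec R)) y = (\<Prod>j\<in>UNIV. indicator {t. \<bar>t - x $ j\<bar> \<le> R} (y $ j) :: ennreal)"
proof (cases "y \<in> cbox (x - vec R) (x + vec R)")
  case True
  then have "\<bar>y $ j - x $ j\<bar> \<le> R" for j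
    by (auto simp: mem_box_cart abs_le_iff algebra_simps)
  then show ?thesis using True by simp
next
  case False
  then obtain j where "\<not> \<bar>y $ j - x $ j\<bar> \<le> R"
    by (force simp: mem_box_cart abs_le_iff algebra_simps)
  then have "(\<Prod>j\<in>UNIV. indicator {t. \<bar>t - x $ j\<bar> \<le> R} (y $ j)) = (0 :: ennreal)"
    by (intro prod_zero bexI [of _ j]) auto
  then show ?thesis using False by simp
qed

lemma nn_integral_box_le_box_max:
  fixes h :: "real ^ 'n \<Rightarrow> ennreal"
  assumes ds: "distinct ds" "set ds = UNIV" and h: "h \<in> borel_measurable borel" and l: "0 < l"
  shows "(\<integral>\<^sup>+y. h y * indicator (cbox (x - vec (l / 2 ^ k)) (x + vec (l / 2 ^ k))) y \<partial>lborel)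
    \<le> ennreal ((l / 2 ^ k) ^ CARD('n)) * box_max l ds h x"
proof -
  let ?R = "l / 2 ^ k"
  have len: "length ds = CARD('n)" using ds distinct_card by fastforce
  have "(\<integral>\<^sup>+y. h y * indicator (cbox (x - vec ?R) (x + vec ?R)) y \<partial>lborel)
    = nested_norm 1 ds (\<lambda>y. h y * indicator (cbox (x - vec ?R) (x + vec ?R)) y) x"
    using h by (intro nn_integral_lborel_nested ds) auto
  also have "\<dots> = ennreal (?R ^ CARD('n)) * box_mean ?R ds h x"
    using nested_norm_box [of ?R ds h x x] ds h l
    by (simp add: indicator_box_eq_prod len)
  also have "\<dots> \<le> ennreal (?R ^ CARD('n)) * box_max l ds h x"
    by (intro mult_left_mono box_mean_le_box_max) auto
  finally show ?thesis .
qed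

section \<open>Functions supported in a cube\<close>

lemma slice_norm_Hoelder:
  fixes f :: "real ^ 'n \<Rightarrow> ennreal"
  assumes f [measurable]: "f \<in> borel_measurable borel" and l: "0 < l" and q: "1 \<le> q"
    and supp: "\<And>y. y $ i \<notin> {a $ i..a $ i + l} \<Longrightarrow> f y = 0"
  shows "slice_norm 1 i f x \<le> ennreal (l powr (1 - 1 / q)) * slice_norm q i f x"
proof -
  let ?M = "density lborel (indicator {a $ i..a $ i + l})"
  have int: "(\<integral>\<^sup>+t. h t \<partial>?M) = (\<integral>\<^sup>+t. h t \<partial>lborel)"
    if [measurable]: "h \<in> borel_measurable borel" and "\<And>t. t \<notin> {a $ i..a $ i + l} \<Longrightarrow> h t = 0" for h
    by (subst nn_integral_density) (auto intro!: nn_integral_cong simp: that indicator_def)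
  have one: "(\<integral>\<^sup>+t. ennreal 1 \<partial>?M) = ennreal l"
    using l by (subst nn_integral_density) auto
  have "enn_powr (\<integral>\<^sup>+t. f (upd x i t) \<partial>?M) q
    \<le> (\<integral>\<^sup>+t. enn_powr (f (upd x i t)) q * ennreal (1 powr (1 - q)) \<partial>?M) * enn_powr (\<integral>\<^sup>+t. ennreal 1 \<partial>?M) (q - 1)"
    using q by (intro nn_integral_Jensen) (auto simp del: ennreal_1 nn_integral_const simp: one)
  also have "(\<integral>\<^sup>+t. enn_powr (f (upd x i t)) q * ennreal (1 powr (1 - q)) \<partial>?M) = (\<integral>\<^sup>+t. enn_powr (f (upd x i t)) q \<partial>lborel)"
    using supp by (subst int) (auto simp: int)
  also have "(\<integral>\<^sup>+t. f (upd x i t) \<partial>?M) = slice_norm 1 i f x"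
    using supp by (subst int) (auto simp: slice_norm_def)
  finally have "slice_norm 1 i f x \<le> enn_powr ((\<integral>\<^sup>+t. enn_powr (f (upd x i t)) q \<partial>lborel) * enn_powr (ennreal l) (q - 1)) (1 / q)"
    using q by (simp only: one enn_powr_le_swap)
  also have "\<dots> = slice_norm q i f x * ennreal (l powr (1 - 1 / q))"
    using q l by (simp add: slice_norm_def enn_powr_mult enn_powr_powr enn_powr_ennreal powr_powr diff_divide_distrib)
  finally show ?thesis by (simp add: mult.commute)
qed

lemma slice_norm_supp:
  fixes f :: "real ^ 'n \<Rightarrow> ennreal"
  assumes "i \<noteq> j" "\<And>y. y $ j \<notin> S \<Longrightarrow> f y = 0" "x $ j \<notin> S"
  shows "slice_norm q i f x = 0"
  using assms by (simp add: slice_norm_def)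

text \<open>The support condition survives each integration, so every variable contributes its own
  factor from Hoelder's inequality on an interval of length \<open>l\<close>.\<close>

lemma nested_norm_Hoelder:
  fixes f :: "real ^ 'n \<Rightarrow> ennreal"
  assumes l: "0 < l" and q: "\<And>j. 1 \<le> q $ j"
    and "distinct is" "f \<in> borel_measurable borel" "\<And>j y. j \<in> set is \<Longrightarrow> y $ j \<notin> {a $ j..a $ j + l} \<Longrightarrow> f y = 0"
  shows "nested_norm 1 is f x \<le> ennreal (l powr (\<Sum>j\<in>set is. 1 - 1 / q $ j)) * nested_norm q is f x"
  using assms(3-)
proof (induction "is" arbitrary: f)
  case Nil
  then show ?case using l by simp
next
  case (Cons i "is")
  let ?c = "l powr (1 - 1 / q $ i)" and ?d = "l powr (\<Sum>j\<in>set is. 1 - 1 / q $ j)"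
  let ?g = "slice_norm (q $ i) i f"
  have g: "?g \<in> borel_measurable borel"
    using Cons.prems by (intro borel_measurable_slice_norm)
  have supp: "?g y = 0" if "j \<in> set is" "y $ j \<notin> {a $ j..a $ j + l}" for j y
    using Cons.prems that by (intro slice_norm_supp [of i j "{a $ j..a $ j + l}"]) auto
  have "nested_norm 1 (i # is) f x \<le> nested_norm 1 is (\<lambda>y. ennreal ?c * ?g y) x"
  proof -
    have "slice_norm 1 i f y \<le> ennreal ?c * ?g y" for y
      using Cons.prems(2) l q [of i] Cons.prems(3) [of i]
      by (intro slice_norm_Hoelder [where a = a]) auto
    then show ?thesis by (auto intro!: nested_norm_mono)
  qed
  also have "\<dots> = ennreal ?c * nested_norm 1 is ?g x"
    using g by (intro nested_norm_cmult) auto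
  also have "\<dots> \<le> ennreal ?c * (ennreal ?d * nested_norm q is ?g x)"
    using Cons.prems supp g by (intro mult_left_mono Cons.IH) auto
  also have "\<dots> = ennreal (l powr (\<Sum>j\<in>set (i # is). 1 - 1 / q $ j)) * nested_norm q (i # is) f x"
    using Cons.prems by (simp add: powr_add ennreal_mult mult.assoc)
  finally show ?case .
qed

text \<open>The factor in front of \<open>c\<close> is the mixed norm of the indicator of a cube; it
  accumulates one variable at a time, and with it the pointwise bound.\<close>

lemma nested_norm_le_const:
  fixes f :: "real ^ 'n \<Rightarrow> ennreal"
  assumes l: "0 < l" and q: "\<And>j. 0 < q $ j" and "0 \<le> c"
    and "distinct is" "\<And>y. f y \<le> ennreal c" "\<And>j y. j \<in> set is \<Longrightarrow> y $ j \<notin> {a $ j..a $ j + l} \<Longrightarrow> f y = 0"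
  shows "nested_norm q is f x \<le> ennreal (l powr (\<Sum>j\<in>set is. 1 / q $ j) * c)"
  using assms(3-)
proof (induction "is" arbitrary: f c)
  case Nil
  then show ?case using l by simp
next
  case (Cons i "is")
  let ?g = "slice_norm (q $ i) i f"
  have supp: "?g y = 0" if "j \<in> set is" "y $ j \<notin> {a $ j..a $ j + l}" for j y
    using Cons.prems that by (intro slice_norm_supp [of i j "{a $ j..a $ j + l}"]) auto
  have "?g y \<le> ennreal (l powr (1 / q $ i) * c)" for y
  proof -
    have "(\<integral>\<^sup>+t. enn_powr (f (upd y i t)) (q $ i) \<partial>lborel)
      \<le> (\<integral>\<^sup>+t. ennreal (c powr (q $ i)) * indicator {a $ i..a $ i + l} t \<partial>lborel)"
    proof (rule nn_integral_mono)
      fix t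
      have "enn_powr (f (upd y i t)) (q $ i) \<le> enn_powr (ennreal c) (q $ i)"
        using Cons.prems q [of i] by (intro enn_powr_mono) auto
      moreover have "f (upd y i t) = 0" if "t \<notin> {a $ i..a $ i + l}"
        using that by (intro Cons.prems(4) [of i]) auto
      ultimately show "enn_powr (f (upd y i t)) (q $ i) \<le> ennreal (c powr (q $ i)) * indicator {a $ i..a $ i + l} t"
        using Cons.prems(1) by (auto simp: enn_powr_ennreal indicator_def)
    qed
    also have "\<dots> = ennreal (c powr (q $ i) * l)"
      using l by (simp add: nn_integral_cmult_indicator ennreal_mult)
    finally have "?g y \<le> enn_powr (ennreal (c powr (q $ i) * l)) (1 / q $ i)"
      unfolding slice_norm_def using q [of i] by (intro enn_powr_mono) auto
    also have "\<dots> = ennreal (l powr (1 / q $ i) * c)"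
      using l q [of i] Cons.prems(1) by (simp add: enn_powr_ennreal powr_mult powr_powr mult.commute)
    finally show ?thesis .
  qed
  then have "nested_norm q is ?g x \<le> ennreal (l powr (\<Sum>j\<in>set is. 1 / q $ j) * (l powr (1 / q $ i) * c))"
    using Cons.prems supp by (intro Cons.IH) auto
  also have "l powr (\<Sum>j\<in>set is. 1 / q $ j) * (l powr (1 / q $ i) * c) = l powr (\<Sum>j\<in>set (i # is). 1 / q $ j) * c"
    using Cons.prems by (simp add: powr_add mult_ac)
  finally show ?case by simp
qed

text \<open>All coordinates share the ratio \<theta>, so the power can be pulled out of one stage
  after another.\<close>

lemma nested_norm_powr:
  assumes "0 < \<theta>" and s: "\<And>j. s $ j = q $ j / \<theta>" and q: "\<And>j. 0 < q $ j"
  shows "nested_norm s is (\<lambda>x. enn_powr (f x) \<theta>) x = enn_powr (nested_norm q is f x) \<theta>"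
proof (induction "is" arbitrary: f)
  case (Cons i "is")
  have "slice_norm (s $ i) i (\<lambda>x. enn_powr (f x) \<theta>) = (\<lambda>x. enn_powr (slice_norm (q $ i) i f x) \<theta>)"
    using assms q [of i] by (auto simp: slice_norm_def enn_powr_powr fun_eq_iff)
  then show ?case using Cons by simp
qed simp

section \<open>Hedberg's inequality\<close>

definition cube :: "real ^ 'n \<Rightarrow> real \<Rightarrow> (real ^ 'n) set" where
  "cube x R = cbox (x - vec R) (x + vec R)"

lemma mem_cube: "y \<in> cube x R \<longleftrightarrow> (\<forall>j. \<bar>x $ j - y $ j\<bar> \<le> R)"
  by (auto simp: cube_def mem_box_cart abs_le_iff algebra_simps)

lemma term_le_suminf_ennreal: "f k \<le> (\<Sum>k. f k)" for f :: "nat \<Rightarrow> ennreal"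
  using sum_le_suminf [of f "{k}"] by simp

text \<open>Some listed scale \<open>R\<close> satisfies \<open>R / 2 \<le> m \<le> R\<close> for
  the maximum norm \<open>m\<close> of \<open>x - y\<close>. Then \<open>y\<close> lies in the cube
  of half side \<open>R\<close>, and this single term dominates the kernel because the Euclidean
  norm is at least \<open>m\<close>.\<close>

lemma kernel_le_cubes:
  fixes x y :: "real ^ 'n"
  assumes l: "0 < l" and v: "0 < v"
  shows "ennreal (1 / norm (x - y) powr v)
    \<le> ennreal (2 powr v) * ((\<Sum>k. ennreal ((l / 2 ^ k) powr (- v)) * indicator (cube x (l / 2 ^ k)) y)
       + (\<Sum>k. ennreal ((l * 2 ^ Suc k) powr (- v)) * indicator (cube x (l * 2 ^ Suc k)) y))"
proof (cases "x = y")
  case True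
  \<comment> \<open>On the diagonal the left side is 0, by the conventions for \<open>powr\<close>
    at 0 and for division by 0.\<close>
  then show ?thesis by simp
next
  case False
  define m where "m = Max (range (\<lambda>j. \<bar>x $ j - y $ j\<bar>))"
  have m_ge: "\<bar>x $ j - y $ j\<bar> \<le> m" for j by (simp add: m_def)
  have "m \<in> range (\<lambda>j. \<bar>x $ j - y $ j\<bar>)"
    unfolding m_def by (rule Max_in) auto
  then obtain j where j: "m = \<bar>x $ j - y $ j\<bar>" by blast
  obtain i where "x $ i \<noteq> y $ i" using False by (auto simp: vec_eq_iff)
  then have m0: "0 < m" using m_ge [of i] by auto
  have mn: "m \<le> norm (x - y)" using component_le_norm_cart [of "x - y" j] by (simp add: j)
  have main: "ennreal (1 / norm (x - y) powr v) \<le> ennreal (2 powr v) * (ennreal (R powr (- v)) * indicator (cube x R) y)"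
    if R: "0 < R" "R / 2 \<le> m" "m \<le> R" for R
  proof -
    have "1 / norm (x - y) powr v \<le> 1 / (R / 2) powr v"
      using R m0 mn v by (intro divide_left_mono powr_mono2 mult_pos_pos) auto
    also have "\<dots> = 2 powr v * R powr (- v)"
      using R by (simp add: powr_divide powr_minus field_simps)
    finally have "ennreal (1 / norm (x - y) powr v) \<le> ennreal (2 powr v * R powr (- v))"
      by (rule ennreal_leI)
    moreover have "y \<in> cube x R" using m_ge R by (auto simp: mem_cube intro: order.trans)
    ultimately show ?thesis by (simp add: ennreal_mult)
  qed
  show ?thesis
  proof (cases "m \<le> l")
    case True
    obtain k0 :: nat where "l / m < 2 ^ k0" using real_arch_pow [of 2 "l / m"] by auto
    then have ex: "l / 2 ^ k0 < m" using m0 by (simp add: field_simps)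
    define K where "K = (LEAST k. l / 2 ^ k < m)"
    have K: "l / 2 ^ K < m" unfolding K_def by (rule LeastI) (rule ex)
    have "K \<noteq> 0" using K True by (intro notI) simp
    then obtain k where k: "K = Suc k" by (cases K) auto
    have "\<not> l / 2 ^ k < m" using not_less_Least [of k "\<lambda>k. l / 2 ^ k < m"] k by (simp add: K_def)
    then have "ennreal (1 / norm (x - y) powr v) \<le> ennreal (2 powr v) * (ennreal ((l / 2 ^ k) powr (- v)) * indicator (cube x (l / 2 ^ k)) y)"
      using K k l by (intro main) (auto simp: mult.commute)
    also have "\<dots> \<le> ennreal (2 powr v) * (\<Sum>k. ennreal ((l / 2 ^ k) powr (- v)) * indicator (cube x (l / 2 ^ k)) y)"
      by (intro mult_left_mono term_le_suminf_ennreal [where f = "\<lambda>k. ennreal ((l / 2 ^ k) powr (- v)) * indicator (cube x (l / 2 ^ k)) y"]) auto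
    finally show ?thesis by (rule order.trans) (intro mult_left_mono, auto)
  next
    case False
    obtain k0 :: nat where "m / l < 2 ^ k0" using real_arch_pow [of 2 "m / l"] by auto
    then have ex: "m \<le> l * 2 ^ k0" using l by (simp add: field_simps)
    define K where "K = (LEAST k. m \<le> l * 2 ^ k)"
    have K: "m \<le> l * 2 ^ K" unfolding K_def by (rule LeastI) (rule ex)
    have "K \<noteq> 0" using K False by (intro notI) simp
    then obtain k where k: "K = Suc k" by (cases K) auto
    have "\<not> m \<le> l * 2 ^ k" using not_less_Least [of k "\<lambda>k. m \<le> l * 2 ^ k"] k by (simp add: K_def)
    then have "ennreal (1 / norm (x - y) powr v) \<le> ennreal (2 powr v) * (ennreal ((l * 2 ^ Suc k) powr (- v)) * indicator (cube x (l * 2 ^ Suc k)) y)"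
      using K k l by (intro main) auto
    also have "\<dots> \<le> ennreal (2 powr v) * (\<Sum>k. ennreal ((l * 2 ^ Suc k) powr (- v)) * indicator (cube x (l * 2 ^ Suc k)) y)"
      by (intro mult_left_mono term_le_suminf_ennreal [where f = "\<lambda>k. ennreal ((l * 2 ^ Suc k) powr (- v)) * indicator (cube x (l * 2 ^ Suc k)) y"]) auto
    finally show ?thesis by (rule order.trans) (intro mult_left_mono, auto)
  qed
qed

section \<open>Summation over dyadic scales\<close>

lemma sum_power_inj_le:
  fixes c :: real
  assumes c: "0 \<le> c" "c < 1" and F: "finite F" "inj_on \<phi> F"
  shows "(\<Sum>k\<in>F. c ^ \<phi> k) \<le> 1 / (1 - c)"
proof -
  have "(\<Sum>k\<in>F. c ^ \<phi> k) = (\<Sum>j\<in>\<phi> ` F. c ^ j)"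
    using F by (simp add: sum.reindex)
  also have "\<dots> \<le> (\<Sum>j. c ^ j)"
    using c F by (intro sum_le_suminf summable_geometric) auto
  also have "\<dots> = 1 / (1 - c)"
    using c by (intro suminf_geometric) auto
  finally show ?thesis .
qed

text \<open>Two geometric series, one for each side of the scale at which two competing bounds
  cross.\<close>

definition scale_const :: "real \<Rightarrow> real \<Rightarrow> real" where
  "scale_const b c = 1 / (1 - 2 powr (- b)) + 1 / (1 - 2 powr (- c))"

lemma two_powr_minus_less_1: "0 < b \<Longrightarrow> 2 powr (- b) < (1 :: real)"
  using powr_less_mono [of "- b" 0 2] by simp

text \<open>From the first index \<open>K\<close> with \<open>a / 2 ^ K\<close> at most 1 the
  positive power decays geometrically; before it the negative power does, read backwards from
  \<open>K\<close>. Neither series depends on \<open>a\<close>.\<close>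

lemma sum_min_powr_le:
  fixes a b c :: real
  assumes a: "0 < a" and b: "0 < b" and c: "0 < c"
  shows "(\<Sum>k<M. min ((a / 2 ^ k) powr b) ((a / 2 ^ k) powr (- c))) \<le> scale_const b c"
proof -
  obtain k0 :: nat where "a < 2 ^ k0" using real_arch_pow [of 2 a] by auto
  then have ex: "a / 2 ^ k0 \<le> 1" by (simp add: field_simps)
  define K where "K = (LEAST k. a / 2 ^ k \<le> 1)"
  have K: "a / 2 ^ K \<le> 1" unfolding K_def by (rule LeastI) (rule ex)
  let ?t = "\<lambda>k. min ((a / 2 ^ k) powr b) ((a / 2 ^ k) powr (- c))"
  have pw: "(2 powr (- e)) ^ j = (2 ^ j) powr (- e)" for e :: real and j :: nat
    by (simp add: powr_realpow [symmetric] powr_powr mult.commute)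
  have low: "?t k \<le> (2 powr (- b)) ^ (k - K)" if k: "K \<le> k" for k
  proof -
    have "(2 :: real) ^ k = 2 ^ K * 2 ^ (k - K)" using k by (simp flip: power_add)
    then have "a / 2 ^ k = a / 2 ^ K / 2 ^ (k - K)" by simp
    also have "\<dots> \<le> 1 / 2 ^ (k - K)" using K by (intro divide_right_mono) auto
    finally have "(a / 2 ^ k) powr b \<le> (1 / 2 ^ (k - K)) powr b"
      using a b by (intro powr_mono2) auto
    also have "\<dots> = (2 powr (- b)) ^ (k - K)"
      unfolding pw by (simp add: powr_divide powr_minus field_simps)
    finally show ?thesis by simp
  qed
  have high: "?t k \<le> (2 powr (- c)) ^ (K - Suc k)" if k: "k < K" for k
  proof -
    have "\<not> a / 2 ^ (K - 1) \<le> 1"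
      using not_less_Least [of "K - 1" "\<lambda>k. a / 2 ^ k \<le> 1"] k by (simp add: K_def)
    moreover have "(2 :: real) ^ (K - 1) = 2 ^ k * 2 ^ (K - Suc k)" using k by (simp flip: power_add)
    ultimately have "2 ^ (K - Suc k) \<le> a / 2 ^ k" by (simp add: field_simps)
    then have "(a / 2 ^ k) powr (- c) \<le> (2 ^ (K - Suc k)) powr (- c)"
      using c by (intro powr_mono2') auto
    then show ?thesis unfolding pw by simp
  qed
  have "(\<Sum>k<M. ?t k) = (\<Sum>k\<in>{..<M} \<inter> {K..}. ?t k) + (\<Sum>k\<in>{..<M} - {K..}. ?t k)"
    by (rule sum.Int_Diff) simp
  also have "\<dots> \<le> (\<Sum>k\<in>{..<M} \<inter> {K..}. (2 powr (- b)) ^ (k - K)) + (\<Sum>k\<in>{..<M} - {K..}. (2 powr (- c)) ^ (K - Suc k))"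
    by (intro add_mono sum_mono low high) auto
  also have "\<dots> \<le> scale_const b c"
    unfolding scale_const_def using b c two_powr_minus_less_1
    by (intro add_mono sum_power_inj_le) (auto simp: inj_on_def)
  finally show ?thesis .
qed

text \<open>Hedberg's interpolation: the two bounds are equal at the scale where
  \<open>R powr (b + c) = N / A\<close>.\<close>

lemma suminf_min_scales_le:
  fixes A :: ennreal and N b c l :: real
  assumes N: "0 \<le> N" and b: "0 < b" and c: "0 < c" and l: "0 < l"
  shows "(\<Sum>k. min (A * ennreal ((l / 2 ^ k) powr b)) (ennreal (N * (l / 2 ^ k) powr (- c))))
    \<le> ennreal (scale_const b c * N powr (b / (b + c))) * enn_powr A (c / (b + c))"
    (is "?S \<le> _")
proof -
  have K: "0 < scale_const b c"
    unfolding scale_const_def using two_powr_minus_less_1 [OF b] two_powr_minus_less_1 [OF c]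
    by (intro add_pos_pos divide_pos_pos) auto
  consider "N = 0" | "A = 0" | "0 < N" "A = \<infinity>" | r where "0 < N" "A = ennreal r" "0 < r"
    using N by (cases A) (auto simp: less_le)
  then show ?thesis
  proof cases
    case 3
    then have "ennreal (scale_const b c * N powr (b / (b + c))) * enn_powr A (c / (b + c)) = \<infinity>"
      using K by (simp add: ennreal_mult_top)
    then show ?thesis by simp
  next
    case 4
    \<comment> \<open>Dividing by the crossing radius moves the crossing to 1, and \<open>S\<close>
      is the common value of the two bounds there.\<close>
    define a where "a = l / (N / r) powr (1 / (b + c))"
    define S where "S = N powr (b / (b + c)) * r powr (c / (b + c))"
    have a: "0 < a" using 4 l by (simp add: a_def)
    have la: "l = a * (N / r) powr (1 / (b + c))" using 4 by (simp add: a_def)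
    have S0: "0 < S" using 4 by (simp add: S_def)
    have bc: "1 - b / (b + c) = c / (b + c)" "1 - c / (b + c) = b / (b + c)"
      using b c by (auto simp: field_simps)
    have 1: "r * (l / 2 ^ k) powr b = S * (a / 2 ^ k) powr b" for k :: nat
    proof -
      have "r * (N / r) powr (b / (b + c)) = S"
        using 4 unfolding S_def bc(1) [symmetric] by (simp add: powr_divide powr_diff)
      moreover have "(l / 2 ^ k) powr b = (a / 2 ^ k) powr b * (N / r) powr (b / (b + c))"
        unfolding la using a 4 by (simp add: powr_mult powr_divide powr_powr)
      ultimately show ?thesis by (simp add: mult_ac)
    qed
    have 2: "N * (l / 2 ^ k) powr (- c) = S * (a / 2 ^ k) powr (- c)" for k :: nat
    proof -
      have "N * (N / r) powr (- (c / (b + c))) = S"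
        using 4 unfolding S_def bc(2) [symmetric] by (simp add: powr_divide powr_diff powr_minus field_simps)
      moreover have "(l / 2 ^ k) powr (- c) = (a / 2 ^ k) powr (- c) * (N / r) powr (- (c / (b + c)))"
        unfolding la using a 4 by (simp add: powr_mult powr_divide powr_powr)
      ultimately show ?thesis by (simp add: mult_ac)
    qed
    have min_eq: "min (A * ennreal ((l / 2 ^ k) powr b)) (ennreal (N * (l / 2 ^ k) powr (- c)))
       = ennreal (S * min ((a / 2 ^ k) powr b) ((a / 2 ^ k) powr (- c)))" for k :: nat
    proof -
      have "A * ennreal ((l / 2 ^ k) powr b) = ennreal (S * (a / 2 ^ k) powr b)"
        using 4 by (simp flip: ennreal_mult 1)
      moreover have "min (ennreal u) (ennreal v) = ennreal (min u v)" for u v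
        by (rule min_of_mono) (simp add: mono_def ennreal_leI)
      ultimately show ?thesis
        using S0 unfolding 2 by (simp add: min_mult_distrib_left)
    qed
    have "?S \<le> ennreal (S * scale_const b c)"
      unfolding min_eq
    proof (rule suminf_le_const)
      fix M
      have "(\<Sum>k<M. ennreal (S * min ((a / 2 ^ k) powr b) ((a / 2 ^ k) powr (- c))))
        = ennreal (S * (\<Sum>k<M. min ((a / 2 ^ k) powr b) ((a / 2 ^ k) powr (- c))))"
        using S0 by (subst sum_ennreal) (auto simp: sum_distrib_left)
      also have "\<dots> \<le> ennreal (S * scale_const b c)"
        using S0 a b c by (intro ennreal_leI mult_left_mono sum_min_powr_le) auto
      finally show "(\<Sum>k<M. ennreal (S * min ((a / 2 ^ k) powr b) ((a / 2 ^ k) powr (- c)))) \<le> ennreal (S * scale_const b c)" .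
    qed simp
    also have "\<dots> = ennreal (scale_const b c * N powr (b / (b + c))) * enn_powr A (c / (b + c))"
      using 4 K by (simp add: enn_powr_ennreal S_def mult_ac flip: ennreal_mult)
    finally show ?thesis .
  qed simp_all
qed

lemma suminf_far_scales:
  fixes c l :: real
  assumes "0 < c" "0 < l" "0 \<le> N"
  shows "(\<Sum>k. ennreal (N * (l * 2 ^ Suc k) powr (- c))) \<le> ennreal (scale_const c c * N * l powr (- c))"
proof (rule suminf_le_const)
  fix M
  have pw: "(l * 2 ^ Suc k) powr (- c) = l powr (- c) * (2 powr (- c)) ^ Suc k" for k
    using assms(2) by (simp add: powr_mult powr_realpow [symmetric] powr_powr powr_add algebra_simps del: power_Suc)
  have "(\<Sum>k<M. ennreal (N * (l * 2 ^ Suc k) powr (- c))) = ennreal (N * l powr (- c) * (\<Sum>k<M. (2 powr (- c)) ^ Suc k))"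
    using assms unfolding pw by (subst sum_ennreal) (auto simp: sum_distrib_left mult.assoc)
  also have "\<dots> \<le> ennreal (N * l powr (- c) * (1 / (1 - 2 powr (- c))))"
    using assms two_powr_minus_less_1 [of c]
    by (intro ennreal_leI mult_left_mono sum_power_inj_le) (auto simp: inj_on_def simp del: power_Suc)
  also have "\<dots> \<le> ennreal (scale_const c c * N * l powr (- c))"
  proof (rule ennreal_leI)
    have "1 / (1 - 2 powr (- c)) \<le> scale_const c c"
      using two_powr_minus_less_1 [of c] assms by (simp add: scale_const_def divide_right_mono)
    then have "N * l powr (- c) * (1 / (1 - 2 powr (- c))) \<le> N * l powr (- c) * scale_const c c"
      using assms by (intro mult_left_mono) auto
    then show "N * l powr (- c) * (1 / (1 - 2 powr (- c))) \<le> scale_const c c * N * l powr (- c)"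
      by (simp add: mult_ac)
  qed
  finally show "(\<Sum>k<M. ennreal (N * (l * 2 ^ Suc k) powr (- c))) \<le> ennreal (scale_const c c * N * l powr (- c))" .
qed simp

text \<open>With values in [0, \<infinity>] no question of integrability arises; applied to the
  modulus of a function, it controls both the existence and the size of
  \<open>frac_int\<close>.\<close>

definition potential :: "real \<Rightarrow> (real ^ 'n \<Rightarrow> ennreal) \<Rightarrow> real ^ 'n \<Rightarrow> ennreal" where
  "potential \<alpha> g x = (\<integral>\<^sup>+y. g y * ennreal (1 / norm (x - y) powr (real CARD('n) - \<alpha>)) \<partial>lborel)"

lemma borel_measurable_potential:
  fixes g :: "real ^ 'n \<Rightarrow> ennreal"
  assumes [measurable]: "g \<in> borel_measurable borel"
  shows "potential \<alpha> g \<in> borel_measurable borel"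
proof -
  have "(\<lambda>(x, y). g y * ennreal (1 / norm (x - y) powr (real CARD('n) - \<alpha>))) \<in> borel_measurable (borel \<Otimes>\<^sub>M lborel)"
    by measurable
  from lborel.borel_measurable_nn_integral [OF this] show ?thesis
    unfolding potential_def [abs_def] .
qed

lemma potential_le_cubes:
  fixes g :: "real ^ 'n \<Rightarrow> ennreal"
  assumes g [measurable]: "g \<in> borel_measurable borel" and l: "0 < l" and \<alpha>: "\<alpha> < real CARD('n)"
  shows "potential \<alpha> g x \<le> ennreal (2 powr (real CARD('n) - \<alpha>)) *
     ((\<Sum>k. ennreal ((l / 2 ^ k) powr (\<alpha> - real CARD('n))) * (\<integral>\<^sup>+y. g y * indicator (cube x (l / 2 ^ k)) y \<partial>lborel))
      + (\<Sum>k. ennreal ((l * 2 ^ Suc k) powr (\<alpha> - real CARD('n))) * (\<integral>\<^sup>+y. g y * indicator (cube x (l * 2 ^ Suc k)) y \<partial>lborel)))"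
proof -
  let ?v = "real CARD('n) - \<alpha>"
  let ?F = "\<lambda>R y. ennreal (R powr (- ?v)) * indicator (cube x R) y :: ennreal"
  have [measurable]: "cube x R \<in> sets borel" for R by (simp add: cube_def)
  have int: "(\<integral>\<^sup>+y. g y * ?F R y \<partial>lborel)
    = ennreal (R powr (\<alpha> - real CARD('n))) * (\<integral>\<^sup>+y. g y * indicator (cube x R) y \<partial>lborel)" for R
    by (subst nn_integral_cmult [symmetric]) (auto simp: mult_ac)
  have "potential \<alpha> g x \<le> (\<integral>\<^sup>+y. g y * (ennreal (2 powr ?v) * ((\<Sum>k. ?F (l / 2 ^ k) y) + (\<Sum>k. ?F (l * 2 ^ Suc k) y))) \<partial>lborel)"
    unfolding potential_def using l \<alpha>
    by (intro nn_integral_mono mult_left_mono kernel_le_cubes) auto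
  also have "\<dots> = (\<integral>\<^sup>+y. ennreal (2 powr ?v) * ((\<Sum>k. g y * ?F (l / 2 ^ k) y) + (\<Sum>k. g y * ?F (l * 2 ^ Suc k) y)) \<partial>lborel)"
    by (simp only: ennreal_suminf_cmult distrib_left mult.left_commute)
  also have "\<dots> = ennreal (2 powr ?v) * ((\<Sum>k. \<integral>\<^sup>+y. g y * ?F (l / 2 ^ k) y \<partial>lborel) + (\<Sum>k. \<integral>\<^sup>+y. g y * ?F (l * 2 ^ Suc k) y \<partial>lborel))"
    by (subst nn_integral_cmult, measurable, subst nn_integral_add, measurable,
        subst nn_integral_suminf, measurable, subst nn_integral_suminf, measurable)
  finally show ?thesis by (simp only: int)
qed

section \<open>Mixed Morrey norms\<close>

lemma nn_integral_cube_le: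
  fixes G :: "real ^ 'n \<Rightarrow> ennreal" and q :: "real ^ 'n"
  assumes ds: "distinct ds" "set ds = UNIV" and G [measurable]: "G \<in> borel_measurable borel"
    and q: "\<And>j. 1 \<le> q $ j" and l: "0 < l"
  shows "(\<integral>\<^sup>+y. G y * indicator (cbox a (a + vec l)) y \<partial>lborel)
    \<le> ennreal (l powr (real CARD('n) - (\<Sum>j\<in>UNIV. 1 / q $ j))) * nested_norm q ds (\<lambda>y. G y * indicator (cbox a (a + vec l)) y) 0"
proof -
  have "(\<integral>\<^sup>+y. G y * indicator (cbox a (a + vec l)) y \<partial>lborel)
    = nested_norm 1 ds (\<lambda>y. G y * indicator (cbox a (a + vec l)) y) 0"
    by (intro nn_integral_lborel_nested ds) measurable
  also have "\<dots> \<le> ennreal (l powr (\<Sum>j\<in>set ds. 1 - 1 / q $ j)) * nested_norm q ds (\<lambda>y. G y * indicator (cbox a (a + vec l)) y) 0"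
    using l q ds by (intro nested_norm_Hoelder [where a = a]) (auto simp: indicator_def mem_box_cart)
  also have "(\<Sum>j\<in>set ds. 1 - 1 / q $ j) = real CARD('n) - (\<Sum>j\<in>UNIV. 1 / q $ j)"
    by (simp add: ds sum_subtractf)
  finally show ?thesis .
qed

lemma powr_split: "0 \<le> m \<Longrightarrow> m powr (1 - \<theta>) * m powr \<theta> = m" for m \<theta> :: real
  by (cases "m = 0") (auto simp flip: powr_add)

text \<open>The exponent in \<open>cubes\<close> is normalised so that kernel times mass at scale
  \<open>R\<close> is at most \<open>N * R powr (- c)\<close>, which is summable over far scales. At
  near scales this competes with \<open>R powr \<alpha>\<close> times the maximal function; a cube
  of half side at most \<open>l\<close> about a point of the given cube lies in the tripled one, so
  only the restriction of \<open>G\<close> enters.\<close>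

lemma potential_pointwise:
  fixes G :: "real ^ 'n \<Rightarrow> ennreal" and \<alpha> c N l :: real
  defines "n \<equiv> real CARD('n)"
  assumes ds: "distinct ds" "set ds = UNIV" and G [measurable]: "G \<in> borel_measurable borel"
    and \<alpha>: "0 < \<alpha>" "\<alpha> < n" and c: "0 < c" and l: "0 < l" and N: "0 \<le> N"
    and cubes: "\<And>z R. 0 < R \<Longrightarrow> (\<integral>\<^sup>+y. G y * indicator (cube z R) y \<partial>lborel) \<le> ennreal (N * R powr (n - \<alpha> - c))"
    and x: "x \<in> cbox a (a + vec l)"
  shows "potential \<alpha> G x \<le> ennreal (2 powr (n - \<alpha>)) *
      (ennreal (scale_const \<alpha> c * N powr (\<alpha> / (\<alpha> + c)))
         * enn_powr (box_max l ds (\<lambda>y. G y * indicator (cbox (a - vec l) (a - vec l + vec (3 * l))) y) x) (c / (\<alpha> + c))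
       + ennreal (scale_const c c * N * l powr (- c)))"
proof -
  let ?h = "\<lambda>y. G y * indicator (cbox (a - vec l) (a - vec l + vec (3 * l))) y"
  let ?A = "box_max l ds ?h x"
  let ?B = "\<lambda>R. \<integral>\<^sup>+y. G y * indicator (cube x R) y \<partial>lborel"
  have B: "ennreal (R powr (\<alpha> - n)) * ?B R \<le> ennreal (N * R powr (- c))" if R: "0 < R" for R
  proof -
    have "ennreal (R powr (\<alpha> - n)) * ?B R \<le> ennreal (R powr (\<alpha> - n)) * ennreal (N * R powr (n - \<alpha> - c))"
      using R by (intro mult_left_mono cubes) auto
    also have "\<dots> = ennreal (N * (R powr (\<alpha> - n) * R powr (n - \<alpha> - c)))"
      using N by (subst ennreal_mult [symmetric]) (auto simp: mult_ac)
    also have "R powr (\<alpha> - n) * R powr (n - \<alpha> - c) = R powr (- c)"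
      by (simp flip: powr_add)
    finally show ?thesis .
  qed
  have near: "ennreal ((l / 2 ^ k) powr (\<alpha> - n)) * ?B (l / 2 ^ k)
    \<le> min (?A * ennreal ((l / 2 ^ k) powr \<alpha>)) (ennreal (N * (l / 2 ^ k) powr (- c)))" for k
  proof -
    let ?R = "l / 2 ^ k"
    have R: "0 < ?R" "?R \<le> l" using l by (auto simp: field_simps)
    have "y \<in> cbox (a - vec l) (a - vec l + vec (3 * l))" if y: "y \<in> cube x ?R" for y
    proof -
      have "\<bar>x $ j - y $ j\<bar> \<le> l" for j using y R(2) by (auto simp: mem_cube intro: order.trans)
      moreover have "a $ j \<le> x $ j \<and> x $ j \<le> a $ j + l" for j using x by (auto simp: mem_box_cart)
      ultimately have "a $ j - l \<le> y $ j \<and> y $ j \<le> a $ j - l + 3 * l" for j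
        by (smt (verit))
      then show ?thesis by (simp add: mem_box_cart)
    qed
    then have "?B ?R = (\<integral>\<^sup>+y. ?h y * indicator (cube x ?R) y \<partial>lborel)"
      by (intro nn_integral_cong) (auto simp: indicator_def)
    also have "\<dots> \<le> ennreal (?R ^ CARD('n)) * ?A"
      unfolding cube_def by (intro nn_integral_box_le_box_max ds l) measurable
    finally have "ennreal (?R powr (\<alpha> - n)) * ?B ?R \<le> ennreal (?R powr (\<alpha> - n)) * (ennreal (?R ^ CARD('n)) * ?A)"
      by (rule mult_left_mono) simp
    also have "\<dots> = ennreal (?R powr (\<alpha> - n) * ?R ^ CARD('n)) * ?A"
      using R by (simp add: ennreal_mult mult.assoc)
    also have "?R powr (\<alpha> - n) * ?R ^ CARD('n) = ?R powr \<alpha>"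
      using R by (simp add: n_def powr_realpow [symmetric] flip: powr_add)
    finally show ?thesis using B [OF R(1)] by (simp add: mult.commute)
  qed
  have "potential \<alpha> G x \<le> ennreal (2 powr (n - \<alpha>)) *
     ((\<Sum>k. ennreal ((l / 2 ^ k) powr (\<alpha> - n)) * ?B (l / 2 ^ k))
      + (\<Sum>k. ennreal ((l * 2 ^ Suc k) powr (\<alpha> - n)) * ?B (l * 2 ^ Suc k)))"
    unfolding n_def using \<alpha> l by (intro potential_le_cubes G) (auto simp: n_def)
  also have "\<dots> \<le> ennreal (2 powr (n - \<alpha>)) *
     ((\<Sum>k. min (?A * ennreal ((l / 2 ^ k) powr \<alpha>)) (ennreal (N * (l / 2 ^ k) powr (- c))))
      + (\<Sum>k. ennreal (N * (l * 2 ^ Suc k) powr (- c))))"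
    using l by (intro mult_left_mono add_mono suminf_le near B) auto
  also have "\<dots> \<le> ennreal (2 powr (n - \<alpha>)) *
     (ennreal (scale_const \<alpha> c * N powr (\<alpha> / (\<alpha> + c))) * enn_powr ?A (c / (\<alpha> + c))
       + ennreal (scale_const c c * N * l powr (- c)))"
    using N \<alpha> c l by (intro mult_left_mono add_mono suminf_min_scales_le suminf_far_scales) auto
  finally show ?thesis .
qed

lemma potential_morrey_bound:
  fixes q s :: "real ^ 'n" and \<alpha> p r :: real
  defines "n \<equiv> real CARD('n)"
  assumes ds: "distinct ds" "set ds = UNIV" and \<alpha>: "0 < \<alpha>" "\<alpha> < n"
    and q: "\<And>j. 1 < q $ j" and s: "\<And>j. 1 < s $ j" and pr: "0 < p" "0 < r"
    and rp: "1 / r = 1 / p - \<alpha> / n" and qs: "\<And>j. q $ j / p = s $ j / r"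
  shows "\<exists>C>0. \<forall>G m. G \<in> borel_measurable borel \<longrightarrow> 0 \<le> m \<longrightarrow>
    (\<forall>a l. 0 < l \<longrightarrow> nested_norm q ds (\<lambda>x. G x * indicator (cbox a (a + vec l)) x) 0
        \<le> ennreal (m * l powr ((\<Sum>j\<in>UNIV. 1 / q $ j) - n / p))) \<longrightarrow>
    (\<forall>a l. 0 < l \<longrightarrow> nested_norm s ds (\<lambda>x. potential \<alpha> G x * indicator (cbox a (a + vec l)) x) 0
        \<le> ennreal (C * m * l powr ((\<Sum>j\<in>UNIV. 1 / s $ j) - n / r)))"
proof -
  have n0: "0 < n" by (simp add: n_def)
  define \<theta> where "\<theta> = p / r"
  define c where "c = n / r"
  have c0: "0 < c" using n0 pr by (simp add: c_def)
  \<comment> \<open>The relation between \<open>p\<close>, \<open>r\<close> and \<alpha> in this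
    form identifies the interpolation exponent \<open>c / (\<alpha> + c)\<close> with
    \<open>p / r\<close>.\<close>
  have ac: "\<alpha> + c = n / p"
  proof -
    have "n * (1 / r) = n * (1 / p - \<alpha> / n)" using rp by simp
    then show ?thesis using n0 by (simp add: c_def algebra_simps)
  qed
  have th: "0 < \<theta>" "c / (\<alpha> + c) = \<theta>"
    using pr n0 unfolding ac by (auto simp: \<theta>_def c_def)
  have th': "\<alpha> / (\<alpha> + c) = 1 - \<theta>"
    using \<alpha> c0 by (simp add: th(2) [symmetric] field_simps)
  have sq: "s $ j = q $ j / \<theta>" for j
    using qs [of j] pr by (simp add: \<theta>_def field_simps)
  have q0: "0 < q $ j" "1 \<le> q $ j" and s0: "0 < s $ j" "1 \<le> s $ j" for j
    using q [of j] s [of j] by auto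
  \<comment> \<open>The growth exponent in \<open>l\<close> of the q-norm over cubes of side
    \<open>l\<close>; multiplied by \<theta> it is the one required of the s-norm.\<close>
  define e where "e = (\<Sum>j\<in>UNIV. 1 / q $ j) - n / p"
  have e': "\<theta> * e = (\<Sum>j\<in>UNIV. 1 / s $ j) - c"
    using pr by (simp add: e_def sq c_def \<theta>_def right_diff_distrib sum_distrib_left mult.commute)
  obtain C0 where C0: "0 \<le> C0" "\<And>l f x. 0 < l \<Longrightarrow> f \<in> borel_measurable borel \<Longrightarrow>
     nested_norm q ds (box_max l ds f) x \<le> ennreal C0 * nested_norm q ds f x"
    using box_max_bound [OF q subset_refl, of ds] by blast
  \<comment> \<open>\<open>K1\<close> comes from the kernel decomposition, and \<open>K2\<close>
    from the fact that a cube of half side \<open>R\<close> has side \<open>2 * R\<close>. The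
    factor \<open>3 powr e\<close> in \<open>K\<close> comes from the tripled cube.\<close>
  define K1 where "K1 = (2 :: real) powr (n - \<alpha>)"
  define K2 where "K2 = (2 :: real) powr (n - n / p)"
  define K where "K = K1 * (scale_const \<alpha> c * K2 powr (1 - \<theta>) * (C0 * 3 powr e) powr \<theta> + scale_const c c * K2)"
  have sc: "0 < scale_const \<alpha> c" "0 < scale_const c c"
    unfolding scale_const_def using two_powr_minus_less_1 [OF \<alpha>(1)] two_powr_minus_less_1 [OF c0]
    by (auto intro!: add_pos_pos)
  have K12: "0 < K1" "0 < K2" by (simp_all add: K1_def K2_def)
  have K0: "0 < K" unfolding K_def using sc K12 by (intro mult_pos_pos add_nonneg_pos) auto
  show ?thesis
  proof (intro exI [of _ K] conjI allI impI K0)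
    fix G :: "real ^ 'n \<Rightarrow> ennreal" and m l :: real and a :: "real ^ 'n"
    assume G [measurable]: "G \<in> borel_measurable borel" and m: "0 \<le> m" and l: "0 < l"
      and hyp: "\<forall>a l. 0 < l \<longrightarrow> nested_norm q ds (\<lambda>x. G x * indicator (cbox a (a + vec l)) x) 0
        \<le> ennreal (m * l powr ((\<Sum>j\<in>UNIV. 1 / q $ j) - n / p))"
    have morrey: "nested_norm q ds (\<lambda>x. G x * indicator (cbox a (a + vec l)) x) 0 \<le> ennreal (m * l powr e)"
      if "0 < l" for a l using hyp that unfolding e_def by blast
    define N where "N = K2 * m"
    have N: "0 \<le> N" using m K12 by (simp add: N_def)
    have cubes: "(\<integral>\<^sup>+y. G y * indicator (cube z R) y \<partial>lborel) \<le> ennreal (N * R powr (n - \<alpha> - c))"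
      if R: "0 < R" for z R
    proof -
      have eq: "cube z R = cbox (z - vec R) (z - vec R + vec (2 * R))"
        by (auto simp: cube_def mem_box_cart add.commute)
      have "(\<integral>\<^sup>+y. G y * indicator (cube z R) y \<partial>lborel)
        \<le> ennreal ((2 * R) powr (n - (\<Sum>j\<in>UNIV. 1 / q $ j))) * nested_norm q ds (\<lambda>y. G y * indicator (cbox (z - vec R) (z - vec R + vec (2 * R))) y) 0"
        unfolding eq n_def using R by (intro nn_integral_cube_le ds q0 G) auto
      also have "\<dots> \<le> ennreal ((2 * R) powr (n - (\<Sum>j\<in>UNIV. 1 / q $ j))) * ennreal (m * (2 * R) powr e)"
        using R by (intro mult_left_mono morrey) auto
      also have "\<dots> = ennreal (m * ((2 * R) powr (n - (\<Sum>j\<in>UNIV. 1 / q $ j)) * (2 * R) powr e))"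
        using m by (subst ennreal_mult [symmetric]) (auto simp: mult_ac)
      also have "(2 * R) powr (n - (\<Sum>j\<in>UNIV. 1 / q $ j)) * (2 * R) powr e = (2 * R) powr (n - n / p)"
        by (simp add: e_def flip: powr_add)
      also have "m * (2 * R) powr (n - n / p) = N * R powr (n - \<alpha> - c)"
        using R ac by (simp add: N_def K2_def powr_mult diff_diff_eq)
      finally show ?thesis .
    qed
    let ?h = "\<lambda>y. G y * indicator (cbox (a - vec l) (a - vec l + vec (3 * l))) y"
    let ?A = "box_max l ds ?h"
    let ?Q = "cbox a (a + vec l)"
    define D1 where "D1 = scale_const \<alpha> c * N powr (1 - \<theta>)"
    define D2 where "D2 = scale_const c c * N * l powr (- c)"
    have D: "0 \<le> D1" "0 \<le> D2" using sc N by (simp_all add: D1_def D2_def)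
    have h [measurable]: "?h \<in> borel_measurable borel" by measurable
    have A [measurable]: "?A \<in> borel_measurable borel" by (rule borel_measurable_box_max [OF h])
    have "nested_norm s ds (\<lambda>x. potential \<alpha> G x * indicator ?Q x) 0
      \<le> nested_norm s ds (\<lambda>x. ennreal K1 * (ennreal D1 * enn_powr (?A x) \<theta> + ennreal D2 * indicator ?Q x)) 0"
    proof (intro nested_norm_mono s0)
      fix x
      show "potential \<alpha> G x * indicator ?Q x \<le> ennreal K1 * (ennreal D1 * enn_powr (?A x) \<theta> + ennreal D2 * indicator ?Q x)"
      proof (cases "x \<in> ?Q")
        case True
        have "potential \<alpha> G x \<le> ennreal (2 powr (real CARD('n) - \<alpha>)) *
          (ennreal (scale_const \<alpha> c * N powr (\<alpha> / (\<alpha> + c))) * enn_powr (?A x) (c / (\<alpha> + c))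
           + ennreal (scale_const c c * N * l powr (- c)))"
          by (rule potential_pointwise [OF ds G \<alpha>(1) _ c0 l N _ True])
            (use \<alpha> cubes in \<open>auto simp: n_def\<close>)
        then show ?thesis using True by (simp add: K1_def D1_def D2_def th th' n_def)
      qed simp
    qed
    also have "\<dots> = ennreal K1 * nested_norm s ds (\<lambda>x. ennreal D1 * enn_powr (?A x) \<theta> + ennreal D2 * indicator ?Q x) 0"
      by (intro nested_norm_cmult s0) measurable
    also have "\<dots> \<le> ennreal K1 * (nested_norm s ds (\<lambda>x. ennreal D1 * enn_powr (?A x) \<theta>) 0 + nested_norm s ds (\<lambda>x. ennreal D2 * indicator ?Q x) 0)"
      by (intro mult_left_mono nested_norm_triangle s0) auto
    also have "nested_norm s ds (\<lambda>x. ennreal D1 * enn_powr (?A x) \<theta>) 0 = ennreal D1 * enn_powr (nested_norm q ds ?A 0) \<theta>"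
      by (subst nested_norm_cmult) (auto simp: s0 nested_norm_powr [OF th(1) sq q0(1)])
    also have "ennreal K1 * (ennreal D1 * enn_powr (nested_norm q ds ?A 0) \<theta> + nested_norm s ds (\<lambda>x. ennreal D2 * indicator ?Q x) 0)
      \<le> ennreal K1 * (ennreal D1 * ennreal ((C0 * (m * (3 * l) powr e)) powr \<theta>)
          + ennreal (l powr (\<Sum>j\<in>set ds. 1 / s $ j) * D2))"
    proof (intro mult_left_mono add_mono)
      have "nested_norm q ds ?A 0 \<le> ennreal C0 * nested_norm q ds ?h 0"
        by (intro C0 l h)
      also have "\<dots> \<le> ennreal C0 * ennreal (m * (3 * l) powr e)"
        using l by (intro mult_left_mono morrey) auto
      also have "\<dots> = ennreal (C0 * (m * (3 * l) powr e))"
        using C0 m by (simp add: ennreal_mult)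
      finally have "enn_powr (nested_norm q ds ?A 0) \<theta> \<le> enn_powr (ennreal (C0 * (m * (3 * l) powr e))) \<theta>"
        using th by (intro enn_powr_mono) auto
      then show "enn_powr (nested_norm q ds ?A 0) \<theta> \<le> ennreal ((C0 * (m * (3 * l) powr e)) powr \<theta>)"
        using C0 m by (simp add: enn_powr_ennreal)
      show "nested_norm s ds (\<lambda>x. ennreal D2 * indicator ?Q x) 0 \<le> ennreal (l powr (\<Sum>j\<in>set ds. 1 / s $ j) * D2)"
        using l s0 D ds by (intro nested_norm_le_const [where a = a]) (auto simp: indicator_def mem_box_cart)
    qed auto
    also have "\<dots> = ennreal (K1 * (D1 * (C0 * (m * (3 * l) powr e)) powr \<theta> + l powr (\<Sum>j\<in>UNIV. 1 / s $ j) * D2))"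
      using D K12 ds by (simp flip: ennreal_mult ennreal_plus)
    \<comment> \<open>The factor \<open>m powr (1 - \<theta>)\<close> from \<open>N\<close> and
      \<open>m powr \<theta>\<close> from the maximal function combine to \<open>m\<close>, and both
      summands scale with the same power of \<open>l\<close>.\<close>
    also have "K1 * (D1 * (C0 * (m * (3 * l) powr e)) powr \<theta> + l powr (\<Sum>j\<in>UNIV. 1 / s $ j) * D2)
      = K * m * l powr ((\<Sum>j\<in>UNIV. 1 / s $ j) - n / r)"
    proof -
      let ?E = "(\<Sum>j\<in>UNIV. 1 / s $ j) - c"
      have "(C0 * (m * (3 * l) powr e)) powr \<theta> = (C0 * 3 powr e) powr \<theta> * m powr \<theta> * l powr ?E"
        using C0 m l by (simp add: powr_mult powr_powr e' [symmetric] mult_ac)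
      moreover have "N powr (1 - \<theta>) = K2 powr (1 - \<theta>) * m powr (1 - \<theta>)"
        using K12 m by (simp add: N_def powr_mult)
      ultimately have "D1 * (C0 * (m * (3 * l) powr e)) powr \<theta>
        = scale_const \<alpha> c * K2 powr (1 - \<theta>) * (C0 * 3 powr e) powr \<theta> * (m powr (1 - \<theta>) * m powr \<theta>) * l powr ?E"
        by (simp add: D1_def mult_ac)
      moreover have "l powr (\<Sum>j\<in>UNIV. 1 / s $ j) * D2 = scale_const c c * K2 * m * l powr ?E"
        using l by (simp add: D2_def N_def powr_diff powr_minus field_simps)
      ultimately show ?thesis
        unfolding powr_split [OF m] by (simp add: K_def c_def [symmetric] algebra_simps)
    qed
    finally show "nested_norm s ds (\<lambda>x. potential \<alpha> G x * indicator ?Q x) 0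
        \<le> ennreal (K * m * l powr ((\<Sum>j\<in>UNIV. 1 / s $ j) - n / r))" .
  qed
qed

text \<open>Invariant: the function handed on is the \<open>b\<close>-th power of a norm. The
  exponent \<open>q $ i / b\<close> turns it into a \<open>q $ i\<close>-th power, and integration
  gives the \<open>q $ i\<close>-th power of the next norm, so \<open>b\<close> becomes
  \<open>q $ i\<close>.\<close>

lemma iterated_int_eq_nested_norm:
  fixes q :: "real ^ 'n"
  assumes q: "\<And>j. 0 < q $ j" and b: "0 < b"
  shows "iterated_int q b is (\<lambda>x. enn_powr (h x) b) x = nested_norm q is h x"
  using b
proof (induction "is" arbitrary: b h)
  case Nil
  then show ?case by (simp add: enn_powr_inverse_cancel')
next
  case (Cons i "is")
  have "(\<lambda>x. \<integral>\<^sup>+t. enn_powr (enn_powr (h (upd x i t)) b) (q $ i / b) \<partial>lebesgue)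
    = (\<lambda>x. enn_powr (slice_norm (q $ i) i h x) (q $ i))"
    using Cons.prems q [of i]
    by (simp add: enn_powr_powr nn_integral_completion slice_norm_def)
  then show ?case using Cons.IH [of "q $ i"] q [of i] by simp
qed

lemma mixed_norm_eq_nested_norm:
  fixes q :: "real ^ 'n::{finite,linorder}"
  assumes "\<And>j. 0 < q $ j"
  shows "mixed_norm q f = nested_norm q (sorted_list_of_set UNIV) (\<lambda>x. ennreal (norm (f x))) 0"
  using iterated_int_eq_nested_norm [of q 1 _ "\<lambda>x. ennreal (norm (f x))"] assms
  by (simp add: mixed_norm_def)

lemma measure_cube_powr:
  fixes a :: "real ^ 'n"
  assumes "0 < l"
  shows "measure lebesgue (cbox a (a + vec l)) powr (1 / p - 1 / real CARD('n) * S) = l powr (real CARD('n) / p - S)"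
proof -
  have "cbox a (a + vec l) \<noteq> {}" using assms by (simp add: interval_ne_empty_cart)
  from content_cbox_cart [OF this]
  have "measure lebesgue (cbox a (a + vec l)) = l ^ CARD('n)" by simp
  then show ?thesis
    using assms by (simp add: powr_realpow [symmetric] powr_powr right_diff_distrib)
qed

text \<open>Slices of a Lebesgue measurable function may fail to be measurable, and lines are null
  sets, so equality almost everywhere alone does not compare iterated integrals. A pointwise
  minorant does, as \<open>nn_integral\<close> is monotone without measurability. It is obtained by
  putting 0 on a Borel null set that contains all exceptional points.\<close>

lemma borel_minorant:
  fixes f :: "real ^ 'n \<Rightarrow> complex"
  assumes f: "f \<in> borel_measurable lebesgue"
  obtains g where "g \<in> borel_measurable borel" "AE x in lborel. f x = g x" "\<And>x. norm (g x) \<le> norm (f x)"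
proof -
  have "(\<lambda>x. Re (f x)) \<in> borel_measurable lebesgue" "(\<lambda>x. Im (f x)) \<in> borel_measurable lebesgue"
    using f by measurable
  from this [THEN completion_ex_borel_measurable_real]
  obtain u v where u [measurable]: "u \<in> borel_measurable lborel" "AE x in lborel. Re (f x) = u x"
    and v [measurable]: "v \<in> borel_measurable lborel" "AE x in lborel. Im (f x) = v x"
    by blast
  have "AE x in lborel. f x = Complex (u x) (v x)"
    using u(2) v(2) by eventually_elim (simp add: complex_eq_iff)
  from AE_E [OF this] obtain N where "{x \<in> space lborel. f x \<noteq> Complex (u x) (v x)} \<subseteq> N"
    "emeasure lborel N = 0" "N \<in> sets lborel" .
  then have N: "N \<in> null_sets lborel" "{x. f x \<noteq> Complex (u x) (v x)} \<subseteq> N" by auto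
  define g where "g x = (if x \<in> N then 0 else Complex (u x) (v x))" for x
  have [measurable]: "N \<in> sets borel" using N by auto
  have "g \<in> borel_measurable borel"
    unfolding g_def [abs_def] Complex_eq using u(1) v(1) by measurable
  moreover have "AE x in lborel. f x = g x"
    using AE_not_in [OF N(1)] by eventually_elim (use N(2) in \<open>auto simp: g_def\<close>)
  moreover have "norm (g x) \<le> norm (f x)" for x
  proof (cases "x \<in> N")
    case False
    then have "f x = Complex (u x) (v x)" using N(2) by auto
    then show ?thesis using False by (simp add: g_def)
  qed (simp add: g_def)
  ultimately show ?thesis using that by blast
qed

lemma frac_integrand_measurable:
  fixes f :: "real ^ 'n \<Rightarrow> complex"
  assumes [measurable]: "f \<in> borel_measurable M" and "sets borel \<subseteq> sets M" "space M = UNIV"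
  shows "frac_integrand \<alpha> f x \<in> borel_measurable M"
proof -
  have "(\<lambda>y. of_real (norm (x - y) powr (real CARD('n) - \<alpha>)) :: complex) \<in> borel_measurable borel"
    by measurable
  then have "(\<lambda>y. of_real (norm (x - y) powr (real CARD('n) - \<alpha>)) :: complex) \<in> borel_measurable M"
    using assms by (auto simp: measurable_def)
  then show ?thesis unfolding frac_integrand_def [abs_def] by measurable
qed

text \<open>Here equality almost everywhere is enough: for each \<open>x\<close> the two integrands
  agree for almost every \<open>y\<close>, so the integrals agree at every \<open>x\<close>. Where
  the potential is infinite the last claim is trivial.\<close>

lemma frac_int_borel_minorant:
  fixes f g :: "real ^ 'n \<Rightarrow> complex" and \<alpha> :: real
  assumes f: "f \<in> borel_measurable lebesgue" and g [measurable]: "g \<in> borel_measurable borel"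
    and ae: "AE x in lborel. f x = g x"
  defines "P \<equiv> potential \<alpha> (\<lambda>y. ennreal (norm (g y)))"
  shows "frac_int \<alpha> f = (\<lambda>x. LINT y|lborel. frac_integrand \<alpha> g x y)"
    and "P x < \<infinity> \<Longrightarrow> integrable lebesgue (frac_integrand \<alpha> f x)"
    and "ennreal (norm (frac_int \<alpha> f x)) \<le> P x"
proof -
  have mf: "frac_integrand \<alpha> f x \<in> borel_measurable lebesgue" for x
    by (rule frac_integrand_measurable [OF f]) auto
  have mg: "frac_integrand \<alpha> g x \<in> borel_measurable lborel" for x
    by (rule frac_integrand_measurable) auto
  then have mg': "frac_integrand \<alpha> g x \<in> borel_measurable lebesgue" for x
    by (rule measurable_completion)
  have eq: "AE y in lebesgue. frac_integrand \<alpha> f x y = frac_integrand \<alpha> g x y" for x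
    using AE_completion [OF ae] by eventually_elim (simp add: frac_integrand_def)
  show int: "frac_int \<alpha> f = (\<lambda>x. LINT y|lborel. frac_integrand \<alpha> g x y)"
    unfolding frac_int_def
    using integral_cong_AE [OF mf mg' eq] integral_completion [OF mg] by simp
  have P: "(\<integral>\<^sup>+y. ennreal (norm (frac_integrand \<alpha> g x y)) \<partial>lborel) = P x" for x
    unfolding P_def potential_def
    by (intro nn_integral_cong) (simp add: frac_integrand_def norm_divide flip: ennreal_mult)
  have ig: "integrable lborel (frac_integrand \<alpha> g x)" if "P x < \<infinity>" for x
    using that mg by (simp add: integrable_iff_bounded P)
  show "integrable lebesgue (frac_integrand \<alpha> f x)" if "P x < \<infinity>"
    using ig [OF that] integrable_cong_AE [OF mf mg' eq] integrable_completion [OF mg] by simp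
  show "ennreal (norm (frac_int \<alpha> f x)) \<le> P x"
  proof (cases "P x < \<infinity>")
    case True
    show ?thesis unfolding int P [symmetric] by (rule integral_norm_bound_ennreal [OF ig [OF True]])
  next
    case False
    then show ?thesis by (simp add: not_less top_unique)
  qed
qed

theorem theorem1p11:
  fixes q s :: "real ^ 'n::{finite,linorder}" and \<alpha> p r :: real
  assumes "0 < \<alpha>" and "\<alpha> < real CARD('n)"
    and "\<And>j. 1 < q $ j" and "\<And>j. 1 < s $ j"
    and "0 < p" and "0 < r"
    and "real CARD('n) / p \<le> (\<Sum>j\<in>UNIV. 1 / q $ j)"
    and "real CARD('n) / r \<le> (\<Sum>j\<in>UNIV. 1 / s $ j)"
    and "1 / r = 1 / p - \<alpha> / real CARD('n)"
    and "\<And>j. q $ j / p = s $ j / r"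
  shows "\<exists>C::real. 0 < C \<and> (\<forall>f\<in>morrey_space p q.
           (AE x in lebesgue. integrable lebesgue (frac_integrand \<alpha> f x)) \<and>
           frac_int \<alpha> f \<in> borel_measurable lebesgue \<and>
           morrey_norm r s (frac_int \<alpha> f) \<le> ennreal C * morrey_norm p q f)"
proof -
  define ds :: "'n list" where "ds = sorted_list_of_set UNIV"
  have ds: "distinct ds" "set ds = UNIV" by (simp_all add: ds_def)
  let ?n = "real CARD('n)" and ?Q = "\<lambda>(a :: real ^ 'n::{finite,linorder}) l. cbox a (a + vec l)"
  let ?S = "\<lambda>q. \<Sum>j\<in>UNIV. 1 / q $ j"
  have q0: "0 < q $ j" and s0: "0 < s $ j" "1 \<le> s $ j" for j
    using assms(3) [of j] assms(4) [of j] by auto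
  obtain C where C: "0 < C" and bound: "\<And>G m a l. G \<in> borel_measurable borel \<Longrightarrow> 0 \<le> m \<Longrightarrow>
    (\<And>a l. 0 < l \<Longrightarrow> nested_norm q ds (\<lambda>x. G x * indicator (?Q a l) x) 0 \<le> ennreal (m * l powr (?S q - ?n / p))) \<Longrightarrow>
    0 < l \<Longrightarrow> nested_norm s ds (\<lambda>x. potential \<alpha> G x * indicator (?Q a l) x) 0 \<le> ennreal (C * m * l powr (?S s - ?n / r))"
    using potential_morrey_bound [OF ds assms(1,2,3,4,5,6,9,10)] by blast
  show ?thesis
  proof (intro exI [of _ C] conjI ballI C)
    fix f assume "f \<in> morrey_space p q"
    then have f: "f \<in> borel_measurable lebesgue" and fin: "morrey_norm p q f < \<infinity>"
      by (auto simp: morrey_space_def)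
    obtain g where g [measurable]: "g \<in> borel_measurable borel" and ae: "AE x in lborel. f x = g x"
      and gf: "\<And>x. norm (g x) \<le> norm (f x)" using borel_minorant [OF f] by blast
    define G where "G x = ennreal (norm (g x))" for x
    have G [measurable]: "G \<in> borel_measurable borel" unfolding G_def by measurable
    define m where "m = enn2real (morrey_norm p q f)"
    have m: "morrey_norm p q f = ennreal m" "0 \<le> m" using fin by (simp_all add: m_def)
    have morrey: "nested_norm q ds (\<lambda>x. G x * indicator (?Q a l) x) 0 \<le> ennreal (m * l powr (?S q - ?n / p))"
      if l: "0 < l" for a l
    proof -
      let ?X = "mixed_norm q (\<lambda>x. indicator (?Q a l) x *\<^sub>R f x)"
      let ?Y = "nested_norm q ds (\<lambda>x. G x * indicator (?Q a l) x) 0"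
      have "?Y \<le> nested_norm q ds (\<lambda>x. ennreal (norm (indicator (?Q a l) x *\<^sub>R f x))) 0"
        using gf by (intro nested_norm_mono q0) (auto simp: G_def indicator_def intro: ennreal_leI)
      also have "\<dots> = ?X"
        using q0 by (simp add: mixed_norm_eq_nested_norm ds_def)
      finally have 1: "?Y \<le> ?X" .
      have "?Q a l \<in> cubes" using l by (auto simp: cubes_def)
      then have "ennreal (measure lebesgue (?Q a l) powr (1 / p - 1 / ?n * ?S q))
          * ?X \<le> ennreal m"
        unfolding m(1) [symmetric] morrey_norm_def by (rule SUP_upper)
      then have "ennreal (l powr (?n / p - ?S q)) * ?X \<le> ennreal m"
        unfolding measure_cube_powr [OF l] .
      then have "ennreal (l powr (?S q - ?n / p)) * (ennreal (l powr (?n / p - ?S q)) * ?X)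
        \<le> ennreal (l powr (?S q - ?n / p)) * ennreal m"
        by (rule mult_left_mono) simp
      moreover have "ennreal (l powr (?S q - ?n / p)) * ennreal (l powr (?n / p - ?S q)) = 1"
        using l by (simp flip: ennreal_mult powr_add)
      moreover have "ennreal (l powr (?S q - ?n / p)) * ennreal m = ennreal (m * l powr (?S q - ?n / p))"
        using m(2) by (subst ennreal_mult [symmetric]) (simp_all add: mult.commute)
      ultimately have "?X \<le> ennreal (m * l powr (?S q - ?n / p))"
        by (simp only: mult.assoc [symmetric] mult_1_left)
      with 1 show ?thesis by (rule order.trans)
    qed
    have P [measurable]: "potential \<alpha> G \<in> borel_measurable borel" by (rule borel_measurable_potential [OF G])
    note pot = bound [OF G m(2) morrey]
    note fi = frac_int_borel_minorant [OF f g ae, where \<alpha> = \<alpha>, folded G_def]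
    \<comment> \<open>By Hoelder's inequality the bound on the s-norm makes the potential integrable
      over each cube, hence finite almost everywhere there; countably many cubes exhaust the
      space.\<close>
    have "AE x in lborel. potential \<alpha> G x < \<infinity>"
    proof -
      have "AE x in lborel. x \<in> ?Q (- vec (real (Suc k))) (2 * real (Suc k)) \<longrightarrow> potential \<alpha> G x < \<infinity>" for k
      proof -
        let ?B = "?Q (- vec (real (Suc k))) (2 * real (Suc k))"
        have "(\<integral>\<^sup>+y. potential \<alpha> G y * indicator ?B y \<partial>lborel)
          \<le> ennreal ((2 * real (Suc k)) powr (?n - ?S s)) * nested_norm s ds (\<lambda>y. potential \<alpha> G y * indicator ?B y) 0"
          by (intro nn_integral_cube_le ds P s0) simp
        also have "\<dots> \<le> ennreal ((2 * real (Suc k)) powr (?n - ?S s)) * ennreal (C * m * (2 * real (Suc k)) powr (?S s - ?n / r))"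
          by (intro mult_left_mono pot) simp_all
        also have "\<dots> < \<infinity>" by (simp add: ennreal_mult_less_top)
        finally have "AE y in lborel. potential \<alpha> G y * indicator ?B y \<noteq> \<infinity>"
          by (intro nn_integral_PInf_AE) auto
        then show ?thesis by eventually_elim (auto simp: less_top)
      qed
      then have "AE x in lborel. \<forall>k. x \<in> ?Q (- vec (real (Suc k))) (2 * real (Suc k)) \<longrightarrow> potential \<alpha> G x < \<infinity>"
        unfolding AE_all_countable by blast
      then show ?thesis
      proof eventually_elim
        case (elim x)
        obtain k :: nat where k: "norm x \<le> real k" using real_arch_simple by blast
        have "- real (Suc k) \<le> x $ j" "x $ j \<le> - real (Suc k) + 2 * real (Suc k)" for j
          using component_le_norm_cart [of x j] k by auto
        then have "x \<in> ?Q (- vec (real (Suc k))) (2 * real (Suc k))"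
          unfolding mem_box_cart vector_add_component vector_uminus_component vec_component by blast
        then show ?case using elim by blast
      qed
    qed
    then have "AE x in lebesgue. potential \<alpha> G x < \<infinity>" by (rule AE_completion)
    then show "AE x in lebesgue. integrable lebesgue (frac_integrand \<alpha> f x)"
      by eventually_elim (rule fi(2))
    show "frac_int \<alpha> f \<in> borel_measurable lebesgue"
    proof -
      have "(\<lambda>(x, y). frac_integrand \<alpha> g x y) \<in> borel_measurable (borel \<Otimes>\<^sub>M lborel)"
        unfolding frac_integrand_def by measurable
      from lborel.borel_measurable_lebesgue_integral [OF this]
      have "(\<lambda>x. LINT y|lborel. frac_integrand \<alpha> g x y) \<in> borel_measurable lborel" by simp
      then show ?thesis unfolding fi(1) by (rule measurable_completion)
    qed
    show "morrey_norm r s (frac_int \<alpha> f) \<le> ennreal C * morrey_norm p q f"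
      unfolding morrey_norm_def [of r]
    proof (rule SUP_least)
      fix Q :: "(real ^ 'n::{finite,linorder}) set" assume "Q \<in> cubes"
      then obtain a l where Q: "Q = ?Q a l" and l: "0 < l" by (auto simp: cubes_def)
      let ?X = "mixed_norm s (\<lambda>x. indicator Q x *\<^sub>R frac_int \<alpha> f x)"
      have "?X
        = nested_norm s ds (\<lambda>x. ennreal (norm (indicator Q x *\<^sub>R frac_int \<alpha> f x))) 0"
        using s0 by (simp add: mixed_norm_eq_nested_norm ds_def)
      also have "\<dots> \<le> nested_norm s ds (\<lambda>x. potential \<alpha> G x * indicator (?Q a l) x) 0"
        using fi(3) by (intro nested_norm_mono s0) (auto simp: Q indicator_def)
      also have "\<dots> \<le> ennreal (C * m * l powr (?S s - ?n / r))" by (rule pot [OF _ l])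
      finally have "ennreal (l powr (?n / r - ?S s)) * ?X
        \<le> ennreal (l powr (?n / r - ?S s)) * ennreal (C * m * l powr (?S s - ?n / r))"
        by (rule mult_left_mono) simp
      also have "\<dots> = ennreal (C * m * (l powr (?n / r - ?S s) * l powr (?S s - ?n / r)))"
        using C m by (subst ennreal_mult [symmetric]) (auto simp: mult_ac)
      also have "l powr (?n / r - ?S s) * l powr (?S s - ?n / r) = 1"
        using l by (simp flip: powr_add)
      finally show "ennreal (measure lebesgue Q powr (1 / r - 1 / real CARD('n) * (\<Sum>j\<in>UNIV. 1 / s $ j)))
          * ?X \<le> ennreal C * morrey_norm p q f"
        unfolding Q measure_cube_powr [OF l] m(1) using C m by (simp add: ennreal_mult)
    qed
  qed
qed

end
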